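(* Let $k\ge0$ and $\Delta(T)=T_1\cdots T_n$. (1) For each $\eta\in\mathbb N_0^n$ there is $a_\eta\in\mathbb R$ such that $\Delta(T)E_\eta=a_\eta E_{\eta-\underline1}$ if $\eta_i\ge1$ for all $i$, and $\Delta(T)E_\eta=0$ (set $a_\eta=0$) if $\eta_i=0$ for some $i$. (2) The map $\eta\mapsto a_\eta$ is $\mathcal S_n$-invariant. (3) $\Delta(T)L_\eta=d_\eta L_{\eta-\underline1}$ for $\eta\in\mathbb N_0^n$ and $\Delta(T)C_\lambda=d_\lambda C_{\lambda-\underline1}$ for $\lambda\in\Lambda_n^+$, where $d_\eta=\frac{|\eta|!}{|\eta-\underline1|!}$ if $\eta_i\ne0$ for all $i$, and $d_\eta=0$ otherwise (the right-hand side being $0$ in that case). (4) Let $p\le q+1$, $\mu\in\mathbb C^p$, $\nu\in\mathbb C^q$ with $\nu_i\notin\{0,k,\dots,k(n-1)\}-\mathbb N_0$ for all $i$, and $w\in\mathbb C^n$. Then, with $\Delta(T)$ acting in the second variable (on the domain where the series converge), $$\Delta(T)\,{}_pK_q(\mu;\nu;w,\cdot)=\frac{[\mu]_{\underline1}}{[\nu]_{\underline1}}\,\Delta(w)\,{}_pK_q(\mu+\underline1;\nu+\underline1;w,\cdot),$$ where $\mu+\underline1,\nu+\underline1$ mean adding $1$ to each component, $[\mu]_{\underline1}=1$ if $p=0$ and $[\nu]_{\underline1}=1$ if $q=0$. The same identity holds with ${}_pF_q$ in place of ${}_pK_q$.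
   Context: $s_{ij}$ transposition of coordinates; Dunkl operators $T_\xi f(x)=\partial_\xi f(x)+k\sum_{i<j}(\xi_i-\xi_j)\frac{f(x)-f(s_{ij}x)}{x_i-x_j}$, $T_j=T_{e_j}$ (commuting). $\underline1=(1,\dots,1)$; $\Delta(w)=\prod w_j$; $[\mu]_\eta=\prod_{j=1}^n(\mu-k(j-1))_{\eta_j}$ and for vectors $[\mu]_\lambda=\prod_i[\mu_i]_\lambda$. Jack polynomials: $\Lambda_n^+$ partitions of length $\le n$; $\eta_+$ decreasing rearrangement, $|\eta|=\sum\eta_i$. Order $\prec$ on $\mathbb N_0^n$: $\kappa\prec\eta$ iff $\kappa_+$ strictly below $\eta_+$ in dominance order, or $\kappa_+=\eta_+$ and $w_\eta<w_\kappa$ in Bruhat order ($w_\eta$ shortest permutation with $w_\eta\eta_+=\eta$). With $\mathcal D_j=x_jT_j+k(1-n)+k\sum_{i>j}s_{ij}$, $\overline\eta_j=\eta_j-k\#\{i<j:\eta_i\ge\eta_j\}-k\#\{i>j:\eta_i>\eta_j\}$, $E_\eta$ is the unique polynomial $x^\eta+\sum_{\kappa\prec\eta}c_{\eta\kappa}x^\kappa$ with $\mathcal D_jE_\eta=\overline\eta_jE_\eta$. Let $c_\eta$ be the unique scalars with $(z_1+\dots+z_n)^m=\sum_{|\eta|=m}c_\eta E_\eta(z)$ for all $m$, $L_\eta=c_\eta E_\eta$, $C_\lambda=\sum_{\eta\in\mathcal S_n\lambda}L_\eta$. ${}_pK_q(\mu;\nu;z,w)=\sum_{\eta\in\mathbb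 N_0^n}\frac{[\mu]_{\eta_+}}{[\nu]_{\eta_+}}\frac{L_\eta(z)L_\eta(w)}{|\eta|!L_\eta(\underline1)}$, ${}_pF_q(\mu;\nu;z,w)=\sum_{\lambda\in\Lambda_n^+}\frac{[\mu]_\lambda}{[\nu]_\lambda}\frac{C_\lambda(z)C_\lambda(w)}{|\lambda|!C_\lambda(\underline1)}$ (entire if $p\le q$, convergent for $\|z\|_\infty\|w\|_\infty<1$ if $p=q+1$). *)

theory Defs
  imports "HOL-Analysis.Analysis" "HOL-Combinatorics.Permutations"
begin

text \<open>Conventions: n is the number of variables; coordinates are indexed 0..n-1.
 Points are functions nat => complex (only coordinates < n matter); multi-indices
 in N_0^n are functions nat => nat vanishing from n on. k :: real is the Dunkl
 parameter.\<close>

definition multi_idx :: "nat \<Rightarrow> (nat \<Rightarrow> nat) set" where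
  "multi_idx n = {\<eta>. \<forall>i\<ge>n. \<eta> i = 0}"

definition absv :: "nat \<Rightarrow> (nat \<Rightarrow> nat) \<Rightarrow> nat" where
  "absv n \<eta> = (\<Sum>i<n. \<eta> i)"

definition is_partition :: "nat \<Rightarrow> (nat \<Rightarrow> nat) \<Rightarrow> bool" where
  "is_partition n lam \<longleftrightarrow> lam \<in> multi_idx n \<and> (\<forall>i j. i \<le> j \<longrightarrow> j < n \<longrightarrow> lam j \<le> lam i)"

definition plus_part :: "nat \<Rightarrow> (nat \<Rightarrow> nat) \<Rightarrow> (nat \<Rightarrow> nat)" where
  "plus_part n \<eta> = (THE lam. is_partition n lam \<and> (\<exists>\<sigma>. \<sigma> permutes {..<n} \<and> lam = \<eta> \<circ> \<sigma>))"

definition dom_lt :: "nat \<Rightarrow> (nat \<Rightarrow> nat) \<Rightarrow> (nat \<Rightarrow> nat) \<Rightarrow> bool" where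
  "dom_lt n lam \<mu> \<longleftrightarrow> absv n lam = absv n \<mu> \<and>
     (\<forall>m\<le>n. (\<Sum>i<m. lam i) \<le> (\<Sum>i<m. \<mu> i)) \<and> lam \<noteq> \<mu>"

definition swp :: "nat \<Rightarrow> nat \<Rightarrow> nat \<Rightarrow> nat" where
  "swp i j = (\<lambda>m. if m = i then j else if m = j then i else m)"

definition inversions :: "nat \<Rightarrow> (nat \<Rightarrow> nat) \<Rightarrow> nat" where
  "inversions n w = card {(i, j). i < j \<and> j < n \<and> w j < w i}"

definition bruhat_step :: "nat \<Rightarrow> (nat \<Rightarrow> nat) \<Rightarrow> (nat \<Rightarrow> nat) \<Rightarrow> bool" where
  "bruhat_step n u v \<longleftrightarrow> u permutes {..<n} \<and>
     (\<exists>i j. i < j \<and> j < n \<and> v = u \<circ> swp i j \<and> inversions n u < inversions n v)"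

definition bruhat_lt :: "nat \<Rightarrow> (nat \<Rightarrow> nat) \<Rightarrow> (nat \<Rightarrow> nat) \<Rightarrow> bool" where
  "bruhat_lt n = tranclp (bruhat_step n)"

definition perm_act :: "(nat \<Rightarrow> nat) \<Rightarrow> (nat \<Rightarrow> 'a) \<Rightarrow> (nat \<Rightarrow> 'a)" where
  "perm_act w \<eta> = \<eta> \<circ> inv w"

definition w_perm :: "nat \<Rightarrow> (nat \<Rightarrow> nat) \<Rightarrow> (nat \<Rightarrow> nat)" where
  "w_perm n \<eta> = (THE w. w permutes {..<n} \<and> perm_act w (plus_part n \<eta>) = \<eta> \<and>
      (\<forall>w'. w' permutes {..<n} \<and> perm_act w' (plus_part n \<eta>) = \<eta> \<longrightarrow>
             inversions n w \<le> inversions n w'))"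

definition prec :: "nat \<Rightarrow> (nat \<Rightarrow> nat) \<Rightarrow> (nat \<Rightarrow> nat) \<Rightarrow> bool" where
  "prec n \<kappa> \<eta> \<longleftrightarrow> dom_lt n (plus_part n \<kappa>) (plus_part n \<eta>) \<or>
     (plus_part n \<kappa> = plus_part n \<eta> \<and> bruhat_lt n (w_perm n \<eta>) (w_perm n \<kappa>))"

definition monom :: "nat \<Rightarrow> (nat \<Rightarrow> nat) \<Rightarrow> (nat \<Rightarrow> complex) \<Rightarrow> complex" where
  "monom n \<eta> x = (\<Prod>i<n. x i ^ \<eta> i)"

definition sw_pt :: "nat \<Rightarrow> nat \<Rightarrow> (nat \<Rightarrow> complex) \<Rightarrow> (nat \<Rightarrow> complex)" where
  "sw_pt i j x = x \<circ> swp i j"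

definition dir_deriv :: "(nat \<Rightarrow> complex) \<Rightarrow> ((nat \<Rightarrow> complex) \<Rightarrow> complex) \<Rightarrow> (nat \<Rightarrow> complex) \<Rightarrow> complex" where
  "dir_deriv \<xi> f x = deriv (\<lambda>t. f (\<lambda>m. x m + t * \<xi> m)) 0"

definition unit_vec :: "nat \<Rightarrow> nat \<Rightarrow> complex" where
  "unit_vec j = (\<lambda>m. if m = j then 1 else 0)"

text \<open>difference quotient (f(x) - f(s_ij x)) / (x_i - x_j), extended continuously to
 the hyperplane x_i = x_j (where it equals (d_i - d_j) f (x) for C^1 functions)\<close>
definition diff_quot :: "nat \<Rightarrow> nat \<Rightarrow> ((nat \<Rightarrow> complex) \<Rightarrow> complex) \<Rightarrow> (nat \<Rightarrow> complex) \<Rightarrow> complex" where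
  "diff_quot i j f x = (if x i \<noteq> x j then (f x - f (sw_pt i j x)) / (x i - x j)
      else dir_deriv (unit_vec i) f x - dir_deriv (unit_vec j) f x)"

definition dunkl :: "nat \<Rightarrow> real \<Rightarrow> (nat \<Rightarrow> complex) \<Rightarrow> ((nat \<Rightarrow> complex) \<Rightarrow> complex) \<Rightarrow> (nat \<Rightarrow> complex) \<Rightarrow> complex" where
  "dunkl n k \<xi> f x = dir_deriv \<xi> f x +
     of_real k * (\<Sum>(i, j)\<in>{(i, j). i < j \<and> j < n}. (\<xi> i - \<xi> j) * diff_quot i j f x)"

definition dunkl_Delta :: "nat \<Rightarrow> real \<Rightarrow> ((nat \<Rightarrow> complex) \<Rightarrow> complex) \<Rightarrow> (nat \<Rightarrow> complex) \<Rightarrow> complex" where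
  "dunkl_Delta n k f = foldr (\<lambda>j g. dunkl n k (unit_vec j) g) [0..<n] f"

definition cher_D :: "nat \<Rightarrow> real \<Rightarrow> nat \<Rightarrow> ((nat \<Rightarrow> complex) \<Rightarrow> complex) \<Rightarrow> (nat \<Rightarrow> complex) \<Rightarrow> complex" where
  "cher_D n k j f x = x j * dunkl n k (unit_vec j) f x + of_real k * (1 - of_nat n) * f x
     + of_real k * (\<Sum>i\<in>{j<..<n}. f (sw_pt i j x))"

definition eigval :: "nat \<Rightarrow> real \<Rightarrow> (nat \<Rightarrow> nat) \<Rightarrow> nat \<Rightarrow> real" where
  "eigval n k \<eta> j = real (\<eta> j) - k * real (card {i. i < j \<and> \<eta> j \<le> \<eta> i})
      - k * real (card {i. j < i \<and> i < n \<and> \<eta> j < \<eta> i})"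

definition jackE :: "nat \<Rightarrow> real \<Rightarrow> (nat \<Rightarrow> nat) \<Rightarrow> (nat \<Rightarrow> complex) \<Rightarrow> complex" where
  "jackE n k \<eta> = (THE f. (\<exists>c. f = (\<lambda>x. monom n \<eta> x +
        (\<Sum>\<kappa>\<in>{\<kappa>\<in>multi_idx n. prec n \<kappa> \<eta>}. c \<kappa> * monom n \<kappa> x))) \<and>
      (\<forall>j<n. \<forall>x. cher_D n k j f x = of_real (eigval n k \<eta> j) * f x))"

definition coefs :: "nat \<Rightarrow> real \<Rightarrow> nat \<Rightarrow> (nat \<Rightarrow> nat) \<Rightarrow> complex" where
  "coefs n k m = (THE c. (\<forall>\<kappa>. \<kappa> \<notin> {\<kappa>\<in>multi_idx n. absv n \<kappa> = m} \<longrightarrow> c \<kappa> = 0) \<and>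
      (\<forall>z. (\<Sum>i<n. z i) ^ m = (\<Sum>\<kappa>\<in>{\<kappa>\<in>multi_idx n. absv n \<kappa> = m}. c \<kappa> * jackE n k \<kappa> z)))"

definition jackL :: "nat \<Rightarrow> real \<Rightarrow> (nat \<Rightarrow> nat) \<Rightarrow> (nat \<Rightarrow> complex) \<Rightarrow> complex" where
  "jackL n k \<eta> z = coefs n k (absv n \<eta>) \<eta> * jackE n k \<eta> z"

definition jackC :: "nat \<Rightarrow> real \<Rightarrow> (nat \<Rightarrow> nat) \<Rightarrow> (nat \<Rightarrow> complex) \<Rightarrow> complex" where
  "jackC n k lam z = (\<Sum>\<eta>\<in>{\<eta>\<in>multi_idx n. plus_part n \<eta> = lam}. jackL n k \<eta> z)"

definition one_vec :: "nat \<Rightarrow> complex" where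
  "one_vec = (\<lambda>_. 1)"

definition gpoch :: "nat \<Rightarrow> real \<Rightarrow> nat \<Rightarrow> (nat \<Rightarrow> complex) \<Rightarrow> (nat \<Rightarrow> nat) \<Rightarrow> complex" where
  "gpoch n k p \<mu> lam = (\<Prod>i<p. \<Prod>j<n. pochhammer (\<mu> i - of_real k * of_nat j) (lam j))"

definition hypK :: "nat \<Rightarrow> real \<Rightarrow> nat \<Rightarrow> nat \<Rightarrow> (nat \<Rightarrow> complex) \<Rightarrow> (nat \<Rightarrow> complex)
     \<Rightarrow> (nat \<Rightarrow> complex) \<Rightarrow> (nat \<Rightarrow> complex) \<Rightarrow> complex" where
  "hypK n k p q \<mu> \<nu> z w = infsum (\<lambda>\<eta>.
      gpoch n k p \<mu> (plus_part n \<eta>) / gpoch n k q \<nu> (plus_part n \<eta>) *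
      (jackL n k \<eta> z * jackL n k \<eta> w / (fact (absv n \<eta>) * jackL n k \<eta> one_vec))) (multi_idx n)"

definition hypF :: "nat \<Rightarrow> real \<Rightarrow> nat \<Rightarrow> nat \<Rightarrow> (nat \<Rightarrow> complex) \<Rightarrow> (nat \<Rightarrow> complex)
     \<Rightarrow> (nat \<Rightarrow> complex) \<Rightarrow> (nat \<Rightarrow> complex) \<Rightarrow> complex" where
  "hypF n k p q \<mu> \<nu> z w = infsum (\<lambda>lam.
      gpoch n k p \<mu> lam / gpoch n k q \<nu> lam *
      (jackC n k lam z * jackC n k lam w / (fact (absv n lam) * jackC n k lam one_vec)))
      {lam. is_partition n lam}"

definition supnorm :: "nat \<Rightarrow> (nat \<Rightarrow> complex) \<Rightarrow> real" where
  "supnorm n z = Max ((\<lambda>i. cmod (z i)) ` {..<n})"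

definition conv_dom :: "nat \<Rightarrow> nat \<Rightarrow> nat \<Rightarrow> (nat \<Rightarrow> complex) \<Rightarrow> (nat \<Rightarrow> complex) set" where
  "conv_dom n p q w = (if p \<le> q then UNIV else {z. supnorm n z * supnorm n w < 1})"

definition minus_one :: "(nat \<Rightarrow> nat) \<Rightarrow> (nat \<Rightarrow> nat)" where
  "minus_one \<eta> = (\<lambda>i. \<eta> i - 1)"

definition d_coef :: "nat \<Rightarrow> (nat \<Rightarrow> nat) \<Rightarrow> complex" where
  "d_coef n \<eta> = (if \<forall>i<n. \<eta> i \<noteq> 0
     then of_nat (fact (absv n \<eta>)) / of_nat (fact (absv n (minus_one \<eta>))) else 0)"

end

theory Submission
  imports Defs "HOL-Complex_Analysis.Complex_Analysis" "HOL-Library.Function_Algebras"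
begin

text \<open>
  The nonsymmetric Jack polynomials are built from 1 by the Knop-Sahi recursion: a raising operator
  (multiply by the last coordinate after a cyclic shift) and adjacent transpositions corrected by a
  multiple of the identity. Triangularity of the Cherednik operators and the separation of their
  spectra identify the result with the polynomials of the definition and show that all coefficients
  are nonnegative. The lowering operator, a cyclic shift followed by one Dunkl operator, undoes raising
  up to a scalar and kills the Jack polynomials whose index ends in 0; its \<open>n\<close>-th power is the product
  of all Dunkl operators. Applied to the powers of the coordinate sum it yields a recursion for the
  coefficients \<open>c\<close>, and in the normalization \<open>L\<close> the scalar is just the degree. So the product of the
  Dunkl operators acts on every convergent series in the \<open>L\<close> by a shift of the coefficients, and all
  parts of the theorem are instances of this formula: the first three for finite sums, the last one
  for the hypergeometric series. For their convergence, nonnegativity bounds the \<open>L\<close> on polydiscs by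
  the values at the all-one vector, the recursion bounds these values by a product over the entries
  of the index, and the ratio test applies to each entry.
\<close>

subsection \<open>Compositions and their decreasing rearrangements\<close>

lemma swp_eq_transpose: "swp i j = Transposition.transpose i j"
  by (auto simp: fun_eq_iff swp_def Transposition.transpose_def)

lemma swp_permutes: "i < n \<Longrightarrow> j < n \<Longrightarrow> swp i j permutes {..<n}"
  unfolding swp_eq_transpose by (rule permutes_swap_id) auto

lemma swp_permutes_UNIV: "swp i j permutes UNIV"
  unfolding swp_eq_transpose by (rule permutes_swap_id) auto

lemma swp_simps [simp]: "swp i j i = j" "swp i j j = i" "m \<noteq> i \<Longrightarrow> m \<noteq> j \<Longrightarrow> swp i j m = m"
  "swp i j (swp i j m) = m"
  by (auto simp: swp_def)

lemma swp_commute: "swp i j = swp j i"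
  by (auto simp: swp_def fun_eq_iff)

lemma comp_swp_swp [simp]: "f \<circ> swp i j \<circ> swp i j = f"
  by (auto simp: fun_eq_iff)

lemma permutes_comp_swp: "\<sigma> permutes S \<Longrightarrow> \<sigma> \<circ> swp i j = swp (\<sigma> i) (\<sigma> j) \<circ> \<sigma>"
  by (auto simp: fun_eq_iff swp_def inj_eq[OF permutes_inj])

lemma permutes_lessThan_iff: "\<sigma> permutes {..<n} \<Longrightarrow> \<sigma> i < n \<longleftrightarrow> i < n"
  using permutes_in_image[of \<sigma> "{..<n}" i] by simp

lemma multi_idx_comp: "\<eta> \<in> multi_idx n \<Longrightarrow> \<sigma> permutes {..<n} \<Longrightarrow> \<eta> \<circ> \<sigma> \<in> multi_idx n"
  by (auto simp: multi_idx_def permutes_def)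

lemma absv_comp: "\<sigma> permutes {..<n} \<Longrightarrow> absv n (\<eta> \<circ> \<sigma>) = absv n \<eta>"
  unfolding absv_def using sum.permute[of \<sigma> "{..<n}" \<eta>] by simp

lemma multi_idx_eqI:
  assumes "\<eta> \<in> multi_idx n" "\<kappa> \<in> multi_idx n" "\<And>i. i < n \<Longrightarrow> \<eta> i = \<kappa> i"
  shows "\<eta> = \<kappa>"
proof
  show "\<eta> i = \<kappa> i" for i using assms by (cases "i < n") (auto simp: multi_idx_def)
qed

lemma zero_multi_idx: "(\<lambda>_. 0) \<in> multi_idx n"
  by (simp add: multi_idx_def)

lemma absv_zero: "absv n (\<lambda>_. 0) = 0"
  by (simp add: absv_def)

definition deg_idx :: "nat \<Rightarrow> nat \<Rightarrow> (nat \<Rightarrow> nat) set" where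
  "deg_idx n m = {\<kappa> \<in> multi_idx n. absv n \<kappa> = m}"

lemma deg_idx_multi: "\<kappa> \<in> deg_idx n m \<Longrightarrow> \<kappa> \<in> multi_idx n"
  by (simp add: deg_idx_def)

lemma deg_idx_absv: "\<eta> \<in> multi_idx n \<Longrightarrow> \<eta> \<in> deg_idx n (absv n \<eta>)"
  by (simp add: deg_idx_def)

lemma deg_idx_comp: "\<eta> \<in> deg_idx n m \<Longrightarrow> \<sigma> permutes {..<n} \<Longrightarrow> \<eta> \<circ> \<sigma> \<in> deg_idx n m"
  by (simp add: deg_idx_def multi_idx_comp absv_comp)

lemma finite_deg_idx [simp]: "finite (deg_idx n m)"
proof (rule finite_subset)
  show "deg_idx n m \<subseteq> {f. \<forall>x. (x \<in> {..<n} \<longrightarrow> f x \<in> {..m}) \<and> (x \<notin> {..<n} \<longrightarrow> f x = 0)}"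
    unfolding deg_idx_def multi_idx_def absv_def
    by (auto simp: not_less) (metis finite_lessThan lessThan_iff member_le_sum zero_le)
  show "finite {f. \<forall>x. (x \<in> {..<n} \<longrightarrow> f x \<in> {..m}) \<and> (x \<notin> {..<n} \<longrightarrow> f x = (0::nat))}"
    by (rule finite_set_of_finite_funs) auto
qed

lemma deg_idx_zero: "deg_idx n 0 = {\<lambda>_. 0}"
  by (auto simp: deg_idx_def absv_def multi_idx_def fun_eq_iff) (metis lessThan_iff not_less)

lemma partition_comp_unique:
  assumes lam: "is_partition n lam" and comp: "is_partition n (lam \<circ> \<sigma>)" and \<sigma>: "\<sigma> permutes {..<n}"
  shows "lam \<circ> \<sigma> = lam"
proof -
  have sorted: "sorted (rev (map l [0..<n]))" if "is_partition n l" for l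
    using that unfolding sorted_wrt_rev by (auto simp: is_partition_def sorted_wrt_iff_nth_less)
  have "mset (map (lam \<circ> \<sigma>) [0..<n]) = image_mset lam (image_mset \<sigma> (mset_set {..<n}))"
    by (simp add: multiset.map_comp atLeast0LessThan)
  also have "\<dots> = mset (map lam [0..<n])"
    by (simp add: permutes_image_mset[OF \<sigma>] atLeast0LessThan)
  finally have "rev (map (lam \<circ> \<sigma>) [0..<n]) = rev (map lam [0..<n])"
    using sorted[OF lam] sorted[OF comp] by (metis mset_rev properties_for_sort)
  then have "(lam \<circ> \<sigma>) i = lam i" if "i < n" for i
    using that by (simp add: map_eq_conv)
  then show ?thesis
    using lam comp by (intro multi_idx_eqI) (auto simp: is_partition_def)
qed

lemma plus_part_eqI:
  assumes "\<eta> \<in> multi_idx n" and \<sigma>: "\<sigma> permutes {..<n}" and part: "is_partition n (\<eta> \<circ> \<sigma>)"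
  shows "plus_part n \<eta> = \<eta> \<circ> \<sigma>"
  unfolding plus_part_def
proof (rule the_equality)
  show "is_partition n (\<eta> \<circ> \<sigma>) \<and> (\<exists>\<tau>. \<tau> permutes {..<n} \<and> \<eta> \<circ> \<sigma> = \<eta> \<circ> \<tau>)" using \<sigma> part by blast
  fix lam assume "is_partition n lam \<and> (\<exists>\<tau>. \<tau> permutes {..<n} \<and> lam = \<eta> \<circ> \<tau>)"
  then obtain \<tau> where lam: "is_partition n lam" and \<tau>: "\<tau> permutes {..<n}" "lam = \<eta> \<circ> \<tau>" by blast
  have "(\<eta> \<circ> \<sigma>) \<circ> (inv \<sigma> \<circ> \<tau>) = lam" using \<tau> \<sigma> by (auto simp: fun_eq_iff permutes_inverses)
  then show "lam = \<eta> \<circ> \<sigma>"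
    using partition_comp_unique[OF part, of "inv \<sigma> \<circ> \<tau>"] lam \<tau> \<sigma>
    by (simp add: permutes_compose permutes_inv)
qed

lemma plus_part_partition: "is_partition n lam \<Longrightarrow> plus_part n lam = lam"
  using plus_part_eqI[of lam n id] by (simp add: is_partition_def permutes_id)

subsection \<open>The rank of an entry in the decreasing rearrangement\<close>

definition sorts_before :: "(nat \<Rightarrow> nat) \<Rightarrow> nat \<Rightarrow> nat \<Rightarrow> bool" where
  "sorts_before \<eta> i j \<longleftrightarrow> \<eta> j < \<eta> i \<or> (\<eta> i = \<eta> j \<and> i < j)"

text \<open>The inverse of this permutation is the shortest permutation taking the partition of \<open>\<eta>\<close> to \<open>\<eta>\<close>.\<close>

definition sort_rank :: "nat \<Rightarrow> (nat \<Rightarrow> nat) \<Rightarrow> nat \<Rightarrow> nat" where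
  "sort_rank n \<eta> j = (if j < n then card {i. i < n \<and> sorts_before \<eta> i j} else j)"

lemma sorts_before_trans: "sorts_before \<eta> i j \<Longrightarrow> sorts_before \<eta> j l \<Longrightarrow> sorts_before \<eta> i l"
  unfolding sorts_before_def by auto

lemma sorts_before_irrefl: "\<not> sorts_before \<eta> i i"
  unfolding sorts_before_def by auto

lemma sorts_before_total: "i \<noteq> j \<Longrightarrow> sorts_before \<eta> i j \<or> sorts_before \<eta> j i"
  unfolding sorts_before_def by auto

lemma sort_rank_less_iff:
  assumes "i < n" "j < n" shows "sort_rank n \<eta> i < sort_rank n \<eta> j \<longleftrightarrow> sorts_before \<eta> i j"
proof -
  have mono: "sort_rank n \<eta> i < sort_rank n \<eta> j" if "sorts_before \<eta> i j" "i < n" "j < n" for i j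
  proof -
    have "{l. l < n \<and> sorts_before \<eta> l i} \<subset> {l. l < n \<and> sorts_before \<eta> l j}"
      using that sorts_before_trans sorts_before_irrefl by blast
    then show ?thesis using that unfolding sort_rank_def by (simp add: psubset_card_mono)
  qed
  show ?thesis
    using mono[of i j] mono[of j i] sorts_before_total[of i j \<eta>] assms by fastforce
qed

lemma sort_rank_permutes: "sort_rank n \<eta> permutes {..<n}"
proof (rule bij_imp_permutes)
  have inj: "inj_on (sort_rank n \<eta>) {..<n}"
    by (rule inj_onI) (metis sorts_before_total lessThan_iff less_irrefl sort_rank_less_iff)
  have sub: "sort_rank n \<eta> ` {..<n} \<subseteq> {..<n}"
  proof clarsimp
    fix j assume "j < n"
    then have "{i. i < n \<and> sorts_before \<eta> i j} \<subset> {..<n}" using sorts_before_irrefl by auto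
    then have "card {i. i < n \<and> sorts_before \<eta> i j} < card {..<n}" by (intro psubset_card_mono) auto
    then show "sort_rank n \<eta> j < n" using \<open>j < n\<close> by (simp add: sort_rank_def)
  qed
  show "bij_betw (sort_rank n \<eta>) {..<n} {..<n}"
    unfolding bij_betw_def using inj sub by (simp add: endo_inj_surj)
qed (auto simp: sort_rank_def)

lemma sort_rank_less: "j < n \<Longrightarrow> sort_rank n \<eta> j < n"
  by (simp add: permutes_lessThan_iff sort_rank_permutes)

lemma sort_rank_eqI:
  assumes \<sigma>: "\<sigma> permutes {..<n}"
    and order: "\<And>i j. i < n \<Longrightarrow> j < n \<Longrightarrow> sorts_before \<eta> i j \<Longrightarrow> \<sigma> i < \<sigma> j"
  shows "sort_rank n \<eta> = \<sigma>"
proof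
  have order_iff: "\<sigma> i < \<sigma> j \<longleftrightarrow> sorts_before \<eta> i j" if "i < n" "j < n" for i j
    using order[of i j] order[of j i] sorts_before_total[of i j \<eta>] that by force
  fix j show "sort_rank n \<eta> j = \<sigma> j"
  proof (cases "j < n")
    case True
    have "bij_betw \<sigma> {i. i < n \<and> sorts_before \<eta> i j} {..<\<sigma> j}"
    proof (rule bij_betw_imageI)
      show "inj_on \<sigma> {i. i < n \<and> sorts_before \<eta> i j}" using permutes_inj_on[OF \<sigma>] .
      have "\<exists>i<n. sorts_before \<eta> i j \<and> l = \<sigma> i" if "l < \<sigma> j" for l
      proof (intro exI[of _ "inv \<sigma> l"] conjI)
        have "l < n" using that True permutes_lessThan_iff[OF \<sigma>, of j] by simp
        then show "inv \<sigma> l < n" by (simp add: permutes_lessThan_iff permutes_inv[OF \<sigma>])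
        then show "sorts_before \<eta> (inv \<sigma> l) j"
          using order_iff[OF _ True, of "inv \<sigma> l"] that by (simp add: permutes_inverses[OF \<sigma>])
      qed (simp add: permutes_inverses[OF \<sigma>])
      then show "\<sigma> ` {i. i < n \<and> sorts_before \<eta> i j} = {..<\<sigma> j}"
        using order_iff[OF _ True] by auto
    qed
    then show ?thesis using True by (auto simp: sort_rank_def dest: bij_betw_same_card)
  next
    case False then show ?thesis using \<sigma> by (auto simp: sort_rank_def permutes_def)
  qed
qed

lemma is_partition_comp_inv_sort_rank:
  assumes "\<eta> \<in> multi_idx n" shows "is_partition n (\<eta> \<circ> inv (sort_rank n \<eta>))"
  unfolding is_partition_def
proof (intro conjI allI impI)
  note perm = sort_rank_permutes[of n \<eta>]
  let ?r = "inv (sort_rank n \<eta>)"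
  show "\<eta> \<circ> ?r \<in> multi_idx n" by (intro multi_idx_comp assms permutes_inv perm)
  fix i j assume ij: "i \<le> j" "j < n"
  show "(\<eta> \<circ> ?r) j \<le> (\<eta> \<circ> ?r) i"
  proof (cases "i = j")
    case False
    have "?r i < n" "?r j < n" using ij by (simp_all add: permutes_lessThan_iff permutes_inv[OF perm])
    moreover have "sort_rank n \<eta> (?r i) < sort_rank n \<eta> (?r j)"
      using ij False by (simp add: permutes_inverses[OF perm])
    ultimately have "sorts_before \<eta> (?r i) (?r j)" by (simp only: sort_rank_less_iff)
    then show ?thesis by (auto simp: sorts_before_def)
  qed simp
qed

lemma plus_part_eq: "\<eta> \<in> multi_idx n \<Longrightarrow> plus_part n \<eta> = \<eta> \<circ> inv (sort_rank n \<eta>)"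
  by (intro plus_part_eqI is_partition_comp_inv_sort_rank permutes_inv sort_rank_permutes)

lemma is_partition_plus_part: "\<eta> \<in> multi_idx n \<Longrightarrow> is_partition n (plus_part n \<eta>)"
  by (simp only: plus_part_eq is_partition_comp_inv_sort_rank)

lemma plus_part_multi: "\<eta> \<in> multi_idx n \<Longrightarrow> plus_part n \<eta> \<in> multi_idx n"
  using is_partition_plus_part by (simp add: is_partition_def)

lemma plus_part_sort_rank: "\<eta> \<in> multi_idx n \<Longrightarrow> plus_part n \<eta> (sort_rank n \<eta> j) = \<eta> j"
  by (simp add: plus_part_eq permutes_inverses[OF sort_rank_permutes])

lemma prod_plus_part:
  fixes g :: "nat \<Rightarrow> nat \<Rightarrow> 'a::comm_monoid_mult"
  assumes "\<eta> \<in> multi_idx n"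
  shows "(\<Prod>i<n. g i (plus_part n \<eta> i)) = (\<Prod>j<n. g (sort_rank n \<eta> j) (\<eta> j))"
  using prod.permute[OF sort_rank_permutes[of n \<eta>], of "\<lambda>i. g i (plus_part n \<eta> i)"]
  by (simp add: plus_part_sort_rank[OF assms])

lemma sum_plus_part:
  fixes g :: "nat \<Rightarrow> 'a::comm_monoid_add"
  assumes "\<eta> \<in> multi_idx n" shows "(\<Sum>i<n. g (plus_part n \<eta> i)) = (\<Sum>j<n. g (\<eta> j))"
  using sum.permute[OF sort_rank_permutes[of n \<eta>], of "\<lambda>i. g (plus_part n \<eta> i)"]
  by (simp add: plus_part_sort_rank[OF assms])

lemma absv_plus_part: "\<eta> \<in> multi_idx n \<Longrightarrow> absv n (plus_part n \<eta>) = absv n \<eta>"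
  using sum_plus_part[of \<eta> n "\<lambda>x. x"] by (simp add: absv_def)

lemma plus_part_comp:
  assumes \<eta>: "\<eta> \<in> multi_idx n" and \<sigma>: "\<sigma> permutes {..<n}"
  shows "plus_part n (\<eta> \<circ> \<sigma>) = plus_part n \<eta>"
proof -
  have "(\<eta> \<circ> \<sigma>) \<circ> (inv \<sigma> \<circ> inv (sort_rank n \<eta>)) = plus_part n \<eta>"
    using assms by (auto simp: fun_eq_iff permutes_inverses plus_part_eq)
  then show ?thesis
    using plus_part_eqI[OF multi_idx_comp[OF assms], of "inv \<sigma> \<circ> inv (sort_rank n \<eta>)"]
      is_partition_plus_part[OF \<eta>] \<sigma> by (simp add: permutes_compose permutes_inv sort_rank_permutes)
qed

lemma plus_part_eq_obtain:
  assumes "\<eta> \<in> multi_idx n" "\<kappa> \<in> multi_idx n" "plus_part n \<eta> = plus_part n \<kappa>"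
  obtains \<sigma> where "\<sigma> permutes {..<n}" "\<eta> = \<kappa> \<circ> \<sigma>"
proof
  show "inv (sort_rank n \<kappa>) \<circ> sort_rank n \<eta> permutes {..<n}"
    by (simp add: permutes_compose permutes_inv sort_rank_permutes)
  have "\<kappa> (inv (sort_rank n \<kappa>) (sort_rank n \<eta> i)) = \<eta> i" for i
    using plus_part_sort_rank[OF assms(1), of i] assms(3) plus_part_eq[OF assms(2)] by simp
  then show "\<eta> = \<kappa> \<circ> (inv (sort_rank n \<kappa>) \<circ> sort_rank n \<eta>)" by (intro ext) (simp only: o_apply)
qed

lemma sort_rank_swap:
  assumes "p < q" "q < n" "\<eta> p \<noteq> \<eta> q"
    and no_ties: "\<And>t. p < t \<Longrightarrow> t < q \<Longrightarrow> \<eta> t \<noteq> \<eta> p \<and> \<eta> t \<noteq> \<eta> q"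
  shows "sort_rank n (\<eta> \<circ> swp p q) = sort_rank n \<eta> \<circ> swp p q"
proof (rule sort_rank_eqI)
  have perm: "swp p q permutes {..<n}" using assms by (intro swp_permutes) auto
  show "sort_rank n \<eta> \<circ> swp p q permutes {..<n}" by (intro permutes_compose perm sort_rank_permutes)
  fix i j assume ij: "i < n" "j < n" and before: "sorts_before (\<eta> \<circ> swp p q) i j"
  have "sorts_before \<eta> (swp p q i) (swp p q j)"
  proof (cases "\<eta> (swp p q i) = \<eta> (swp p q j)")
    case False then show ?thesis using before by (auto simp: sorts_before_def)
  next
    case True
    then have "swp p q i < swp p q j \<longleftrightarrow> i < j"
      using assms(1,3) no_ties[of i] no_ties[of j] not_less_iff_gr_or_eq[of i p]
        not_less_iff_gr_or_eq[of q j]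
      by (cases "i = p"; cases "i = q"; cases "j = p"; cases "j = q") auto
    then show ?thesis using before True by (auto simp: sorts_before_def)
  qed
  then show "(sort_rank n \<eta> \<circ> swp p q) i < (sort_rank n \<eta> \<circ> swp p q) j"
    using ij by (simp add: sort_rank_less_iff permutes_lessThan_iff[OF perm])
qed

subsection \<open>The order on compositions\<close>

lemma dom_lt_trans:
  assumes "dom_lt n a b" "dom_lt n b c" "a \<in> multi_idx n" "b \<in> multi_idx n"
  shows "dom_lt n a c"
proof -
  have "a \<noteq> c"
  proof
    assume "a = c"
    then have eq: "(\<Sum>i<m. a i) = (\<Sum>i<m. b i)" if "m \<le> n" for m
      using assms that unfolding dom_lt_def by (metis le_antisym)
    have "a i = b i" if "i < n" for i using eq[of i] eq[of "Suc i"] that by simp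
    then have "a = b" using assms(3,4) by (intro multi_idx_eqI)
    then show False using assms(1) by (simp add: dom_lt_def)
  qed
  then show ?thesis using assms unfolding dom_lt_def by (auto intro: order_trans)
qed

lemma sum_le_sum_partition:
  assumes "is_partition n lam" "A \<subseteq> {..<n}"
  shows "(\<Sum>i\<in>A. lam i) \<le> (\<Sum>i<card A. lam i)"
  using assms(2)
proof (induction "card A" arbitrary: A)
  case 0
  then show ?case using finite_subset by fastforce
next
  case (Suc m)
  have fin: "finite A" using Suc.prems finite_subset by auto
  have "A \<noteq> {}" using Suc.hyps(2) by auto
  then have Max: "Max A \<in> A" "Max A < n" using fin Suc.prems by auto
  have card: "card (A - {Max A}) = m" using Suc.hyps(2) Max fin by simp
  have "A \<subseteq> {..Max A}" using fin by auto
  from card_mono[OF _ this] have "m \<le> Max A" using Suc.hyps(2) by simp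
  then have "lam (Max A) \<le> lam m" using Max assms(1) unfolding is_partition_def by blast
  moreover have "(\<Sum>i\<in>A - {Max A}. lam i) \<le> (\<Sum>i<m. lam i)"
    using Suc.hyps(1)[of "A - {Max A}"] card Suc.prems by auto
  ultimately show ?case
    using Suc.hyps(2)[symmetric] sum.remove[OF fin Max(1), of lam] by simp
qed

lemma sum_le_sum_plus_part:
  assumes \<eta>: "\<eta> \<in> multi_idx n" and A: "A \<subseteq> {..<n}"
  shows "(\<Sum>i\<in>A. \<eta> i) \<le> (\<Sum>i<card A. plus_part n \<eta> i)"
proof -
  have inj: "inj_on (sort_rank n \<eta>) A" using permutes_inj_on[OF sort_rank_permutes] .
  have "(\<Sum>i\<in>A. \<eta> i) = (\<Sum>i\<in>sort_rank n \<eta> ` A. plus_part n \<eta> i)"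
    by (simp add: sum.reindex[OF inj] plus_part_sort_rank[OF \<eta>])
  also have "\<dots> \<le> (\<Sum>i<card (sort_rank n \<eta> ` A). plus_part n \<eta> i)"
    using A by (intro sum_le_sum_partition[of n] is_partition_plus_part \<eta>) (auto simp: sort_rank_less)
  finally show ?thesis by (simp add: card_image[OF inj])
qed

lemma sum_plus_part_attained:
  assumes \<eta>: "\<eta> \<in> multi_idx n" and "m \<le> n"
  obtains A where "A \<subseteq> {..<n}" "card A = m" "(\<Sum>i<m. plus_part n \<eta> i) = (\<Sum>i\<in>A. \<eta> i)"
proof
  let ?r = "inv (sort_rank n \<eta>)"
  have perm: "?r permutes {..<n}" by (intro permutes_inv sort_rank_permutes)
  have inj: "inj_on ?r {..<m}" using permutes_inj_on[OF perm] .
  show "?r ` {..<m} \<subseteq> {..<n}"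
    using permutes_image[OF perm] image_mono[of "{..<m}" "{..<n}" ?r] \<open>m \<le> n\<close> by auto
  show "card (?r ` {..<m}) = m" by (simp add: card_image[OF inj])
  show "(\<Sum>i<m. plus_part n \<eta> i) = (\<Sum>i\<in>?r ` {..<m}. \<eta> i)"
    by (simp add: plus_part_eq[OF \<eta>] sum.reindex[OF inj])
qed

lemma dom_lt_plus_partI:
  assumes \<kappa>: "\<kappa> \<in> multi_idx n" and \<eta>: "\<eta> \<in> multi_idx n" and "absv n \<kappa> = absv n \<eta>"
    and subset_sums: "\<And>A. A \<subseteq> {..<n} \<Longrightarrow> \<exists>B\<subseteq>{..<n}. card B = card A \<and> sum \<kappa> A \<le> sum \<eta> B"
    and "plus_part n \<kappa> \<noteq> plus_part n \<eta>"
  shows "dom_lt n (plus_part n \<kappa>) (plus_part n \<eta>)"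
proof -
  have "(\<Sum>i<m. plus_part n \<kappa> i) \<le> (\<Sum>i<m. plus_part n \<eta> i)" if m: "m \<le> n" for m
  proof -
    obtain A where A: "A \<subseteq> {..<n}" "card A = m" "(\<Sum>i<m. plus_part n \<kappa> i) = sum \<kappa> A"
      using sum_plus_part_attained[OF \<kappa> m] .
    then obtain B where "B \<subseteq> {..<n}" "card B = m" "sum \<kappa> A \<le> sum \<eta> B" using subset_sums by blast
    then show ?thesis using sum_le_sum_plus_part[OF \<eta>, of B] A(3) by simp
  qed
  then show ?thesis
    using assms by (simp add: dom_lt_def absv_plus_part)
qed

definition move_units :: "nat \<Rightarrow> nat \<Rightarrow> nat \<Rightarrow> (nat \<Rightarrow> nat) \<Rightarrow> nat \<Rightarrow> nat" where
  "move_units i j l \<eta> = \<eta>(i := \<eta> i - l, j := \<eta> j + l)"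

lemma move_units_multi: "\<eta> \<in> multi_idx n \<Longrightarrow> i < n \<Longrightarrow> j < n \<Longrightarrow> move_units i j l \<eta> \<in> multi_idx n"
  by (auto simp: move_units_def multi_idx_def)

lemma move_units_zero: "move_units i j 0 \<eta> = \<eta>"
  by (simp add: move_units_def)

lemma move_units_all: "i \<noteq> j \<Longrightarrow> \<eta> j \<le> \<eta> i \<Longrightarrow> move_units i j (\<eta> i - \<eta> j) \<eta> = \<eta> \<circ> swp i j"
  by (auto simp: move_units_def fun_eq_iff swp_def)

lemma sum_remove_two:
  fixes g :: "'a \<Rightarrow> 'b::comm_monoid_add"
  assumes "finite A" "i \<in> A" "j \<in> A" "i \<noteq> j"
  shows "sum g A = g i + (g j + sum g (A - {i, j}))"
  using sum.subset_diff[of "{i, j}" A g] assms by (simp add: ac_simps)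

lemma sum_move_units:
  assumes "finite A" "i \<in> A" "j \<in> A" "i \<noteq> j" "l \<le> \<eta> i"
  shows "sum (move_units i j l \<eta>) A = sum \<eta> A"
  using assms unfolding sum_remove_two[OF assms(1-4)] by (simp add: move_units_def)

lemma subset_sum_move_units:
  assumes "finite A" "j \<notin> A \<or> i \<in> A" "i \<noteq> j" "l \<le> \<eta> i"
  shows "sum (move_units i j l \<eta>) A \<le> sum \<eta> A"
proof (cases "j \<in> A")
  case True
  then show ?thesis using assms by (simp add: sum_move_units)
next
  case False
  then show ?thesis by (intro sum_mono) (auto simp: move_units_def)
qed

lemma subset_sum_move_units_exchange:
  assumes "finite A" "j \<in> A" "i \<notin> A" "\<eta> j + l \<le> \<eta> i"
  shows "sum (move_units i j l \<eta>) A \<le> sum \<eta> (insert i (A - {j}))"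
proof -
  have "sum (move_units i j l \<eta>) (A - {j}) = sum \<eta> (A - {j})"
    using assms by (intro sum.cong) (auto simp: move_units_def)
  then show ?thesis
    using assms by (auto simp: sum.remove[of A j "move_units i j l \<eta>"]) (auto simp: move_units_def)
qed

lemma sum_squares_move_units_less:
  assumes "i < n" "j < n" "0 < l" "\<eta> j + l < \<eta> i"
  shows "(\<Sum>m<n. (move_units i j l \<eta> m)\<^sup>2) < (\<Sum>m<n. (\<eta> m)\<^sup>2)"
proof -
  have ij: "i \<noteq> j" using assms by auto
  obtain d where "\<eta> i = \<eta> j + l + d" "0 < d" using less_imp_add_positive[OF assms(4)] by metis
  then have "(\<eta> i - l)\<^sup>2 + (\<eta> j + l)\<^sup>2 < (\<eta> i)\<^sup>2 + (\<eta> j)\<^sup>2"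
    using assms(3) by (simp add: power2_eq_square algebra_simps)
  moreover have "(\<Sum>m<n. (g m)\<^sup>2) = (g i)\<^sup>2 + ((g j)\<^sup>2 + (\<Sum>m\<in>{..<n} - {i, j}. (g m)\<^sup>2))" for g :: "nat \<Rightarrow> nat"
    using assms ij by (intro sum_remove_two) auto
  ultimately show ?thesis using ij by (simp add: move_units_def)
qed

lemma prec_move_units:
  assumes \<eta>: "\<eta> \<in> multi_idx n" and ij: "i < n" "j < n" and l: "0 < l" "\<eta> j + l < \<eta> i"
  shows "prec n (move_units i j l \<eta>) \<eta>"
proof -
  let ?\<kappa> = "move_units i j l \<eta>"
  have \<kappa>: "?\<kappa> \<in> multi_idx n" by (rule move_units_multi[OF \<eta> ij])
  have ne: "i \<noteq> j" using l by auto
  have "dom_lt n (plus_part n ?\<kappa>) (plus_part n \<eta>)"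
  proof (rule dom_lt_plus_partI[OF \<kappa> \<eta>])
    show "absv n ?\<kappa> = absv n \<eta>" unfolding absv_def using ij l ne by (intro sum_move_units) auto
    fix A assume A: "A \<subseteq> {..<n}"
    then have fin: "finite A" using finite_subset by blast
    show "\<exists>B\<subseteq>{..<n}. card B = card A \<and> sum ?\<kappa> A \<le> sum \<eta> B"
    proof (cases "j \<notin> A \<or> i \<in> A")
      case True
      then show ?thesis using subset_sum_move_units[OF fin True ne] l A by auto
    next
      case False
      then have "card (insert i (A - {j})) = card A"
        using fin card.remove[of A j] by simp
      moreover have "sum ?\<kappa> A \<le> sum \<eta> (insert i (A - {j}))"
        using False fin l by (intro subset_sum_move_units_exchange) auto
      ultimately show ?thesis using A ij by (intro exI[of _ "insert i (A - {j})"]) auto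
    qed
  next
    show "plus_part n ?\<kappa> \<noteq> plus_part n \<eta>"
      using sum_squares_move_units_less[OF ij l] sum_plus_part[OF \<kappa>, of "\<lambda>x. x\<^sup>2"]
        sum_plus_part[OF \<eta>, of "\<lambda>x. x\<^sup>2"] by auto
  qed
  then show ?thesis by (simp add: prec_def)
qed

lemma inversions_swap:
  assumes "i < j" "j < n" "u i < u j"
  shows "inversions n u < inversions n (u \<circ> swp i j)"
proof -
  let ?v = "u \<circ> swp i j"
  let ?I = "\<lambda>u. {(a, b). a < b \<and> b < n \<and> u b < (u a :: nat)}"
  define \<phi> where "\<phi> = (\<lambda>(a, b). if a < i \<or> j < b then (swp i j a, swp i j b) else (a, b))"
  have fin: "finite (?I ?v)" by (rule finite_subset[of _ "{..<n} \<times> {..<n}"]) auto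
  have inj: "inj_on \<phi> (?I u)"
    using assms(1) by (auto simp: inj_on_def \<phi>_def swp_def split: if_splits)
  have sub: "\<phi> ` ?I u \<subseteq> ?I ?v - {(i, j)}"
  proof clarsimp
    fix a b assume ab: "a < b" "b < n" "u b < u a"
    show "(case \<phi> (a, b) of (a, b) \<Rightarrow> a < b \<and> b < n \<and> u (swp i j b) < u (swp i j a)) \<and> \<phi> (a, b) \<noteq> (i, j)"
      using ab assms(1-3) by (auto simp: \<phi>_def swp_def)
  qed
  have "(i, j) \<in> ?I ?v" using assms by auto
  have "card (?I u) = card (\<phi> ` ?I u)" by (simp add: card_image[OF inj])
  also have "\<dots> \<le> card (?I ?v - {(i, j)})" using fin sub by (intro card_mono) auto
  also have "\<dots> < card (?I ?v)" using fin \<open>(i, j) \<in> ?I ?v\<close> by (rule card_Diff1_less)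
  finally show ?thesis unfolding inversions_def .
qed

definition shortest_with_image :: "nat \<Rightarrow> (nat \<Rightarrow> nat) \<Rightarrow> (nat \<Rightarrow> nat) \<Rightarrow> bool" where
  "shortest_with_image n \<eta> w \<longleftrightarrow> w permutes {..<n} \<and>
    (\<forall>w'. w' permutes {..<n} \<and> \<eta> \<circ> w' = \<eta> \<circ> w \<longrightarrow> inversions n w \<le> inversions n w')"

lemma shortest_ascending_on_ties:
  assumes shortest: "shortest_with_image n \<eta> w" and ij: "i < j" "j < n" and tie: "\<eta> (w i) = \<eta> (w j)"
  shows "w i < w j"
proof (rule ccontr)
  have w: "w permutes {..<n}" using shortest by (simp add: shortest_with_image_def)
  assume "\<not> w i < w j"
  then have "w j < w i" using ij inj_eq[OF permutes_inj[OF w], of i j] by auto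
  then have "inversions n (w \<circ> swp i j) < inversions n w"
    using inversions_swap[OF ij, of "w \<circ> swp i j"] by simp
  moreover have "w \<circ> swp i j permutes {..<n}" using ij by (intro permutes_compose swp_permutes w) auto
  moreover have "\<eta> \<circ> (w \<circ> swp i j) = \<eta> \<circ> w" using tie by (auto simp: fun_eq_iff swp_def)
  ultimately show False using shortest unfolding shortest_with_image_def by (meson not_le)
qed

lemma shortest_sorting_eq:
  assumes shortest: "shortest_with_image n \<eta> w" and part: "is_partition n (\<eta> \<circ> w)"
  shows "w = inv (sort_rank n \<eta>)"
proof -
  have w: "w permutes {..<n}" using shortest by (simp add: shortest_with_image_def)
  note w_inv = permutes_inv[OF w] and w_cancel = permutes_inverses[OF w]
  have "sort_rank n \<eta> = inv w"
  proof (rule sort_rank_eqI[OF w_inv])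
    fix i j assume ij: "i < n" "j < n" "sorts_before \<eta> i j"
    show "inv w i < inv w j"
    proof (rule ccontr)
      assume "\<not> inv w i < inv w j"
      moreover have "inv w i \<noteq> inv w j"
        using ij sorts_before_irrefl[of \<eta>] inj_eq[OF permutes_inj[OF w_inv], of i j] by auto
      ultimately have less: "inv w j < inv w i" by simp
      have "inv w i < n" using ij by (simp add: permutes_lessThan_iff[OF w_inv])
      then have "\<eta> i \<le> \<eta> j"
        using part less unfolding is_partition_def by (metis comp_apply less_imp_le w_cancel(1))
      then have "\<eta> i = \<eta> j" "i < j" using ij by (auto simp: sorts_before_def)
      then show False
        using shortest_ascending_on_ties[OF shortest less \<open>inv w i < n\<close>] by (simp add: w_cancel)
    qed
  qed
  then show ?thesis by (simp add: permutes_inv_inv[OF w])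
qed

lemma w_perm_eq:
  assumes \<eta>: "\<eta> \<in> multi_idx n" shows "w_perm n \<eta> = inv (sort_rank n \<eta>)"
proof -
  have act_iff: "perm_act w (plus_part n \<eta>) = \<eta> \<longleftrightarrow> \<eta> \<circ> w = plus_part n \<eta>" if "w permutes {..<n}" for w
    using permutes_inverses[OF that] by (auto simp: perm_act_def fun_eq_iff) (metis, metis)
  have iff: "w permutes {..<n} \<and> perm_act w (plus_part n \<eta>) = \<eta> \<and>
      (\<forall>w'. w' permutes {..<n} \<and> perm_act w' (plus_part n \<eta>) = \<eta> \<longrightarrow> inversions n w \<le> inversions n w')
    \<longleftrightarrow> \<eta> \<circ> w = plus_part n \<eta> \<and> shortest_with_image n \<eta> w" for w
    unfolding shortest_with_image_def using act_iff by metis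
  have unique: "w = inv (sort_rank n \<eta>)" if "\<eta> \<circ> w = plus_part n \<eta> \<and> shortest_with_image n \<eta> w" for w
    using shortest_sorting_eq[of n \<eta> w] that is_partition_plus_part[OF \<eta>] by simp
  have "inv (sort_rank n \<eta>) permutes {..<n} \<and> \<eta> \<circ> inv (sort_rank n \<eta>) = plus_part n \<eta>"
    by (simp add: plus_part_eq[OF \<eta>] permutes_inv sort_rank_permutes)
  from ex_has_least_nat[of "\<lambda>w. w permutes {..<n} \<and> \<eta> \<circ> w = plus_part n \<eta>", OF this, of "inversions n"]
  obtain w where "\<eta> \<circ> w = plus_part n \<eta> \<and> shortest_with_image n \<eta> w"
    unfolding shortest_with_image_def by metis
  with unique show ?thesis
    unfolding w_perm_def iff by (intro the_equality) (blast, blast)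
qed

lemma bruhat_lt_inversions: "bruhat_lt n u v \<Longrightarrow> inversions n u < inversions n v"
  unfolding bruhat_lt_def
  by (induction rule: tranclp_induct) (auto simp: bruhat_step_def comp_def intro: less_trans)

lemma bruhat_lt_trans [trans]: "bruhat_lt n u v \<Longrightarrow> bruhat_lt n v w \<Longrightarrow> bruhat_lt n u w"
  unfolding bruhat_lt_def by (rule tranclp_trans)

lemma inv_swp: "inv (swp i j) = swp i j"
  by (rule inv_unique_comp) (simp_all add: fun_eq_iff)

lemma bruhat_lt_swap_no_ties:
  assumes \<eta>: "\<eta> \<in> multi_idx n" and pq: "p < q" "q < n" "\<eta> q < \<eta> p"
    and no_ties: "\<And>t. p < t \<Longrightarrow> t < q \<Longrightarrow> \<eta> t \<noteq> \<eta> p \<and> \<eta> t \<noteq> \<eta> q"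
  shows "bruhat_lt n (w_perm n \<eta>) (w_perm n (\<eta> \<circ> swp p q))"
proof -
  let ?r = "sort_rank n \<eta>"
  note r = sort_rank_permutes[of n \<eta>]
  have perm: "swp p q permutes {..<n}" using pq by (intro swp_permutes) auto
  have "sort_rank n (\<eta> \<circ> swp p q) = swp (?r p) (?r q) \<circ> ?r"
    using sort_rank_swap[of p q n \<eta>] pq no_ties permutes_comp_swp[OF r] by auto
  moreover have "inv (swp (?r p) (?r q) \<circ> ?r) = inv ?r \<circ> swp (?r p) (?r q)"
    using o_inv_distrib[OF permutes_bij[OF swp_permutes_UNIV] permutes_bij[OF r]] by (simp add: inv_swp)
  ultimately have w_swap: "w_perm n (\<eta> \<circ> swp p q) = w_perm n \<eta> \<circ> swp (?r p) (?r q)"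
    by (simp only: w_perm_eq[OF \<eta>] w_perm_eq[OF multi_idx_comp[OF \<eta> perm]])
  have less: "?r p < ?r q" using pq by (simp add: sort_rank_less_iff sorts_before_def)
  have "inversions n (w_perm n \<eta>) < inversions n (w_perm n \<eta> \<circ> swp (?r p) (?r q))"
    using pq less by (intro inversions_swap)
      (simp_all add: w_perm_eq[OF \<eta>] sort_rank_less permutes_inverses[OF r])
  then have "bruhat_step n (w_perm n \<eta>) (w_perm n (\<eta> \<circ> swp p q))"
    unfolding bruhat_step_def w_swap using less pq sort_rank_less[of q n \<eta>]
    by (auto simp: w_perm_eq[OF \<eta>] permutes_inv[OF r])
  then show ?thesis unfolding bruhat_lt_def by blast
qed

text \<open>Ties between \<open>p\<close> and \<open>q\<close> break the relation between the ranks of \<open>\<eta>\<close> and of its swap; then the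
  swap is factored through a tied position into two shorter swaps.\<close>

lemma bruhat_lt_swap:
  assumes "\<eta> \<in> multi_idx n" "p < q" "q < n" "\<eta> q < \<eta> p"
  shows "bruhat_lt n (w_perm n \<eta>) (w_perm n (\<eta> \<circ> swp p q))"
  using assms
proof (induction "q - p" arbitrary: p q \<eta> rule: less_induct)
  case less
  have multi: "\<eta> \<circ> swp a b \<in> multi_idx n" if "a < n" "b < n" for a b
    using less.prems(1) that by (intro multi_idx_comp swp_permutes)
  consider (no_ties) "\<And>t. p < t \<Longrightarrow> t < q \<Longrightarrow> \<eta> t \<noteq> \<eta> p \<and> \<eta> t \<noteq> \<eta> q"
    | (low) t where "p < t" "t < q" "\<eta> t = \<eta> q"
    | (high) t where "p < t" "t < q" "\<eta> t = \<eta> p" by blast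
  then show ?case
  proof cases
    case no_ties
    then show ?thesis using less.prems by (intro bruhat_lt_swap_no_ties)
  next
    case low
    have factor: "\<eta> \<circ> swp p q = (\<eta> \<circ> swp p t) \<circ> swp t q" using low by (auto simp: fun_eq_iff swp_def)
    have "bruhat_lt n (w_perm n \<eta>) (w_perm n (\<eta> \<circ> swp p t))"
      using low less.prems by (intro less.hyps) auto
    also have "bruhat_lt n (w_perm n (\<eta> \<circ> swp p t)) (w_perm n (\<eta> \<circ> swp p q))"
      unfolding factor using low less.prems by (intro less.hyps multi) (auto simp: swp_def)
    finally show ?thesis .
  next
    case high
    have factor: "\<eta> \<circ> swp p q = (\<eta> \<circ> swp t q) \<circ> swp p t" using high by (auto simp: fun_eq_iff swp_def)
    have "bruhat_lt n (w_perm n \<eta>) (w_perm n (\<eta> \<circ> swp t q))"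
      using high less.prems by (intro less.hyps) auto
    also have "bruhat_lt n (w_perm n (\<eta> \<circ> swp t q)) (w_perm n (\<eta> \<circ> swp p q))"
      unfolding factor using high less.prems by (intro less.hyps multi) (auto simp: swp_def)
    finally show ?thesis .
  qed
qed

lemma prec_swap:
  assumes "\<eta> \<in> multi_idx n" "p < q" "q < n" "\<eta> q < \<eta> p"
  shows "prec n (\<eta> \<circ> swp p q) \<eta>"
  unfolding prec_def
  using bruhat_lt_swap[OF assms] plus_part_comp[OF assms(1) swp_permutes[of p n q]] assms by simp

lemma prec_trans:
  assumes "prec n a b" "prec n b c" "a \<in> multi_idx n" "b \<in> multi_idx n"
  shows "prec n a c"
  using assms(1,2) dom_lt_trans[OF _ _ plus_part_multi[OF assms(3)] plus_part_multi[OF assms(4)]]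
    bruhat_lt_trans
  unfolding prec_def by metis

lemma prec_irrefl: "\<not> prec n a a"
  unfolding prec_def dom_lt_def using bruhat_lt_inversions by blast

lemma prec_absv: "prec n a b \<Longrightarrow> a \<in> multi_idx n \<Longrightarrow> b \<in> multi_idx n \<Longrightarrow> absv n a = absv n b"
  unfolding prec_def dom_lt_def using absv_plus_part by metis

definition low_idx :: "nat \<Rightarrow> (nat \<Rightarrow> nat) \<Rightarrow> (nat \<Rightarrow> nat) set" where
  "low_idx n \<eta> = {\<kappa> \<in> multi_idx n. prec n \<kappa> \<eta>}"

lemma low_idx_subset: "\<eta> \<in> deg_idx n m \<Longrightarrow> low_idx n \<eta> \<subseteq> deg_idx n m"
  unfolding low_idx_def deg_idx_def using prec_absv by auto

lemma finite_low_idx: "\<eta> \<in> multi_idx n \<Longrightarrow> finite (low_idx n \<eta>)"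
  using low_idx_subset[OF deg_idx_absv] finite_deg_idx finite_subset by blast

lemma not_in_low_idx: "\<eta> \<notin> low_idx n \<eta>"
  by (simp add: low_idx_def prec_irrefl)

lemma low_idx_psubset: "\<eta> \<in> multi_idx n \<Longrightarrow> \<kappa> \<in> low_idx n \<eta> \<Longrightarrow> low_idx n \<kappa> \<subset> low_idx n \<eta>"
  using not_in_low_idx[of \<kappa> n] by (auto simp: low_idx_def intro: prec_trans)

lemma prec_maximal_exists:
  assumes "finite S" "S \<noteq> {}" "S \<subseteq> multi_idx n"
  obtains \<rho> where "\<rho> \<in> S" "\<And>\<tau>. \<tau> \<in> S \<Longrightarrow> \<not> prec n \<rho> \<tau>"
proof -
  have "transp_on S (prec n)" using assms(3) by (intro transp_onI) (blast intro: prec_trans)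
  moreover have "asymp_on S (prec n)"
    using assms(3) prec_irrefl by (intro asymp_onI) (blast intro: prec_trans)
  ultimately obtain \<rho> where "\<rho> \<in> S" "\<forall>\<tau>\<in>S. \<tau> \<noteq> \<rho> \<longrightarrow> \<not> prec n \<rho> \<tau>"
    using Finite_Set.bex_max_element[of S "prec n"] assms by blast
  then show ?thesis using that[of \<rho>] prec_irrefl by metis
qed

subsection \<open>Eigenvalues of the Cherednik operators\<close>

lemma eigval_sort_rank: "j < n \<Longrightarrow> eigval n k \<eta> j = real (\<eta> j) - k * real (sort_rank n \<eta> j)"
proof -
  assume j: "j < n"
  have "{i. i < n \<and> sorts_before \<eta> i j} = {i. i < j \<and> \<eta> j \<le> \<eta> i} \<union> {i. j < i \<and> i < n \<and> \<eta> j < \<eta> i}"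
    using j by (auto simp: sorts_before_def) (metis linorder_neqE_nat less_irrefl)
  moreover have "card ({i. i < j \<and> \<eta> j \<le> \<eta> i} \<union> {i. j < i \<and> i < n \<and> \<eta> j < \<eta> i})
    = card {i. i < j \<and> \<eta> j \<le> \<eta> i} + card {i. j < i \<and> i < n \<and> \<eta> j < \<eta> i}"
    by (rule card_Un_disjoint) auto
  ultimately show ?thesis using j by (simp add: eigval_def sort_rank_def algebra_simps)
qed

lemma eigval_less:
  assumes "0 < k" "i < n" "j < n" "sorts_before \<eta> i j"
  shows "eigval n k \<eta> j < eigval n k \<eta> i"
proof -
  have "k * real (sort_rank n \<eta> i) < k * real (sort_rank n \<eta> j)"
    using assms by (intro mult_strict_left_mono) (simp_all add: sort_rank_less_iff)
  moreover have "real (\<eta> j) \<le> real (\<eta> i)" using assms(4) by (auto simp: sorts_before_def)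
  ultimately show ?thesis unfolding eigval_sort_rank[OF assms(2)] eigval_sort_rank[OF assms(3)] by linarith
qed

lemma eigval_gap:
  assumes "0 \<le> k" "i < n" "j < n" "\<eta> j < \<eta> i"
  shows "real (\<eta> i) - real (\<eta> j) + k \<le> eigval n k \<eta> i - eigval n k \<eta> j"
proof -
  have "sort_rank n \<eta> i < sort_rank n \<eta> j" using assms by (simp add: sort_rank_less_iff sorts_before_def)
  then have "k * real (sort_rank n \<eta> i + 1) \<le> k * real (sort_rank n \<eta> j)"
    using assms(1) by (intro mult_left_mono) auto
  then show ?thesis using assms by (simp add: eigval_sort_rank algebra_simps)
qed

lemma eigval_lower_bound:
  assumes "0 \<le> k" "j < n" shows "real (\<eta> j) \<le> eigval n k \<eta> j + k * (real n - 1)"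
proof -
  have "real (sort_rank n \<eta> j) \<le> real n - 1" using sort_rank_less[OF assms(2), of \<eta>] by linarith
  then have "k * real (sort_rank n \<eta> j) \<le> k * (real n - 1)" using assms(1) by (rule mult_left_mono)
  then show ?thesis using assms by (simp add: eigval_sort_rank)
qed

lemma eigval_swap:
  assumes "Suc j < n" "\<eta> j \<noteq> \<eta> (Suc j)" "i < n"
  shows "eigval n k (\<eta> \<circ> swp j (Suc j)) i = eigval n k \<eta> (swp j (Suc j) i)"
proof -
  have "swp j (Suc j) i < n" using assms by (auto simp: swp_def)
  then show ?thesis using assms sort_rank_swap[of j "Suc j" n \<eta>] by (simp add: eigval_sort_rank)
qed

lemma eigval_determines_idx:
  assumes k: "0 \<le> k" and \<tau>: "\<tau> \<in> multi_idx n" and \<kappa>: "\<kappa> \<in> multi_idx n" and \<sigma>: "\<sigma> permutes {..<n}"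
    and eq: "\<And>j. j < n \<Longrightarrow> eigval n k \<tau> j = eigval n k \<kappa> (\<sigma> j)"
  shows "\<tau> = \<kappa> \<circ> \<sigma>"
proof (rule multi_idx_eqI[OF \<tau> multi_idx_comp[OF \<kappa> \<sigma>]])
  fix j assume j: "j < n"
  note \<sigma>_less = permutes_lessThan_iff[OF \<sigma>]
  show "\<tau> j = (\<kappa> \<circ> \<sigma>) j"
  proof (cases "k = 0")
    case True then show ?thesis using eq[OF j] j by (simp add: eigval_sort_rank \<sigma>_less)
  next
    case False
    then have "0 < k" using k by simp
    have "sort_rank n \<tau> = sort_rank n \<kappa> \<circ> \<sigma>"
    proof (rule sort_rank_eqI)
      show "sort_rank n \<kappa> \<circ> \<sigma> permutes {..<n}" by (intro permutes_compose \<sigma> sort_rank_permutes)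
      fix i j assume ij: "i < n" "j < n" "sorts_before \<tau> i j"
      then have "eigval n k \<kappa> (\<sigma> j) < eigval n k \<kappa> (\<sigma> i)"
        using eigval_less[OF \<open>0 < k\<close>, of i n j \<tau>] eq by simp
      then have "\<not> sorts_before \<kappa> (\<sigma> j) (\<sigma> i)" "\<sigma> i \<noteq> \<sigma> j"
        using eigval_less[OF \<open>0 < k\<close>, of "\<sigma> j" n "\<sigma> i" \<kappa>] ij by (auto simp: \<sigma>_less)
      then show "(sort_rank n \<kappa> \<circ> \<sigma>) i < (sort_rank n \<kappa> \<circ> \<sigma>) j"
        using sorts_before_total ij by (auto simp: sort_rank_less_iff \<sigma>_less)
    qed
    then show ?thesis using eq[OF j] j by (simp add: eigval_sort_rank \<sigma>_less)
  qed
qed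

subsection \<open>Dunkl operators on partially differentiable functions\<close>

lemma unit_vec_apply: "unit_vec j m = (if m = j then 1 else 0)"
  by (simp add: unit_vec_def)

abbreviation coord_line :: "nat \<Rightarrow> (nat \<Rightarrow> complex) \<Rightarrow> complex \<Rightarrow> nat \<Rightarrow> complex" where
  "coord_line j x t \<equiv> \<lambda>m. x m + t * unit_vec j m"

definition partially_diff :: "((nat \<Rightarrow> complex) \<Rightarrow> complex) \<Rightarrow> bool" where
  "partially_diff f \<longleftrightarrow> (\<forall>x j. (\<lambda>t. f (coord_line j x t)) field_differentiable at 0)"

lemma partially_diff_DERIV:
  assumes "partially_diff f"
  shows "((\<lambda>t. f (coord_line j x t)) has_field_derivative dir_deriv (unit_vec j) f (coord_line j x w)) (at w)"
proof -
  have "((\<lambda>t. f (coord_line j (coord_line j x w) t)) has_field_derivative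
    dir_deriv (unit_vec j) f (coord_line j x w)) (at 0)"
    using assms unfolding partially_diff_def dir_deriv_def by (simp add: DERIV_deriv_iff_field_differentiable)
  then have "((\<lambda>t. f (coord_line j x (t + w))) has_field_derivative
    dir_deriv (unit_vec j) f (coord_line j x w)) (at 0)"
    by (simp add: algebra_simps)
  then show ?thesis using DERIV_shift[of "\<lambda>t. f (coord_line j x t)" _ 0 w] by simp
qed

lemma partially_diff_DERIV_zero:
  "partially_diff f \<Longrightarrow> ((\<lambda>t. f (coord_line j x t)) has_field_derivative dir_deriv (unit_vec j) f x) (at 0)"
  using partially_diff_DERIV[of f x j 0] by simp

lemma dir_derivI:
  "((\<lambda>t. f (coord_line j x t)) has_field_derivative D) (at 0) \<Longrightarrow> dir_deriv (unit_vec j) f x = D"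
  unfolding dir_deriv_def by (rule DERIV_imp_deriv)

lemma partially_diffI:
  "(\<And>x j. \<exists>D. ((\<lambda>t. f (coord_line j x t)) has_field_derivative D) (at 0)) \<Longrightarrow> partially_diff f"
  unfolding partially_diff_def field_differentiable_def by blast

lemma partially_diff_const [intro, simp]: "partially_diff (\<lambda>_. c)"
  by (rule partially_diffI, rule exI[of _ 0]) simp

lemma dir_deriv_const [simp]: "dir_deriv (unit_vec j) (\<lambda>_. c) x = 0"
  by (rule dir_derivI) simp

lemma DERIV_coord: "((\<lambda>t. x l + t * unit_vec j l) has_field_derivative unit_vec j l) (at 0)"
  by (auto intro!: derivative_eq_intros)

lemma partially_diff_coord [intro, simp]: "partially_diff (\<lambda>x. x l)"
  using DERIV_coord by (intro partially_diffI) blast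

lemma dir_deriv_coord: "dir_deriv (unit_vec j) (\<lambda>x. x l) x = unit_vec j l"
  by (intro dir_derivI DERIV_coord)

lemma partially_diff_add [intro]: "partially_diff f \<Longrightarrow> partially_diff g \<Longrightarrow> partially_diff (\<lambda>x. f x + g x)"
  unfolding partially_diff_def by (auto intro: field_differentiable_add)

lemma dir_deriv_add: "partially_diff f \<Longrightarrow> partially_diff g \<Longrightarrow>
  dir_deriv (unit_vec j) (\<lambda>x. f x + g x) x = dir_deriv (unit_vec j) f x + dir_deriv (unit_vec j) g x"
  by (intro dir_derivI DERIV_add partially_diff_DERIV_zero)

lemma partially_diff_diff [intro]: "partially_diff f \<Longrightarrow> partially_diff g \<Longrightarrow> partially_diff (\<lambda>x. f x - g x)"
  unfolding partially_diff_def by (auto intro: field_differentiable_diff)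

lemma dir_deriv_diff: "partially_diff f \<Longrightarrow> partially_diff g \<Longrightarrow>
  dir_deriv (unit_vec j) (\<lambda>x. f x - g x) x = dir_deriv (unit_vec j) f x - dir_deriv (unit_vec j) g x"
  by (intro dir_derivI DERIV_diff partially_diff_DERIV_zero)

lemma partially_diff_mult [intro]: "partially_diff f \<Longrightarrow> partially_diff g \<Longrightarrow> partially_diff (\<lambda>x. f x * g x)"
  unfolding partially_diff_def by (auto intro: field_differentiable_mult)

lemma dir_deriv_mult: "partially_diff f \<Longrightarrow> partially_diff g \<Longrightarrow>
  dir_deriv (unit_vec j) (\<lambda>x. f x * g x) x =
    dir_deriv (unit_vec j) f x * g x + f x * dir_deriv (unit_vec j) g x"
  by (rule dir_derivI)
    (use DERIV_mult[OF partially_diff_DERIV_zero partially_diff_DERIV_zero, of f g x j x j] in \<open>simp add: mult.commute add.commute\<close>)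

lemma dir_deriv_cmult: "partially_diff f \<Longrightarrow>
  dir_deriv (unit_vec j) (\<lambda>x. c * f x) x = c * dir_deriv (unit_vec j) f x"
  using dir_deriv_mult[of "\<lambda>_. c" f j x] by simp

lemma partially_diff_sum [intro]: "(\<And>i. i \<in> S \<Longrightarrow> partially_diff (f i)) \<Longrightarrow> partially_diff (\<lambda>x. \<Sum>i\<in>S. f i x)"
  by (induction S rule: infinite_finite_induct) auto

lemma dir_deriv_sum:
  assumes "\<And>i. i \<in> S \<Longrightarrow> partially_diff (f i)"
  shows "dir_deriv (unit_vec j) (\<lambda>x. \<Sum>i\<in>S. c i * f i x) x = (\<Sum>i\<in>S. c i * dir_deriv (unit_vec j) (f i) x)"
  using assms
proof (induction S rule: infinite_finite_induct)
  case (insert i S)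
  then have "partially_diff (\<lambda>x. c i * f i x)" "partially_diff (\<lambda>x. \<Sum>i\<in>S. c i * f i x)"
    by (auto intro!: partially_diff_sum partially_diff_mult)
  then show ?case using insert by (simp add: dir_deriv_add dir_deriv_cmult)
qed auto

lemma partially_diff_prod [intro]: "(\<And>i. i \<in> S \<Longrightarrow> partially_diff (f i)) \<Longrightarrow> partially_diff (\<lambda>x. \<Prod>i\<in>S. f i x)"
  by (induction S rule: infinite_finite_induct) auto

lemma partially_diff_power [intro]: "partially_diff f \<Longrightarrow> partially_diff (\<lambda>x. f x ^ m)"
  by (induction m) auto

lemma partially_diff_monom [intro, simp]: "partially_diff (monom n \<eta>)"
  unfolding monom_def[abs_def] by (intro partially_diff_prod partially_diff_power partially_diff_coord)

lemma coord_line_comp: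
  assumes "\<sigma> permutes S"
  shows "coord_line (\<sigma> b) x t \<circ> \<sigma> = coord_line b (x \<circ> \<sigma>) t"
  by (auto simp: fun_eq_iff unit_vec_apply inj_eq[OF permutes_inj[OF assms]])

lemma partially_diff_comp:
  assumes "partially_diff f" "\<sigma> permutes S" shows "partially_diff (\<lambda>x. f (x \<circ> \<sigma>))"
  unfolding partially_diff_def
proof (intro allI)
  fix x j
  have "coord_line j x t \<circ> \<sigma> = coord_line (inv \<sigma> j) (x \<circ> \<sigma>) t" for t
    using coord_line_comp[OF assms(2), of x t "inv \<sigma> j"] by (simp add: permutes_inverses[OF assms(2)])
  then show "(\<lambda>t. f (coord_line j x t \<circ> \<sigma>)) field_differentiable at 0"
    using assms(1) unfolding partially_diff_def by simp
qed

lemma dir_deriv_comp: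
  "\<sigma> permutes S \<Longrightarrow> dir_deriv (unit_vec (\<sigma> b)) (\<lambda>x. f (x \<circ> \<sigma>)) x = dir_deriv (unit_vec b) f (x \<circ> \<sigma>)"
  unfolding dir_deriv_def by (simp add: coord_line_comp)

lemma partially_diff_sw_pt [intro]: "partially_diff f \<Longrightarrow> partially_diff (\<lambda>x. f (sw_pt i j x))"
  unfolding sw_pt_def using swp_permutes_UNIV by (intro partially_diff_comp)

lemma sw_pt_commute: "sw_pt i j x = sw_pt j i x"
  by (simp add: sw_pt_def swp_commute)

lemma sw_pt_same: "x i = x j \<Longrightarrow> sw_pt i j x = x"
  by (auto simp: sw_pt_def swp_def fun_eq_iff)

lemma diff_quot_anti: "diff_quot i j f x = - diff_quot j i f x"
  by (simp add: diff_quot_def sw_pt_commute[of i j] minus_divide_right)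

lemma diff_quot_add: "partially_diff f \<Longrightarrow> partially_diff g \<Longrightarrow>
  diff_quot i j (\<lambda>x. f x + g x) x = diff_quot i j f x + diff_quot i j g x"
  by (simp add: diff_quot_def dir_deriv_add add_divide_distrib[symmetric])

lemma diff_quot_cmult: "partially_diff f \<Longrightarrow> diff_quot i j (\<lambda>x. c * f x) x = c * diff_quot i j f x"
  by (simp add: diff_quot_def dir_deriv_cmult algebra_simps)

lemma diff_quot_coord_mult:
  assumes "partially_diff f" "a \<noteq> b"
  shows "diff_quot a b (\<lambda>x. x l * f x) x = x l * diff_quot a b f x +
    (if l = a then f (sw_pt a b x) else if l = b then - f (sw_pt a b x) else 0)"
proof (cases "x a = x b")
  case True
  then show ?thesis using assms
    by (simp add: diff_quot_def dir_deriv_mult dir_deriv_coord sw_pt_same unit_vec_apply algebra_simps)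
next
  case False
  then have ne: "x a - x b \<noteq> 0" by simp
  have "sw_pt a b x l = (if l = a then x b else if l = b then x a else x l)"
    by (auto simp: sw_pt_def)
  then show ?thesis using False ne assms(2)
    by (auto simp: diff_quot_def field_simps)
qed

lemma sw_pt_comp:
  assumes "\<sigma> permutes S" shows "sw_pt (\<sigma> a) (\<sigma> b) x \<circ> \<sigma> = sw_pt a b (x \<circ> \<sigma>)"
  unfolding sw_pt_def comp_assoc permutes_comp_swp[OF assms] ..

lemma diff_quot_comp:
  assumes "\<sigma> permutes S"
  shows "diff_quot (\<sigma> a) (\<sigma> b) (\<lambda>x. f (x \<circ> \<sigma>)) x = diff_quot a b f (x \<circ> \<sigma>)"
  by (simp add: diff_quot_def dir_deriv_comp[OF assms] sw_pt_comp[OF assms])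

lemma diff_quot_eqI:
  assumes f: "partially_diff f" and q: "partially_diff q" and "i \<noteq> j"
    and eq: "\<And>x. f x - f (sw_pt i j x) = (x i - x j) * q x"
  shows "diff_quot i j f x = q x"
proof (cases "x i = x j")
  case False then show ?thesis by (simp add: diff_quot_def eq)
next
  case True
  have "dir_deriv (unit_vec i) (\<lambda>x. f (sw_pt i j x)) x = dir_deriv (unit_vec j) f x"
    using dir_deriv_comp[OF swp_permutes_UNIV, of i j j f x] sw_pt_same[OF True] by (simp add: sw_pt_def)
  then have "dir_deriv (unit_vec i) f x - dir_deriv (unit_vec j) f x
      = dir_deriv (unit_vec i) (\<lambda>x. f x - f (sw_pt i j x)) x"
    using f by (simp add: dir_deriv_diff partially_diff_sw_pt)
  also have "\<dots> = dir_deriv (unit_vec i) (\<lambda>x. (x i - x j) * q x) x" by (simp add: eq)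
  also have "\<dots> = q x"
    using q True assms(3)
    by (simp add: dir_deriv_mult partially_diff_diff dir_deriv_diff dir_deriv_coord unit_vec_apply)
  finally show ?thesis using True by (simp add: diff_quot_def)
qed

lemma dunkl_unit:
  assumes a: "a < n"
  shows "dunkl n k (unit_vec a) f x = dir_deriv (unit_vec a) f x +
    of_real k * (\<Sum>b\<in>{..<n} - {a}. diff_quot a b f x)"
proof -
  let ?pairs = "{(i, j). i < j \<and> j < n}"
  let ?g = "\<lambda>(i, j). (unit_vec a i - unit_vec a j) * diff_quot i j f x"
  define pair where "pair b = (if b < a then (b, a) else (a, b))" for b
  have fin: "finite ?pairs" by (rule finite_subset[of _ "{..<n} \<times> {..<n}"]) auto
  have inj: "inj_on pair ({..<n} - {a})" by (auto simp: inj_on_def pair_def split: if_splits)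
  have sub: "pair ` ({..<n} - {a}) \<subseteq> ?pairs" using a by (auto simp: pair_def)
  have "?g p = 0" if p: "p \<in> ?pairs - pair ` ({..<n} - {a})" for p
  proof -
    obtain i j where ij: "p = (i, j)" "i < j" "j < n" using p by auto
    have "p = pair j" if "i = a" using ij that by (simp add: pair_def)
    moreover have "p = pair i" if "j = a" using ij that by (simp add: pair_def)
    ultimately have "i \<noteq> a" "j \<noteq> a" using p ij by auto
    then show ?thesis using ij by (simp add: unit_vec_apply)
  qed
  then have "sum ?g ?pairs = sum ?g (pair ` ({..<n} - {a}))"
    using fin sub by (intro sum.mono_neutral_right) auto
  also have "\<dots> = (\<Sum>b\<in>{..<n} - {a}. ?g (pair b))" by (simp add: sum.reindex[OF inj])
  also have "\<dots> = (\<Sum>b\<in>{..<n} - {a}. diff_quot a b f x)"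
    by (intro sum.cong) (auto simp: pair_def unit_vec_apply diff_quot_anti[of _ a])
  finally show ?thesis by (simp add: dunkl_def)
qed

lemma dunkl_add:
  assumes "a < n" "partially_diff f" "partially_diff g"
  shows "dunkl n k (unit_vec a) (\<lambda>x. f x + g x) x = dunkl n k (unit_vec a) f x + dunkl n k (unit_vec a) g x"
  using assms by (simp add: dunkl_unit dir_deriv_add diff_quot_add sum.distrib algebra_simps)

lemma dunkl_cmult:
  assumes "a < n" "partially_diff f"
  shows "dunkl n k (unit_vec a) (\<lambda>x. c * f x) x = c * dunkl n k (unit_vec a) f x"
  using assms
  by (simp add: dunkl_unit dir_deriv_cmult diff_quot_cmult sum_distrib_left[symmetric] algebra_simps)

lemma dunkl_zero: "a < n \<Longrightarrow> dunkl n k (unit_vec a) (\<lambda>x. 0) x = 0"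
  using dunkl_cmult[of a n "\<lambda>_. 0" k 0 x] by simp

lemma dunkl_sum:
  assumes "a < n" "\<And>i. i \<in> S \<Longrightarrow> partially_diff (f i)"
  shows "dunkl n k (unit_vec a) (\<lambda>x. \<Sum>i\<in>S. c i * f i x) x = (\<Sum>i\<in>S. c i * dunkl n k (unit_vec a) (f i) x)"
  using assms(2)
proof (induction S rule: infinite_finite_induct)
  case (insert i S)
  then have "partially_diff (\<lambda>x. c i * f i x)" "partially_diff (\<lambda>x. \<Sum>i\<in>S. c i * f i x)"
    by (auto intro!: partially_diff_sum partially_diff_mult)
  then show ?case using insert assms(1) by (simp add: dunkl_add dunkl_cmult)
qed (use assms(1) dunkl_zero in auto)

lemma dunkl_coord_mult_same:
  assumes "a < n" "partially_diff f"
  shows "dunkl n k (unit_vec a) (\<lambda>x. x a * f x) x = x a * dunkl n k (unit_vec a) f x + f x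
    + of_real k * (\<Sum>b\<in>{..<n} - {a}. f (sw_pt a b x))"
proof -
  have "(\<Sum>b\<in>{..<n} - {a}. diff_quot a b (\<lambda>x. x a * f x) x)
    = (\<Sum>b\<in>{..<n} - {a}. x a * diff_quot a b f x + f (sw_pt a b x))"
    using assms by (intro sum.cong refl) (auto simp: diff_quot_coord_mult)
  then show ?thesis using assms
    by (simp add: dunkl_unit dir_deriv_mult dir_deriv_coord unit_vec_apply sum.distrib
        sum_distrib_left[symmetric] algebra_simps)
qed

lemma dunkl_coord_mult_other:
  assumes "a < n" "b < n" "a \<noteq> b" "partially_diff f"
  shows "dunkl n k (unit_vec a) (\<lambda>x. x b * f x) x
    = x b * dunkl n k (unit_vec a) f x - of_real k * f (sw_pt a b x)"
proof -
  have "(\<Sum>c\<in>{..<n} - {a}. diff_quot a c (\<lambda>x. x b * f x) x)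
    = (\<Sum>c\<in>{..<n} - {a}. x b * diff_quot a c f x + (if c = b then - f (sw_pt a b x) else 0))"
    using assms by (intro sum.cong refl) (auto simp: diff_quot_coord_mult)
  also have "\<dots> = x b * (\<Sum>c\<in>{..<n} - {a}. diff_quot a c f x) - f (sw_pt a b x)"
    using assms by (simp add: sum.distrib sum_distrib_left[symmetric])
  finally have diff_quot_sum: "(\<Sum>c\<in>{..<n} - {a}. diff_quot a c (\<lambda>x. x b * f x) x)
    = x b * (\<Sum>c\<in>{..<n} - {a}. diff_quot a c f x) - f (sw_pt a b x)" .
  show ?thesis unfolding dunkl_unit[OF assms(1)] diff_quot_sum using assms
    by (simp add: dir_deriv_mult dir_deriv_coord unit_vec_apply algebra_simps)
qed

lemma dunkl_comp:
  assumes \<sigma>: "\<sigma> permutes {..<n}" and "b < n"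
  shows "dunkl n k (unit_vec (\<sigma> b)) (\<lambda>x. f (x \<circ> \<sigma>)) x = dunkl n k (unit_vec b) f (x \<circ> \<sigma>)"
proof -
  have \<sigma>b: "\<sigma> b < n" using assms by (simp add: permutes_lessThan_iff)
  have "bij_betw \<sigma> ({..<n} - {b}) ({..<n} - {\<sigma> b})"
    by (rule bij_betw_DiffI[OF permutes_imp_bij[OF \<sigma>], of "{b}" "{\<sigma> b}"]) (use assms \<sigma>b in auto)
  from sum.reindex_bij_betw[OF this, of "\<lambda>c. diff_quot (\<sigma> b) c (\<lambda>x. f (x \<circ> \<sigma>)) x"]
  have "(\<Sum>c\<in>{..<n} - {\<sigma> b}. diff_quot (\<sigma> b) c (\<lambda>x. f (x \<circ> \<sigma>)) x) = (\<Sum>c\<in>{..<n} - {b}. diff_quot b c f (x \<circ> \<sigma>))"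
    by (simp add: diff_quot_comp[OF \<sigma>])
  then show ?thesis using assms \<sigma>b by (simp add: dunkl_unit dir_deriv_comp[OF \<sigma>])
qed

lemma cher_D_sum:
  assumes "j < n" "\<And>i. i \<in> S \<Longrightarrow> partially_diff (f i)"
  shows "cher_D n k j (\<lambda>x. \<Sum>i\<in>S. c i * f i x) x = (\<Sum>i\<in>S. c i * cher_D n k j (f i) x)"
proof -
  have dunkl_lin: "dunkl n k (unit_vec j) (\<lambda>x. \<Sum>i\<in>S. c i * f i x) x
    = (\<Sum>i\<in>S. c i * dunkl n k (unit_vec j) (f i) x)"
    by (rule dunkl_sum[OF assms])
  have "cher_D n k j (\<lambda>x. \<Sum>i\<in>S. c i * f i x) x = x j * (\<Sum>i\<in>S. c i * dunkl n k (unit_vec j) (f i) x)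
    + of_real k * (1 - of_nat n) * (\<Sum>i\<in>S. c i * f i x)
    + of_real k * (\<Sum>i\<in>S. \<Sum>l\<in>{j<..<n}. c i * f i (sw_pt l j x))"
    unfolding cher_D_def dunkl_lin sum.swap[of _ "{j<..<n}" S] ..
  also have "\<dots> = (\<Sum>i\<in>S. c i * cher_D n k j (f i) x)"
    unfolding cher_D_def by (simp add: sum_distrib_left sum.distrib[symmetric] algebra_simps)
  finally show ?thesis .
qed

lemma cher_D_add:
  assumes "j < n" "partially_diff f" "partially_diff g"
  shows "cher_D n k j (\<lambda>x. f x + c * g x) x = cher_D n k j f x + c * cher_D n k j g x"
  using assms
  by (simp add: cher_D_def dunkl_add dunkl_cmult partially_diff_mult sum.distrib sum_distrib_left
      algebra_simps)

subsection \<open>Spans and independent families of functions\<close>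

interpretation fun_space: vector_space "\<lambda>(c::complex) (f :: 'p \<Rightarrow> complex) x. c * f x"
  by unfold_locales (auto simp: fun_eq_iff algebra_simps)

lemma fun_span_add:
  "f \<in> fun_space.span S \<Longrightarrow> g \<in> fun_space.span S \<Longrightarrow> (\<lambda>x. f x + g x) \<in> fun_space.span S"
  using fun_space.span_add[of f S g] by (simp add: plus_fun_def)

lemma fun_span_diff:
  "f \<in> fun_space.span S \<Longrightarrow> g \<in> fun_space.span S \<Longrightarrow> (\<lambda>x. f x - g x) \<in> fun_space.span S"
  using fun_space.span_diff[of f S g] by (simp add: fun_diff_def)

lemma fun_span_zero: "(\<lambda>x. 0) \<in> fun_space.span S"
  using fun_space.span_zero[of S] by (simp add: zero_fun_def)

lemma fun_span_sum: "(\<And>i. i \<in> I \<Longrightarrow> f i \<in> fun_space.span S) \<Longrightarrow> (\<lambda>x. \<Sum>i\<in>I. f i x) \<in> fun_space.span S"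
  by (induction I rule: infinite_finite_induct) (auto intro: fun_span_zero fun_span_add)

lemma fun_span_linear_combination: "A \<subseteq> B \<Longrightarrow> (\<lambda>x. \<Sum>\<kappa>\<in>A. c \<kappa> * F \<kappa> x) \<in> fun_space.span (F ` B)"
  by (intro fun_span_sum fun_space.span_scale[of "F _"] fun_space.span_base imageI) auto

lemma fun_span_image_obtain:
  assumes "finite A" "f \<in> fun_space.span (F ` A)"
  obtains c where "f = (\<lambda>x. \<Sum>\<kappa>\<in>A. c \<kappa> * F \<kappa> x)"
proof -
  have "\<exists>c. f = (\<lambda>x. \<Sum>\<kappa>\<in>A. c \<kappa> * F \<kappa> x)"
    using assms(2)
  proof (induction rule: fun_space.span_induct_alt)
    case base
    show ?case by (rule exI[of _ "\<lambda>_. 0"]) (simp add: zero_fun_def)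
  next
    case (step a g h)
    then obtain \<kappa> c where \<kappa>: "\<kappa> \<in> A" "g = F \<kappa>" and c: "h = (\<lambda>x. \<Sum>\<kappa>\<in>A. c \<kappa> * F \<kappa> x)" by blast
    have "(\<Sum>\<tau>\<in>A. (c \<tau> + (if \<tau> = \<kappa> then a else 0)) * F \<tau> x) = a * g x + h x" for x
    proof -
      have "(\<Sum>\<tau>\<in>A. (c \<tau> + (if \<tau> = \<kappa> then a else 0)) * F \<tau> x)
        = (\<Sum>\<tau>\<in>A. c \<tau> * F \<tau> x) + (\<Sum>\<tau>\<in>A. if \<tau> = \<kappa> then a * F \<tau> x else 0)"
        by (simp add: distrib_right sum.distrib if_distrib[of "\<lambda>c. c * _"] cong: if_cong)
      then show ?thesis using assms(1) \<kappa> c by simp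
    qed
    then show ?case
      by (intro exI[of _ "\<lambda>\<tau>. c \<tau> + (if \<tau> = \<kappa> then a else 0)"]) (simp add: plus_fun_def)
  qed
  then show ?thesis using that by blast
qed

definition indep_family :: "('i \<Rightarrow> 'p \<Rightarrow> complex) \<Rightarrow> 'i set \<Rightarrow> bool" where
  "indep_family F S \<longleftrightarrow> (\<forall>c. (\<forall>x. (\<Sum>\<kappa>\<in>S. c \<kappa> * F \<kappa> x) = 0) \<longrightarrow> (\<forall>\<kappa>\<in>S. c \<kappa> = 0))"

lemma indep_family_coeff_eq:
  assumes "indep_family F S" "\<And>x. (\<Sum>\<kappa>\<in>S. c \<kappa> * F \<kappa> x) = (\<Sum>\<kappa>\<in>S. d \<kappa> * F \<kappa> x)" "\<kappa> \<in> S"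
  shows "c \<kappa> = d \<kappa>"
proof -
  have "(\<Sum>\<kappa>\<in>S. (c \<kappa> - d \<kappa>) * F \<kappa> x) = 0" for x
    using assms(2) by (simp add: left_diff_distrib sum_subtractf)
  then show ?thesis using assms(1,3) unfolding indep_family_def by (metis eq_iff_diff_eq_0)
qed

lemma indep_family_not_in_span:
  assumes "indep_family F S" "finite S" "\<kappa> \<in> S" "(\<lambda>x. a * F \<kappa> x) \<in> fun_space.span (F ` (S - {\<kappa>}))"
  shows "a = 0"
proof -
  obtain c where c: "(\<lambda>x. a * F \<kappa> x) = (\<lambda>x. \<Sum>\<tau>\<in>S - {\<kappa>}. c \<tau> * F \<tau> x)"
    using assms(2,4) fun_span_image_obtain[of "S - {\<kappa>}"] by blast
  let ?c = "\<lambda>\<tau>. if \<tau> = \<kappa> then 0 else c \<tau>"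
  have "(\<Sum>\<tau>\<in>S. (if \<tau> = \<kappa> then a else 0) * F \<tau> x) = (\<Sum>\<tau>\<in>S. ?c \<tau> * F \<tau> x)" for x
    using fun_cong[OF c, of x] assms(2,3) by (simp add: sum.remove)
  from indep_family_coeff_eq[OF assms(1) this assms(3)] show ?thesis by simp
qed

lemma joint_eigenfunctions_indep:
  fixes F :: "'i \<Rightarrow> 'p \<Rightarrow> complex" and D :: "nat \<Rightarrow> ('p \<Rightarrow> complex) \<Rightarrow> 'p \<Rightarrow> complex"
  assumes "finite S"
    and D: "\<And>j c S' x. j < n \<Longrightarrow> S' \<subseteq> S \<Longrightarrow> D j (\<lambda>x. \<Sum>\<kappa>\<in>S'. c \<kappa> * F \<kappa> x) x = (\<Sum>\<kappa>\<in>S'. c \<kappa> * (ev j \<kappa> * F \<kappa> x))"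
    and separated: "\<And>\<kappa> \<kappa>'. \<kappa> \<in> S \<Longrightarrow> \<kappa>' \<in> S \<Longrightarrow> \<kappa> \<noteq> \<kappa>' \<Longrightarrow> \<exists>j<n. ev j \<kappa> \<noteq> ev j \<kappa>'"
    and nonzero: "\<And>\<kappa>. \<kappa> \<in> S \<Longrightarrow> \<exists>x. F \<kappa> x \<noteq> 0"
  shows "indep_family F S"
proof -
  have "\<forall>\<kappa>\<in>S'. c \<kappa> = 0" if "S' \<subseteq> S" "\<And>x. (\<Sum>\<kappa>\<in>S'. c \<kappa> * F \<kappa> x) = 0" for S' c
    using finite_subset[OF that(1) assms(1)] that
  proof (induction S' arbitrary: c rule: finite_induct)
    case (insert \<rho> S')
    have "c \<kappa> = 0" if \<kappa>: "\<kappa> \<in> S'" for \<kappa>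
    proof -
      have "\<kappa> \<noteq> \<rho>" "\<kappa> \<in> S" "\<rho> \<in> S" using \<kappa> insert by auto
      then obtain j where j: "j < n" "ev j \<kappa> \<noteq> ev j \<rho>" using separated by blast
      have "(\<Sum>\<kappa>\<in>insert \<rho> S'. c \<kappa> * (ev j \<kappa> * F \<kappa> x)) = D j (\<lambda>x. 0) x" for x
        using D[OF j(1) insert.prems(1), of c x] insert.prems(2) by simp
      then have D_zero: "(\<Sum>\<kappa>\<in>insert \<rho> S'. c \<kappa> * (ev j \<kappa> * F \<kappa> x)) = 0" for x
        using D[OF j(1), of "{}" _ x] by simp
      have "(\<Sum>\<kappa>\<in>S'. ((ev j \<kappa> - ev j \<rho>) * c \<kappa>) * F \<kappa> x) = 0" for x
      proof -
        have "(\<Sum>\<kappa>\<in>S'. ((ev j \<kappa> - ev j \<rho>) * c \<kappa>) * F \<kappa> x)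
          = (\<Sum>\<kappa>\<in>insert \<rho> S'. c \<kappa> * (ev j \<kappa> * F \<kappa> x)) - ev j \<rho> * (\<Sum>\<kappa>\<in>insert \<rho> S'. c \<kappa> * F \<kappa> x)"
          using insert.hyps by (simp add: sum_distrib_left sum_subtractf algebra_simps)
        then show ?thesis using D_zero[of x] insert.prems(2)[of x] by simp
      qed
      then have "(ev j \<kappa> - ev j \<rho>) * c \<kappa> = 0"
        using insert.IH[of "\<lambda>\<kappa>. (ev j \<kappa> - ev j \<rho>) * c \<kappa>"] insert.prems(1) \<kappa> by blast
      then show ?thesis using j by simp
    qed
    moreover obtain x where x: "F \<rho> x \<noteq> 0" using nonzero insert.prems(1) by blast
    ultimately show ?case using insert.prems(2)[of x] insert.hyps by auto
  qed simp
  then show ?thesis by (auto simp: indep_family_def)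
qed

subsection \<open>Monomials\<close>

lemma monom_split:
  assumes "j < n" shows "monom n \<eta> x = x j ^ \<eta> j * (\<Prod>i\<in>{..<n} - {j}. x i ^ \<eta> i)"
  unfolding monom_def using assms by (subst prod.remove[of _ j]) auto

lemma monom_cong: "(\<And>i. i < n \<Longrightarrow> \<eta> i = \<kappa> i) \<Longrightarrow> monom n \<eta> x = monom n \<kappa> x"
  by (simp add: monom_def)

lemma coord_mult_monom:
  assumes "j < n" shows "x j * monom n \<eta> x = monom n (\<eta>(j := Suc (\<eta> j))) x"
  unfolding monom_split[OF assms] by (simp add: ac_simps)

lemma monom_comp:
  assumes "\<sigma> permutes {..<n}" shows "monom n (\<eta> \<circ> \<sigma>) (x \<circ> \<sigma>) = monom n \<eta> x"
  unfolding monom_def using prod.permute[OF assms, of "\<lambda>i. x i ^ \<eta> i"] by (simp add: o_def)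

lemma monom_sw_pt:
  assumes "i < n" "j < n" shows "monom n \<eta> (sw_pt i j x) = monom n (\<eta> \<circ> swp i j) x"
  using monom_comp[OF swp_permutes[OF assms], of "\<eta> \<circ> swp i j" x] unfolding sw_pt_def by simp

lemma dir_deriv_monom:
  assumes "j < n"
  shows "dir_deriv (unit_vec j) (monom n \<eta>) x = of_nat (\<eta> j) * monom n (\<eta>(j := \<eta> j - 1)) x"
proof -
  let ?c = "\<Prod>i\<in>{..<n} - {j}. x i ^ \<eta> i"
  have "monom n \<eta> (coord_line j x t) = (x j + t) ^ \<eta> j * ?c" for t
    unfolding monom_split[OF assms]
    by (intro arg_cong2[of _ _ _ _ "(*)"] prod.cong) (auto simp: unit_vec_apply)
  moreover have "((\<lambda>t. (x j + t) ^ \<eta> j * ?c) has_field_derivative of_nat (\<eta> j) * x j ^ (\<eta> j - 1) * ?c) (at 0)"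
    by (auto intro!: derivative_eq_intros)
  ultimately have "dir_deriv (unit_vec j) (monom n \<eta>) x = of_nat (\<eta> j) * x j ^ (\<eta> j - 1) * ?c"
    by (intro dir_derivI) simp
  then show ?thesis unfolding monom_split[OF assms] by simp
qed

lemma coord_mult_dir_deriv_monom:
  assumes "j < n" shows "x j * dir_deriv (unit_vec j) (monom n \<eta>) x = of_nat (\<eta> j) * monom n \<eta> x"
proof (cases "\<eta> j")
  case (Suc m)
  then have "x j * monom n (\<eta>(j := \<eta> j - 1)) x = monom n \<eta> x"
    unfolding coord_mult_monom[OF assms] by (simp add: fun_upd_idem)
  then show ?thesis unfolding dir_deriv_monom[OF assms] by (simp only: mult.left_commute[of "x j"])
qed (simp add: dir_deriv_monom[OF assms])

text \<open>The monomials are joint eigenfunctions of the Euler operators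
  \<^term>\<open>\<lambda>f x. x j * dir_deriv (unit_vec j) f x\<close>.\<close>

lemma monoms_indep:
  assumes "finite S" "S \<subseteq> multi_idx n" shows "indep_family (monom n) S"
proof (rule joint_eigenfunctions_indep[where n = n, OF assms(1)])
  show "x j * dir_deriv (unit_vec j) (\<lambda>x. \<Sum>\<kappa>\<in>S'. c \<kappa> * monom n \<kappa> x) x
      = (\<Sum>\<kappa>\<in>S'. c \<kappa> * (of_nat (\<kappa> j) * monom n \<kappa> x))" if "j < n" for j c S' and x :: "nat \<Rightarrow> complex"
    using that by (simp add: dir_deriv_sum sum_distrib_left mult.left_commute[of "x j"]
        coord_mult_dir_deriv_monom)
  show "\<exists>j<n. of_nat (\<kappa> j) \<noteq> (of_nat (\<kappa>' j) :: complex)" if "\<kappa> \<in> S" "\<kappa>' \<in> S" "\<kappa> \<noteq> \<kappa>'" for \<kappa> \<kappa>'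
    using that multi_idx_eqI[of \<kappa> n \<kappa>'] assms(2) by auto
  show "\<exists>x. monom n \<kappa> x \<noteq> 0" for \<kappa> by (rule exI[of _ "\<lambda>_. 1"]) (simp add: monom_def)
qed

lemma deg_idx_monoms_indep: "indep_family (monom n) (deg_idx n m)"
  by (intro monoms_indep) (auto simp: deg_idx_multi)

lemma fun_span_monom_partially_diff:
  assumes "finite A" "f \<in> fun_space.span (monom n ` A)" shows "partially_diff f"
  using assms by (auto elim!: fun_span_image_obtain
      intro!: partially_diff_sum partially_diff_mult partially_diff_const partially_diff_monom)

subsection \<open>Triangularity of the Cherednik operators\<close>

lemma coord_mult_lowered_monom:
  assumes "i < n" "j < n" "i \<noteq> j" "l < \<eta> i"
  shows "x i * monom n ((move_units i j l \<eta>)(i := \<eta> i - Suc l)) x = monom n (move_units i j l \<eta>) x"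
    and "x j * monom n ((move_units i j l \<eta>)(i := \<eta> i - Suc l)) x = monom n (move_units i j (Suc l) \<eta>) x"
proof -
  let ?\<kappa> = "(move_units i j l \<eta>)(i := \<eta> i - Suc l)"
  have "?\<kappa>(i := Suc (?\<kappa> i)) = move_units i j l \<eta>" "?\<kappa>(j := Suc (?\<kappa> j)) = move_units i j (Suc l) \<eta>"
    using assms by (auto simp: move_units_def fun_eq_iff)
  then show "x i * monom n ?\<kappa> x = monom n (move_units i j l \<eta>) x"
    and "x j * monom n ?\<kappa> x = monom n (move_units i j (Suc l) \<eta>) x"
    using coord_mult_monom[OF assms(1), of x ?\<kappa>] coord_mult_monom[OF assms(2), of x ?\<kappa>] by simp_all
qed

lemma diff_quot_monom:
  assumes ij: "i < n" "j < n" and less: "\<eta> j < \<eta> i"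
  shows "diff_quot i j (monom n \<eta>) x
    = (\<Sum>l<\<eta> i - \<eta> j. monom n ((move_units i j l \<eta>)(i := \<eta> i - Suc l)) x)"
proof (rule diff_quot_eqI[where q = "\<lambda>x. \<Sum>l<\<eta> i - \<eta> j. monom n ((move_units i j l \<eta>)(i := \<eta> i - Suc l)) x"])
  show ne: "i \<noteq> j" using less by auto
  fix x :: "nat \<Rightarrow> complex"
  let ?d = "\<eta> i - \<eta> j" and ?m = "\<lambda>l. monom n (move_units i j l \<eta>) x"
  have "(x i - x j) * (\<Sum>l<?d. monom n ((move_units i j l \<eta>)(i := \<eta> i - Suc l)) x)
    = (\<Sum>l<?d. ?m l - ?m (Suc l))"
    unfolding sum_distrib_left using coord_mult_lowered_monom[OF ij ne, of _ \<eta> x]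
    by (intro sum.cong refl) (simp add: left_diff_distrib)
  also have "\<dots> = ?m 0 - ?m ?d" by (rule sum_lessThan_telescope')
  finally show "monom n \<eta> x - monom n \<eta> (sw_pt i j x)
    = (x i - x j) * (\<Sum>l<?d. monom n ((move_units i j l \<eta>)(i := \<eta> i - Suc l)) x)"
    using less ne by (simp add: move_units_zero move_units_all monom_sw_pt[OF ij])
qed auto

lemma diff_quot_monom_equal:
  assumes "i < n" "j < n" "i \<noteq> j" "\<eta> i = \<eta> j" shows "diff_quot i j (monom n \<eta>) x = 0"
proof (rule diff_quot_eqI[where q = "\<lambda>_. 0"])
  fix x
  have "\<eta> \<circ> swp i j = \<eta>" using assms by (auto simp: fun_eq_iff swp_def)
  then show "monom n \<eta> x - monom n \<eta> (sw_pt i j x) = (x i - x j) * 0"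
    using monom_sw_pt[OF assms(1,2), of \<eta> x] by simp
qed (use assms in auto)

lemma coord_mult_diff_quot_monom_low:
  assumes \<eta>: "\<eta> \<in> multi_idx n" and ij: "i < n" "j < n" and less: "\<eta> j < \<eta> i"
  shows "(\<lambda>x. x i * diff_quot i j (monom n \<eta>) x - monom n \<eta> x) \<in> fun_space.span (monom n ` low_idx n \<eta>)"
    and "(\<lambda>x. x j * diff_quot i j (monom n \<eta>) x - monom n \<eta> (sw_pt i j x))
      \<in> fun_space.span (monom n ` low_idx n \<eta>)"
proof -
  have ne: "i \<noteq> j" using less by auto
  obtain d where d: "\<eta> i - \<eta> j = Suc d" using less by (metis Suc_diff_Suc)
  let ?low = "\<lambda>x. \<Sum>l<d. monom n (move_units i j (Suc l) \<eta>) x"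
  have low: "?low \<in> fun_space.span (monom n ` low_idx n \<eta>)"
    using d by (intro fun_span_sum fun_space.span_base imageI)
      (auto simp: low_idx_def intro!: move_units_multi[OF \<eta> ij] prec_move_units[OF \<eta> ij])
  have mult: "x i * diff_quot i j (monom n \<eta>) x = (\<Sum>l<Suc d. monom n (move_units i j l \<eta>) x)"
    "x j * diff_quot i j (monom n \<eta>) x = (\<Sum>l<Suc d. monom n (move_units i j (Suc l) \<eta>) x)" for x
    unfolding diff_quot_monom[where \<eta> = \<eta>, OF ij less] d sum_distrib_left
    using d by (intro sum.cong refl coord_mult_lowered_monom[OF ij ne]; simp)+
  have "(\<lambda>x. x i * diff_quot i j (monom n \<eta>) x - monom n \<eta> x) = ?low"
    unfolding mult by (simp add: sum.lessThan_Suc_shift move_units_zero del: sum.lessThan_Suc)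
  with low show "(\<lambda>x. x i * diff_quot i j (monom n \<eta>) x - monom n \<eta> x)
      \<in> fun_space.span (monom n ` low_idx n \<eta>)" by simp
  have "move_units i j (Suc d) \<eta> = \<eta> \<circ> swp i j"
    unfolding d[symmetric] using less ne by (intro move_units_all) auto
  then have "(\<lambda>x. x j * diff_quot i j (monom n \<eta>) x - monom n \<eta> (sw_pt i j x)) = ?low"
    unfolding mult by (simp add: monom_sw_pt[OF ij])
  with low show "(\<lambda>x. x j * diff_quot i j (monom n \<eta>) x - monom n \<eta> (sw_pt i j x))
      \<in> fun_space.span (monom n ` low_idx n \<eta>)" by simp
qed

lemma monom_sw_pt_low:
  assumes "\<eta> \<in> multi_idx n" "p < q" "q < n" "\<eta> q < \<eta> p"
  shows "(\<lambda>x. monom n \<eta> (sw_pt p q x)) \<in> fun_space.span (monom n ` low_idx n \<eta>)"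
proof -
  have "\<eta> \<circ> swp p q \<in> low_idx n \<eta>"
    using assms by (auto simp: low_idx_def intro!: prec_swap multi_idx_comp swp_permutes)
  then show ?thesis using assms by (simp add: monom_sw_pt fun_space.span_base)
qed

lemma cher_D_summand_monom_low:
  assumes \<eta>: "\<eta> \<in> multi_idx n" and ij: "i < n" "j < n" "i \<noteq> j"
  shows "(\<lambda>x. x j * diff_quot j i (monom n \<eta>) x + (if j < i then monom n \<eta> (sw_pt i j x) else 0)
      - (if sorts_before \<eta> i j then 0 else monom n \<eta> x)) \<in> fun_space.span (monom n ` low_idx n \<eta>)"
    (is "?f \<in> ?V")
proof -
  consider (less) "\<eta> i < \<eta> j" | (equal) "\<eta> i = \<eta> j" | (greater) "\<eta> j < \<eta> i" by linarith
  then show ?thesis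
  proof cases
    case less
    have "(\<lambda>x. if j < i then monom n \<eta> (sw_pt i j x) else 0) \<in> ?V"
      using monom_sw_pt_low[OF \<eta>, of j i, unfolded sw_pt_commute[of j i]] less ij
      by (cases "j < i") (auto intro: fun_span_zero)
    moreover have "\<not> sorts_before \<eta> i j" using less by (simp add: sorts_before_def)
    ultimately show ?thesis
      using fun_span_add[OF coord_mult_diff_quot_monom_low(1)[OF \<eta> ij(2,1) less],
          of "\<lambda>x. if j < i then monom n \<eta> (sw_pt i j x) else 0"]
      by (simp only: if_False) (simp add: algebra_simps)
  next
    case equal
    have "\<eta> \<circ> swp i j = \<eta>" using equal by (auto simp: fun_eq_iff swp_def)
    then have "?f = (\<lambda>x. 0)"
      using ij equal diff_quot_monom_equal[of j n i \<eta>] by (auto simp: sorts_before_def monom_sw_pt)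
    then show ?thesis by (simp add: fun_span_zero)
  next
    case greater
    note low = coord_mult_diff_quot_monom_low(2)[OF \<eta> ij(1,2) greater]
    have "(\<lambda>x. if i < j then monom n \<eta> (sw_pt i j x) else 0) \<in> ?V"
      using monom_sw_pt_low[OF \<eta>, of i j] greater ij by (cases "i < j") (auto intro: fun_span_zero)
    from fun_space.span_scale[OF fun_span_add[OF low this], of "-1"]
    have "(\<lambda>x. - 1 * (x j * diff_quot i j (monom n \<eta>) x - monom n \<eta> (sw_pt i j x)
      + (if i < j then monom n \<eta> (sw_pt i j x) else 0))) \<in> ?V" .
    moreover have "?f = (\<lambda>x. - 1 * (x j * diff_quot i j (monom n \<eta>) x - monom n \<eta> (sw_pt i j x)
      + (if i < j then monom n \<eta> (sw_pt i j x) else 0)))"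
      using greater ij(3) by (auto simp: sorts_before_def diff_quot_anti[of j i] fun_eq_iff)
    ultimately show ?thesis by simp
  qed
qed

lemma sum_not_sorts_before:
  assumes "j < n"
  shows "(\<Sum>i\<in>{..<n} - {j}. if sorts_before \<eta> i j then 0 else a)
    = (of_nat (n - 1) - of_nat (sort_rank n \<eta> j)) * (a::complex)"
proof -
  let ?I = "{..<n} - {j}"
  have "(\<Sum>i\<in>?I. if sorts_before \<eta> i j then 0 else a) = (\<Sum>i\<in>?I. a - (if sorts_before \<eta> i j then a else 0))"
    by (intro sum.cong) auto
  also have "\<dots> = of_nat (card ?I) * a - of_nat (card {i \<in> ?I. sorts_before \<eta> i j}) * a"
    by (simp only: sum_subtractf sum.inter_filter[symmetric] finite_Diff finite_lessThan sum_constant)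
  also have "{i \<in> ?I. sorts_before \<eta> i j} = {i. i < n \<and> sorts_before \<eta> i j}" using sorts_before_irrefl by auto
  finally show ?thesis using assms by (simp add: sort_rank_def left_diff_distrib)
qed

lemma cher_D_monom_low:
  assumes \<eta>: "\<eta> \<in> multi_idx n" and j: "j < n"
  shows "(\<lambda>x. cher_D n k j (monom n \<eta>) x - of_real (eigval n k \<eta> j) * monom n \<eta> x)
    \<in> fun_space.span (monom n ` low_idx n \<eta>)"
proof -
  let ?I = "{..<n} - {j}"
  let ?g = "\<lambda>i x. x j * diff_quot j i (monom n \<eta>) x + (if j < i then monom n \<eta> (sw_pt i j x) else 0)
    - (if sorts_before \<eta> i j then 0 else monom n \<eta> x)"
  have "cher_D n k j (monom n \<eta>) x - of_real (eigval n k \<eta> j) * monom n \<eta> x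
    = of_real k * (\<Sum>i\<in>?I. ?g i x)" for x
  proof -
    have "(\<Sum>i\<in>{j<..<n}. monom n \<eta> (sw_pt i j x)) = (\<Sum>i\<in>?I. if j < i then monom n \<eta> (sw_pt i j x) else 0)"
      by (rule sum.mono_neutral_cong_left) auto
    then have sum_g: "(\<Sum>i\<in>?I. ?g i x) = x j * (\<Sum>i\<in>?I. diff_quot j i (monom n \<eta>) x)
      + (\<Sum>i\<in>{j<..<n}. monom n \<eta> (sw_pt i j x))
      - (of_nat (n - 1) - of_nat (sort_rank n \<eta> j)) * monom n \<eta> x"
      by (simp only: sum_subtractf sum.distrib sum_distrib_left sum_not_sorts_before[OF j])
    have cher: "cher_D n k j (monom n \<eta>) x = of_nat (\<eta> j) * monom n \<eta> x
      + of_real k * (1 - of_nat n) * monom n \<eta> x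
      + of_real k * (x j * (\<Sum>i\<in>?I. diff_quot j i (monom n \<eta>) x) + (\<Sum>i\<in>{j<..<n}. monom n \<eta> (sw_pt i j x)))"
      unfolding cher_D_def dunkl_unit[OF j]
      by (simp add: coord_mult_dir_deriv_monom[OF j, symmetric] algebra_simps)
    show ?thesis unfolding sum_g cher using j by (simp add: eigval_sort_rank algebra_simps of_nat_diff)
  qed
  moreover have "(\<lambda>x. of_real k * (\<Sum>i\<in>?I. ?g i x)) \<in> fun_space.span (monom n ` low_idx n \<eta>)"
    using \<eta> j
    by (intro fun_space.span_scale[of "\<lambda>x. \<Sum>i\<in>?I. ?g i x"] fun_span_sum cher_D_summand_monom_low) auto
  ultimately show ?thesis by simp
qed

lemma cher_D_monom_diagonal:
  assumes \<kappa>: "\<kappa> \<in> deg_idx n m" and maximal: "\<not> prec n \<rho> \<kappa>" and j: "j < n"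
  shows "(\<lambda>x. cher_D n k j (monom n \<kappa>) x - (if \<kappa> = \<rho> then of_real (eigval n k \<rho> j) * monom n \<rho> x else 0))
    \<in> fun_space.span (monom n ` (deg_idx n m - {\<rho>}))" (is "?f \<in> fun_space.span ?V")
proof -
  have "monom n ` low_idx n \<kappa> \<subseteq> ?V"
    using low_idx_subset[OF \<kappa>] maximal by (auto simp: low_idx_def)
  then have "(\<lambda>x. cher_D n k j (monom n \<kappa>) x - of_real (eigval n k \<kappa> j) * monom n \<kappa> x) \<in> fun_space.span ?V"
    using cher_D_monom_low[OF deg_idx_multi[OF \<kappa>] j] fun_space.span_mono by blast
  moreover have "(\<lambda>x. if \<kappa> = \<rho> then 0 else of_real (eigval n k \<kappa> j) * monom n \<kappa> x) \<in> fun_space.span ?V"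
    using \<kappa> by (cases "\<kappa> = \<rho>")
      (auto intro: fun_span_zero fun_space.span_scale[of "monom n \<kappa>"] fun_space.span_base)
  ultimately have "(\<lambda>x. cher_D n k j (monom n \<kappa>) x - of_real (eigval n k \<kappa> j) * monom n \<kappa> x
    + (if \<kappa> = \<rho> then 0 else of_real (eigval n k \<kappa> j) * monom n \<kappa> x)) \<in> fun_space.span ?V"
    by (rule fun_span_add)
  then show ?thesis by (cases "\<kappa> = \<rho>") auto
qed

lemma eigenfunction_maximal_idx:
  assumes k: "0 \<le> k" and \<eta>: "\<eta> \<in> multi_idx n"
    and f: "f = (\<lambda>x. \<Sum>\<kappa>\<in>deg_idx n m. c \<kappa> * monom n \<kappa> x)"
    and eig: "\<And>j x. j < n \<Longrightarrow> cher_D n k j f x = of_real (eigval n k \<eta> j) * f x"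
    and \<rho>: "\<rho> \<in> deg_idx n m" "c \<rho> \<noteq> 0"
    and maximal: "\<And>\<tau>. \<tau> \<in> deg_idx n m \<Longrightarrow> c \<tau> \<noteq> 0 \<Longrightarrow> \<not> prec n \<rho> \<tau>"
  shows "\<rho> = \<eta>"
proof -
  let ?M = "deg_idx n m" and ?V = "fun_space.span (monom n ` (deg_idx n m - {\<rho>}))"
  have "eigval n k \<rho> j = eigval n k \<eta> (id j)" if j: "j < n" for j
  proof -
    let ?t = "\<lambda>\<kappa> x. if \<kappa> = \<rho> then of_real (eigval n k \<rho> j) * monom n \<rho> x else 0"
    let ?D = "\<lambda>x. \<Sum>\<kappa>\<in>?M. c \<kappa> * (cher_D n k j (monom n \<kappa>) x - ?t \<kappa> x)"
    let ?g = "\<lambda>x. \<Sum>\<kappa>\<in>?M - {\<rho>}. c \<kappa> * monom n \<kappa> x"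
    have "(\<lambda>x. c \<kappa> * (cher_D n k j (monom n \<kappa>) x - ?t \<kappa> x)) \<in> ?V" if \<kappa>: "\<kappa> \<in> ?M" for \<kappa>
      using cher_D_monom_diagonal[OF \<kappa> maximal[OF \<kappa>] j, of k]
      by (cases "c \<kappa> = 0") (auto intro: fun_span_zero fun_space.span_scale)
    then have "?D \<in> ?V" by (intro fun_span_sum)
    moreover have "(\<lambda>x. of_real (eigval n k \<eta> j) * ?g x) \<in> ?V"
      by (intro fun_space.span_scale[of ?g] fun_span_linear_combination order_refl)
    ultimately have diff: "(\<lambda>x. ?D x - of_real (eigval n k \<eta> j) * ?g x) \<in> ?V" by (rule fun_span_diff)
    have "?D x - of_real (eigval n k \<eta> j) * ?g x
      = ((of_real (eigval n k \<eta> j) - of_real (eigval n k \<rho> j)) * c \<rho>) * monom n \<rho> x" for x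
    proof -
      have "(\<Sum>\<kappa>\<in>?M. c \<kappa> * cher_D n k j (monom n \<kappa>) x) = of_real (eigval n k \<eta> j) * (\<Sum>\<kappa>\<in>?M. c \<kappa> * monom n \<kappa> x)"
        using eig[OF j, of x] cher_D_sum[OF j, of ?M "monom n" k c x] unfolding f by simp
      moreover have "(\<Sum>\<kappa>\<in>?M. c \<kappa> * ?t \<kappa> x) = c \<rho> * (of_real (eigval n k \<rho> j) * monom n \<rho> x)"
        using \<rho>(1) by (simp add: if_distrib[of "\<lambda>t. _ * t"] cong: if_cong)
      ultimately show ?thesis
        using \<rho>(1) by (simp add: right_diff_distrib sum_subtractf sum.remove[of ?M \<rho>] algebra_simps)
    qed
    with diff have "(of_real (eigval n k \<eta> j) - complex_of_real (eigval n k \<rho> j)) * c \<rho> = 0"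
      by (intro indep_family_not_in_span[OF deg_idx_monoms_indep finite_deg_idx \<rho>(1)]) simp
    then show ?thesis using \<rho>(2) by simp
  qed
  then show ?thesis
    using eigval_determines_idx[OF k deg_idx_multi[OF \<rho>(1)] \<eta> permutes_id] by simp
qed

lemma eigenfunction_support:
  assumes k: "0 \<le> k" and \<eta>: "\<eta> \<in> multi_idx n"
    and f: "f = (\<lambda>x. \<Sum>\<kappa>\<in>deg_idx n m. c \<kappa> * monom n \<kappa> x)"
    and eig: "\<And>j x. j < n \<Longrightarrow> cher_D n k j f x = of_real (eigval n k \<eta> j) * f x"
    and \<kappa>: "\<kappa> \<in> deg_idx n m" "c \<kappa> \<noteq> 0"
  shows "\<kappa> = \<eta> \<or> \<kappa> \<in> low_idx n \<eta>"
proof (rule ccontr)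
  define B where "B = {\<kappa> \<in> deg_idx n m. c \<kappa> \<noteq> 0 \<and> \<kappa> \<noteq> \<eta> \<and> \<not> prec n \<kappa> \<eta>}"
  assume "\<not> (\<kappa> = \<eta> \<or> \<kappa> \<in> low_idx n \<eta>)"
  then have "B \<noteq> {}" using \<kappa> by (auto simp: B_def low_idx_def deg_idx_multi)
  moreover have "finite B" "B \<subseteq> multi_idx n" by (auto simp: B_def deg_idx_multi)
  ultimately obtain \<rho> where \<rho>: "\<rho> \<in> B" and maximal: "\<And>\<tau>. \<tau> \<in> B \<Longrightarrow> \<not> prec n \<rho> \<tau>"
    using prec_maximal_exists by blast
  have "\<not> prec n \<rho> \<tau>" if "\<tau> \<in> deg_idx n m" "c \<tau> \<noteq> 0" for \<tau>
  proof
    assume less: "prec n \<rho> \<tau>"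
    then have "\<tau> \<noteq> \<eta>" "\<not> prec n \<tau> \<eta>"
      using \<rho> that prec_trans[OF less] by (auto simp: B_def deg_idx_multi)
    then show False using maximal[of \<tau>] less that by (simp add: B_def)
  qed
  then have "\<rho> = \<eta>" using \<rho> by (intro eigenfunction_maximal_idx[OF k \<eta> f eig]) (auto simp: B_def)
  then show False using \<rho> by (simp add: B_def)
qed

lemma eigenfunction_low_eq_zero:
  assumes k: "0 \<le> k" and \<eta>: "\<eta> \<in> multi_idx n"
    and f: "f \<in> fun_space.span (monom n ` low_idx n \<eta>)"
    and eig: "\<And>j x. j < n \<Longrightarrow> cher_D n k j f x = of_real (eigval n k \<eta> j) * f x"
  shows "f = (\<lambda>x. 0)"
proof -
  let ?M = "deg_idx n (absv n \<eta>)"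
  obtain c where c: "f = (\<lambda>x. \<Sum>\<kappa>\<in>low_idx n \<eta>. c \<kappa> * monom n \<kappa> x)"
    using fun_span_image_obtain[OF finite_low_idx[OF \<eta>] f] .
  define B where "B = {\<kappa> \<in> low_idx n \<eta>. c \<kappa> \<noteq> 0}"
  have "B = {}"
  proof (rule ccontr)
    assume "B \<noteq> {}"
    moreover have "finite B" unfolding B_def using finite_low_idx[OF \<eta>] by simp
    moreover have "B \<subseteq> multi_idx n" by (auto simp: B_def low_idx_def)
    ultimately obtain \<rho> where \<rho>: "\<rho> \<in> B" and maximal: "\<And>\<tau>. \<tau> \<in> B \<Longrightarrow> \<not> prec n \<rho> \<tau>"
      using prec_maximal_exists by blast
    let ?c = "\<lambda>\<kappa>. if \<kappa> \<in> low_idx n \<eta> then c \<kappa> else 0"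
    have "f = (\<lambda>x. \<Sum>\<kappa>\<in>?M. ?c \<kappa> * monom n \<kappa> x)"
      unfolding c using low_idx_subset[OF deg_idx_absv[OF \<eta>]]
      by (intro ext sum.mono_neutral_cong_left) auto
    then have "\<rho> = \<eta>"
      using \<rho> maximal low_idx_subset[OF deg_idx_absv[OF \<eta>]]
      by (intro eigenfunction_maximal_idx[OF k \<eta> _ eig, where c = ?c]) (auto simp: B_def split: if_splits)
    then show False using \<rho> not_in_low_idx by (simp add: B_def)
  qed
  then show ?thesis unfolding c by (auto simp: B_def intro!: sum.neutral)
qed

subsection \<open>The raising operator of Knop and Sahi\<close>

definition cyc :: "nat \<Rightarrow> nat \<Rightarrow> nat" where
  "cyc n m = (if Suc m < n then Suc m else if Suc m = n then 0 else m)"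

definition cyc_inv :: "nat \<Rightarrow> nat \<Rightarrow> nat" where
  "cyc_inv n m = (if m < n then (if m = 0 then n - 1 else m - 1) else m)"

lemma cyc_cyc_inv [simp]: "cyc n (cyc_inv n m) = m" and cyc_inv_cyc [simp]: "cyc_inv n (cyc n m) = m"
  by (auto simp: cyc_def cyc_inv_def)

lemma comp_cyc_cyc_inv [simp]: "f \<circ> cyc n \<circ> cyc_inv n = f"
  and comp_cyc_inv_cyc [simp]: "f \<circ> cyc_inv n \<circ> cyc n = f"
  by (auto simp: fun_eq_iff)

lemma cyc_permutes: "cyc n permutes {..<n}"
proof (rule bij_imp_permutes)
  show "bij_betw (cyc n) {..<n} {..<n}"
    by (rule bij_betw_byWitness[where f' = "cyc_inv n"]) (auto simp: cyc_def cyc_inv_def)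
qed (auto simp: cyc_def)

lemma cyc_inv_permutes: "cyc_inv n permutes {..<n}"
proof (rule bij_imp_permutes)
  show "bij_betw (cyc_inv n) {..<n} {..<n}"
    by (rule bij_betw_byWitness[where f' = "cyc n"]) (auto simp: cyc_def cyc_inv_def)
qed (auto simp: cyc_inv_def)

definition raise_idx :: "nat \<Rightarrow> (nat \<Rightarrow> nat) \<Rightarrow> nat \<Rightarrow> nat" where
  "raise_idx n \<eta> m = (if Suc m < n then \<eta> (Suc m) else if Suc m = n then Suc (\<eta> 0) else 0)"

definition lower_idx :: "nat \<Rightarrow> (nat \<Rightarrow> nat) \<Rightarrow> nat \<Rightarrow> nat" where
  "lower_idx n \<kappa> m = (if m = 0 then \<kappa> (n - 1) - 1 else if m < n then \<kappa> (m - 1) else 0)"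

lemma raise_idx_multi [simp]: "raise_idx n \<eta> \<in> multi_idx n"
  by (auto simp: multi_idx_def raise_idx_def)

lemma lower_idx_multi: "1 \<le> n \<Longrightarrow> lower_idx n \<kappa> \<in> multi_idx n"
  by (auto simp: multi_idx_def lower_idx_def)

lemma raise_idx_last: "1 \<le> n \<Longrightarrow> raise_idx n \<eta> (n - 1) = Suc (\<eta> 0)"
  by (simp add: raise_idx_def)

lemma lower_raise_idx: "1 \<le> n \<Longrightarrow> \<eta> \<in> multi_idx n \<Longrightarrow> lower_idx n (raise_idx n \<eta>) = \<eta>"
  by (auto simp: fun_eq_iff multi_idx_def lower_idx_def raise_idx_def)

lemma raise_lower_idx: "1 \<le> n \<Longrightarrow> \<kappa> \<in> multi_idx n \<Longrightarrow> 0 < \<kappa> (n - 1) \<Longrightarrow> raise_idx n (lower_idx n \<kappa>) = \<kappa>"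
  by (auto simp: fun_eq_iff multi_idx_def lower_idx_def raise_idx_def)

lemma absv_raise_idx:
  assumes "1 \<le> n" shows "absv n (raise_idx n \<eta>) = Suc (absv n \<eta>)"
proof -
  obtain p where p: "n = Suc p" using assms by (cases n) auto
  have "absv n (raise_idx n \<eta>) = (\<Sum>i<p. raise_idx n \<eta> i) + raise_idx n \<eta> p"
    unfolding absv_def p by (rule sum.lessThan_Suc)
  also have "(\<Sum>i<p. raise_idx n \<eta> i) = (\<Sum>i<p. \<eta> (Suc i))"
    using p by (intro sum.cong) (auto simp: raise_idx_def)
  also have "raise_idx n \<eta> p = Suc (\<eta> 0)" using p by (simp add: raise_idx_def)
  also have "(\<Sum>i<p. \<eta> (Suc i)) + Suc (\<eta> 0) = Suc (absv n \<eta>)"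
    unfolding absv_def p by (simp add: sum.lessThan_Suc_shift del: sum.lessThan_Suc)
  finally show ?thesis .
qed

lemma bij_betw_raise_idx:
  assumes "1 \<le> n" shows "bij_betw (raise_idx n) (multi_idx n) {\<kappa> \<in> multi_idx n. 0 < \<kappa> (n - 1)}"
  by (rule bij_betw_byWitness[where f' = "lower_idx n"])
    (use assms in \<open>auto simp: lower_raise_idx raise_lower_idx lower_idx_multi raise_idx_def\<close>)

lemma bij_betw_raise_idx_deg:
  assumes n: "1 \<le> n"
  shows "bij_betw (raise_idx n) (deg_idx n m) {\<kappa> \<in> deg_idx n (Suc m). 0 < \<kappa> (n - 1)}"
proof (rule bij_betw_byWitness[where f' = "lower_idx n"])
  show "lower_idx n ` {\<kappa> \<in> deg_idx n (Suc m). 0 < \<kappa> (n - 1)} \<subseteq> deg_idx n m"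
  proof clarify
    fix \<kappa> assume "\<kappa> \<in> deg_idx n (Suc m)" "0 < \<kappa> (n - 1)"
    then show "lower_idx n \<kappa> \<in> deg_idx n m"
      using absv_raise_idx[OF n, of "lower_idx n \<kappa>"] raise_lower_idx[OF n, of \<kappa>]
      by (simp add: deg_idx_def lower_idx_multi[OF n])
  qed
qed (use n in \<open>auto simp: deg_idx_def lower_raise_idx raise_lower_idx absv_raise_idx raise_idx_def\<close>)

lemma sort_rank_raise_idx:
  assumes "1 \<le> n" shows "sort_rank n (raise_idx n \<eta>) = sort_rank n \<eta> \<circ> cyc n"
proof (rule sort_rank_eqI)
  show "sort_rank n \<eta> \<circ> cyc n permutes {..<n}" by (intro permutes_compose cyc_permutes sort_rank_permutes)
  fix i j assume ij: "i < n" "j < n" "sorts_before (raise_idx n \<eta>) i j"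
  then have "sorts_before \<eta> (cyc n i) (cyc n j)"
    by (cases "Suc i = n"; cases "Suc j = n") (auto simp: sorts_before_def cyc_def raise_idx_def)
  then show "(sort_rank n \<eta> \<circ> cyc n) i < (sort_rank n \<eta> \<circ> cyc n) j"
    using ij by (simp add: sort_rank_less_iff permutes_lessThan_iff[OF cyc_permutes])
qed

lemma eigval_raise_idx:
  "Suc j < n \<Longrightarrow> eigval n k (raise_idx n \<eta>) j = eigval n k \<eta> (Suc j)"
  "1 \<le> n \<Longrightarrow> eigval n k (raise_idx n \<eta>) (n - 1) = eigval n k \<eta> 0 + 1"
  by (simp_all add: eigval_sort_rank sort_rank_raise_idx cyc_def) (simp_all add: raise_idx_def)

definition raise_op :: "nat \<Rightarrow> ((nat \<Rightarrow> complex) \<Rightarrow> complex) \<Rightarrow> (nat \<Rightarrow> complex) \<Rightarrow> complex" where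
  "raise_op n f x = x (n - 1) * f (x \<circ> cyc_inv n)"

lemma raise_op_monom:
  assumes "1 \<le> n" shows "raise_op n (monom n \<eta>) x = monom n (raise_idx n \<eta>) x"
proof -
  have "monom n \<eta> (x \<circ> cyc_inv n) = monom n (\<eta> \<circ> cyc n) x"
    using monom_comp[OF cyc_permutes, of n \<eta> "x \<circ> cyc_inv n"] by (simp only: comp_cyc_inv_cyc)
  then have "raise_op n (monom n \<eta>) x = monom n ((\<eta> \<circ> cyc n)(n - 1 := Suc ((\<eta> \<circ> cyc n) (n - 1)))) x"
    unfolding raise_op_def using assms by (simp only: coord_mult_monom)
  also have "\<dots> = monom n (raise_idx n \<eta>) x"
    using assms by (intro monom_cong) (auto simp: cyc_def raise_idx_def)
  finally show ?thesis .
qed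

lemma raise_op_sum: "raise_op n (\<lambda>x. \<Sum>\<kappa>\<in>S. c \<kappa> * f \<kappa> x) x = (\<Sum>\<kappa>\<in>S. c \<kappa> * raise_op n (f \<kappa>) x)"
  by (simp add: raise_op_def sum_distrib_left algebra_simps)

lemma dunkl_first_coord_mult:
  assumes "1 \<le> n" "partially_diff f"
  shows "dunkl n k (unit_vec 0) (\<lambda>x. x 0 * f x) x = cher_D n k 0 f x + f x + of_real k * (of_nat n - 1) * f x"
proof -
  have "{..<n} - {0} = {0<..<n}" by auto
  then show ?thesis using assms
    by (simp add: dunkl_coord_mult_same cher_D_def sw_pt_commute[of 0] algebra_simps)
qed

lemma dunkl_last_raise_op:
  assumes n: "1 \<le> n"
  shows "dunkl n k (unit_vec (n - 1)) (raise_op n f) x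
    = dunkl n k (unit_vec 0) (\<lambda>x. x 0 * f x) (x \<circ> cyc_inv n)"
proof -
  have last: "cyc_inv n 0 = n - 1" using n by (simp add: cyc_inv_def)
  have "raise_op n f = (\<lambda>x. (\<lambda>x. x 0 * f x) (x \<circ> cyc_inv n))" by (auto simp: raise_op_def last)
  then show ?thesis using dunkl_comp[OF cyc_inv_permutes, of 0 n k "\<lambda>x. x 0 * f x" x] n last by simp
qed

lemma cher_D_last_raise_op:
  assumes n: "1 \<le> n" and f: "partially_diff f"
  shows "cher_D n k (n - 1) (raise_op n f) x = raise_op n (\<lambda>x. cher_D n k 0 f x + f x) x"
proof -
  have "{n - 1<..<n} = {}" by auto
  then show ?thesis
    unfolding cher_D_def[of n k "n - 1"] dunkl_last_raise_op[OF n] dunkl_first_coord_mult[OF n f]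
    by (simp add: raise_op_def algebra_simps)
qed

lemma cher_D_raise_op:
  assumes j: "Suc j < n" and f: "partially_diff f"
  shows "cher_D n k j (raise_op n f) x = raise_op n (cher_D n k (Suc j) f) x"
proof -
  define g where "g x = f (x \<circ> cyc_inv n)" for x
  have g: "partially_diff g" unfolding g_def[abs_def] by (rule partially_diff_comp[OF f cyc_inv_permutes])
  have raise: "raise_op n f = (\<lambda>x. x (n - 1) * g x)" by (auto simp: raise_op_def g_def)
  have pred: "cyc_inv n (Suc i) = i" if "Suc i < n" for i using that by (simp add: cyc_inv_def)
  have "dunkl n k (unit_vec j) g x = dunkl n k (unit_vec (Suc j)) f (x \<circ> cyc_inv n)"
    using dunkl_comp[OF cyc_inv_permutes, of "Suc j" n k f x] j pred unfolding g_def[abs_def] by simp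
  then have dunkl: "dunkl n k (unit_vec j) (\<lambda>x. x (n - 1) * g x) x
      = x (n - 1) * dunkl n k (unit_vec (Suc j)) f (x \<circ> cyc_inv n) - of_real k * g (sw_pt j (n - 1) x)"
    using dunkl_coord_mult_other[of j n "n - 1" g k x] j g by simp
  let ?h = "\<lambda>i. sw_pt i j x (n - 1) * g (sw_pt i j x)"
  have "(\<Sum>i\<in>{j<..<n - 1}. ?h i) = x (n - 1) * (\<Sum>i\<in>{j<..<n - 1}. g (sw_pt i j x))"
    unfolding sum_distrib_left using j by (intro sum.cong refl) (auto simp: sw_pt_def)
  also have "(\<Sum>i\<in>{j<..<n - 1}. g (sw_pt i j x)) = (\<Sum>i\<in>{Suc j<..<n}. f (sw_pt i (Suc j) (x \<circ> cyc_inv n)))"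
  proof (rule sum.reindex_bij_witness[where i = "\<lambda>i. i - 1" and j = Suc])
    fix i assume "i \<in> {j<..<n - 1}"
    then have "Suc i < n" by auto
    then show "f (sw_pt (Suc i) (Suc j) (x \<circ> cyc_inv n)) = g (sw_pt i j x)"
      using sw_pt_comp[OF cyc_inv_permutes, of n "Suc i" "Suc j" x] j unfolding g_def by (simp add: pred)
  qed (use j in auto)
  moreover have "{j<..<n} = insert (n - 1) {j<..<n - 1}" using j by auto
  moreover have "?h (n - 1) = x j * g (sw_pt j (n - 1) x)"
    unfolding sw_pt_commute[of "n - 1" j x] by (simp add: sw_pt_def)
  ultimately have swaps: "(\<Sum>i\<in>{j<..<n}. ?h i) = x j * g (sw_pt j (n - 1) x)
    + x (n - 1) * (\<Sum>i\<in>{Suc j<..<n}. f (sw_pt i (Suc j) (x \<circ> cyc_inv n)))"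
    by simp
  show ?thesis
    unfolding raise cher_D_def dunkl swaps using j by (simp add: raise_op_def g_def pred algebra_simps)
qed

subsection \<open>The Cherednik operators and adjacent transpositions\<close>

lemma sw_pt_sw_pt: "sw_pt j l (sw_pt i a x) = sw_pt (swp j l i) (swp j l a) (sw_pt j l x)"
  using sw_pt_comp[OF swp_permutes_UNIV, of j l "swp j l i" "swp j l a" x] by (simp add: sw_pt_def)

lemma dunkl_sw_pt:
  assumes "j < n" "l < n" "a < n"
  shows "dunkl n k (unit_vec a) (\<lambda>x. f (sw_pt j l x)) x = dunkl n k (unit_vec (swp j l a)) f (sw_pt j l x)"
proof -
  note perm = swp_permutes[OF assms(1,2)]
  have "swp j l a < n" using assms by (simp add: permutes_lessThan_iff[OF perm])
  from dunkl_comp[OF perm this, of k f x] show ?thesis unfolding sw_pt_def by simp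
qed

lemma
  assumes j: "Suc j < n"
  shows cher_D_sw_pt_first: "cher_D n k j (\<lambda>x. f (sw_pt j (Suc j) x)) x
      = cher_D n k (Suc j) f (sw_pt j (Suc j) x) + of_real k * f x" (is ?first)
    and cher_D_sw_pt_second: "cher_D n k (Suc j) (\<lambda>x. f (sw_pt j (Suc j) x)) x
      = cher_D n k j f (sw_pt j (Suc j) x) - of_real k * f x" (is ?second)
    and cher_D_sw_pt_other: "a < n \<Longrightarrow> a \<noteq> j \<Longrightarrow> a \<noteq> Suc j \<Longrightarrow>
      cher_D n k a (\<lambda>x. f (sw_pt j (Suc j) x)) x = cher_D n k a f (sw_pt j (Suc j) x)"
      (is "_ \<Longrightarrow> _ \<Longrightarrow> _ \<Longrightarrow> ?other")
proof -
  let ?s = "swp j (Suc j)" and ?y = "sw_pt j (Suc j) x"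
  have y: "?y a = x (?s a)" for a by (simp add: sw_pt_def)
  have jn: "j < n" using j by simp
  have range: "{j<..<n} = insert (Suc j) {Suc j<..<n}" using j by auto
  have cancel: "sw_pt j (Suc j) (sw_pt (Suc j) j x) = x" "sw_pt (Suc j) j ?y = x"
    by (auto simp: sw_pt_def swp_def fun_eq_iff)
  have "(\<Sum>i\<in>{Suc j<..<n}. f (sw_pt j (Suc j) (sw_pt i j x))) = (\<Sum>i\<in>{Suc j<..<n}. f (sw_pt i (Suc j) ?y))"
    by (intro sum.cong refl) (auto simp: sw_pt_sw_pt[of j "Suc j" _ _ x])
  then show ?first
    unfolding cher_D_def dunkl_sw_pt[OF jn j jn] range by (simp add: y cancel algebra_simps)
  have "(\<Sum>i\<in>{Suc j<..<n}. f (sw_pt j (Suc j) (sw_pt i (Suc j) x))) = (\<Sum>i\<in>{Suc j<..<n}. f (sw_pt i j ?y))"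
    by (intro sum.cong refl) (auto simp: sw_pt_sw_pt[of j "Suc j" _ _ x])
  then show ?second
    unfolding cher_D_def dunkl_sw_pt[OF jn j j] range by (simp add: y cancel algebra_simps)
  assume a: "a < n" "a \<noteq> j" "a \<noteq> Suc j"
  have "(\<Sum>i\<in>{a<..<n}. f (sw_pt j (Suc j) (sw_pt i a x))) = (\<Sum>i\<in>{a<..<n}. f (sw_pt i a ?y))"
  proof (rule sum.reindex_bij_witness[where i = ?s and j = ?s])
    fix i assume "i \<in> {a<..<n}"
    then show "?s i \<in> {a<..<n}" using a j by (auto simp: swp_def)
    show "f (sw_pt (?s i) a ?y) = f (sw_pt j (Suc j) (sw_pt i a x))"
      using a by (simp add: sw_pt_sw_pt[of j "Suc j" _ _ x])
  qed (use a j in \<open>auto simp: swp_def\<close>)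
  then show ?other unfolding cher_D_def dunkl_sw_pt[OF jn j a(1)] using a by (simp add: y)
qed

definition swap_coef :: "nat \<Rightarrow> real \<Rightarrow> (nat \<Rightarrow> nat) \<Rightarrow> nat \<Rightarrow> real" where
  "swap_coef n k \<kappa> j = k / (eigval n k \<kappa> (Suc j) - eigval n k \<kappa> j)"

lemma
  assumes "0 \<le> k" "Suc j < n" "\<kappa> j < \<kappa> (Suc j)"
  shows swap_coef_nonneg: "0 \<le> swap_coef n k \<kappa> j" and swap_coef_less_one: "swap_coef n k \<kappa> j < 1"
    and swap_coef_mult_gap: "swap_coef n k \<kappa> j * (eigval n k \<kappa> (Suc j) - eigval n k \<kappa> j) = k"
  using eigval_gap[of k "Suc j" n j \<kappa>] assms by (auto simp: swap_coef_def field_simps)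

lemma swap_step_eigenfunction:
  assumes k: "0 \<le> k" and j: "Suc j < n" "\<kappa> j < \<kappa> (Suc j)" and f: "partially_diff f"
    and eig: "\<And>i x. i < n \<Longrightarrow> cher_D n k i f x = of_real (eigval n k \<kappa> i) * f x" and i: "i < n"
  shows "cher_D n k i (\<lambda>x. f (sw_pt j (Suc j) x) + of_real (swap_coef n k \<kappa> j) * f x) x
    = of_real (eigval n k (\<kappa> \<circ> swp j (Suc j)) i) *
      (f (sw_pt j (Suc j) x) + of_real (swap_coef n k \<kappa> j) * f x)"
proof -
  let ?c = "swap_coef n k \<kappa> j" and ?y = "sw_pt j (Suc j) x"
  have jn: "j < n" using j by simp
  have coef: "complex_of_real k = of_real ?c * (of_real (eigval n k \<kappa> (Suc j)) - of_real (eigval n k \<kappa> j))"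
    using swap_coef_mult_gap[OF k j] by (metis of_real_diff of_real_mult)
  have linear: "cher_D n k i (\<lambda>x. f (sw_pt j (Suc j) x) + of_real ?c * f x) x
    = cher_D n k i (\<lambda>x. f (sw_pt j (Suc j) x)) x + of_real ?c * (of_real (eigval n k \<kappa> i) * f x)"
    using cher_D_add[OF i partially_diff_sw_pt[OF f] f] eig[OF i] by simp
  have eigval: "eigval n k (\<kappa> \<circ> swp j (Suc j)) i = eigval n k \<kappa> (swp j (Suc j) i)"
    using j i by (intro eigval_swap) auto
  consider (first) "i = j" | (second) "i = Suc j" | (other) "i \<noteq> j" "i \<noteq> Suc j" by blast
  then show ?thesis
  proof cases
    case first
    show ?thesis
      unfolding linear eigval unfolding first cher_D_sw_pt_first[OF j(1)] eig[OF j(1)] coef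
      by (simp add: algebra_simps)
  next
    case second
    show ?thesis
      unfolding linear eigval unfolding second cher_D_sw_pt_second[OF j(1)] eig[OF jn] coef
      by (simp add: algebra_simps)
  next
    case other
    then show ?thesis
      unfolding linear eigval cher_D_sw_pt_other[OF j(1) i other] eig[OF i] by (simp add: algebra_simps)
  qed
qed

subsection \<open>Existence and uniqueness of the nonsymmetric Jack polynomials\<close>

text \<open>The coefficients are required to be nonnegative: both steps of the recursion preserve this.\<close>

definition is_jack :: "nat \<Rightarrow> real \<Rightarrow> (nat \<Rightarrow> nat) \<Rightarrow> ((nat \<Rightarrow> complex) \<Rightarrow> complex) \<Rightarrow> bool" where
  "is_jack n k \<eta> f \<longleftrightarrow>
    (\<exists>c :: (nat \<Rightarrow> nat) \<Rightarrow> real. (\<forall>\<kappa>. 0 \<le> c \<kappa>) \<and> c \<eta> = 1 \<and>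
      f = (\<lambda>x. \<Sum>\<kappa>\<in>deg_idx n (absv n \<eta>). of_real (c \<kappa>) * monom n \<kappa> x)) \<and>
    (\<forall>j<n. \<forall>x. cher_D n k j f x = of_real (eigval n k \<eta> j) * f x)"

lemma is_jackI:
  fixes c :: "(nat \<Rightarrow> nat) \<Rightarrow> real"
  assumes "\<And>\<kappa>. 0 \<le> c \<kappa>" "c \<eta> = 1"
    and "\<And>x. f x = (\<Sum>\<kappa>\<in>deg_idx n (absv n \<eta>). of_real (c \<kappa>) * monom n \<kappa> x)"
    and "\<And>j x. j < n \<Longrightarrow> cher_D n k j f x = of_real (eigval n k \<eta> j) * f x"
  shows "is_jack n k \<eta> f"
  unfolding is_jack_def using assms by (intro conjI exI[of _ c]) auto

lemma is_jackE:
  assumes "is_jack n k \<eta> f"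
  obtains c :: "(nat \<Rightarrow> nat) \<Rightarrow> real" where "\<And>\<kappa>. 0 \<le> c \<kappa>" "c \<eta> = 1"
    "f = (\<lambda>x. \<Sum>\<kappa>\<in>deg_idx n (absv n \<eta>). of_real (c \<kappa>) * monom n \<kappa> x)"
  using assms unfolding is_jack_def by blast

lemma is_jack_eigenfunction:
  "is_jack n k \<eta> f \<Longrightarrow> j < n \<Longrightarrow> cher_D n k j f x = of_real (eigval n k \<eta> j) * f x"
  unfolding is_jack_def by blast

lemma is_jack_in_span:
  assumes "is_jack n k \<eta> f" shows "f \<in> fun_space.span (monom n ` deg_idx n (absv n \<eta>))"
proof -
  obtain c :: "(nat \<Rightarrow> nat) \<Rightarrow> real"
    where "f = (\<lambda>x. \<Sum>\<kappa>\<in>deg_idx n (absv n \<eta>). of_real (c \<kappa>) * monom n \<kappa> x)"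
    using is_jackE[OF assms] by blast
  then show ?thesis
    by (simp add: fun_span_linear_combination)
qed

lemma is_jack_partially_diff: "is_jack n k \<eta> f \<Longrightarrow> partially_diff f"
  by (rule fun_span_monom_partially_diff[OF finite_deg_idx is_jack_in_span])

lemma norm_monom_le:
  assumes "\<And>i. i < n \<Longrightarrow> cmod (x i) \<le> R" shows "cmod (monom n \<kappa> x) \<le> R ^ absv n \<kappa>"
proof -
  have "cmod (monom n \<kappa> x) = (\<Prod>i<n. cmod (x i) ^ \<kappa> i)"
    by (simp add: monom_def prod_norm[symmetric] norm_power)
  also have "\<dots> \<le> (\<Prod>i<n. R ^ \<kappa> i)" using assms by (intro prod_mono) (auto intro: power_mono)
  finally show ?thesis by (simp add: absv_def power_sum)
qed

lemma
  assumes f: "is_jack n k \<eta> f" and \<eta>: "\<eta> \<in> multi_idx n"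
  shows is_jack_one_real: "f one_vec = of_real (Re (f one_vec))"
    and is_jack_one_ge: "1 \<le> Re (f one_vec)"
    and is_jack_norm_le: "(\<And>i. i < n \<Longrightarrow> cmod (x i) \<le> R) \<Longrightarrow> cmod (f x) \<le> Re (f one_vec) * R ^ absv n \<eta>"
proof -
  let ?M = "deg_idx n (absv n \<eta>)"
  obtain c :: "(nat \<Rightarrow> nat) \<Rightarrow> real" where c: "\<And>\<kappa>. 0 \<le> c \<kappa>" "c \<eta> = 1"
    and f_eq: "f = (\<lambda>x. \<Sum>\<kappa>\<in>?M. of_real (c \<kappa>) * monom n \<kappa> x)"
    using is_jackE[OF f] by blast
  have one: "f one_vec = of_real (\<Sum>\<kappa>\<in>?M. c \<kappa>)" unfolding f_eq by (simp add: monom_def one_vec_def)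
  then show "f one_vec = of_real (Re (f one_vec))" by simp
  show "1 \<le> Re (f one_vec)"
    using member_le_sum[OF deg_idx_absv[OF \<eta>], of c] c by (simp add: one)
  assume R: "\<And>i. i < n \<Longrightarrow> cmod (x i) \<le> R"
  have "cmod (f x) \<le> (\<Sum>\<kappa>\<in>?M. c \<kappa> * R ^ absv n \<eta>)"
    unfolding f_eq
  proof (rule sum_norm_le)
    fix \<kappa> assume "\<kappa> \<in> ?M"
    then show "cmod (of_real (c \<kappa>) * monom n \<kappa> x) \<le> c \<kappa> * R ^ absv n \<eta>"
      using norm_monom_le[of n x R \<kappa>, OF R] c(1)
      by (simp add: norm_mult deg_idx_def mult_left_mono)
  qed
  then show "cmod (f x) \<le> Re (f one_vec) * R ^ absv n \<eta>" by (simp add: one sum_distrib_right)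
qed

lemma is_jack_zero: "is_jack n k (\<lambda>_. 0) (\<lambda>_. 1)"
proof (rule is_jackI[of "\<lambda>_. 1"])
  show "(1::complex) = (\<Sum>\<kappa>\<in>deg_idx n (absv n (\<lambda>_. 0)). of_real 1 * monom n \<kappa> x)" for x
    by (simp add: monom_def deg_idx_zero absv_zero)
  fix j x assume j: "j < n"
  have "diff_quot a b (\<lambda>_. 1) x = 0" for a b by (simp add: diff_quot_def)
  then have "dunkl n k (unit_vec j) (\<lambda>_. 1) x = 0" using j by (simp add: dunkl_unit)
  moreover have "card {i. i < j} = j" by simp
  ultimately show "cher_D n k j (\<lambda>_. 1) x = of_real (eigval n k (\<lambda>_. 0) j) * 1"
    using j by (simp add: cher_D_def eigval_def algebra_simps of_nat_diff)
qed auto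

lemma raise_op_eigenfunction:
  assumes n: "1 \<le> n" and diff: "partially_diff f"
    and eig: "\<And>j x. j < n \<Longrightarrow> cher_D n k j f x = of_real (eigval n k \<eta> j) * f x"
    and j: "j < n"
  shows "cher_D n k j (raise_op n f) x = of_real (eigval n k (raise_idx n \<eta>) j) * raise_op n f x"
proof (cases "Suc j = n")
  case True
  then have last: "j = n - 1" by simp
  show ?thesis
    unfolding last cher_D_last_raise_op[OF n diff] eigval_raise_idx(2)[OF n]
    using n by (simp add: raise_op_def eig algebra_simps)
next
  case False
  then have "Suc j < n" using j by simp
  then show ?thesis
    unfolding cher_D_raise_op[OF \<open>Suc j < n\<close> diff] by (simp add: eigval_raise_idx(1) raise_op_def eig)
qed

lemma is_jack_raise:
  assumes n: "1 \<le> n" and \<eta>: "\<eta> \<in> multi_idx n" and f: "is_jack n k \<eta> f"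
  shows "is_jack n k (raise_idx n \<eta>) (raise_op n f)"
proof -
  let ?m = "absv n \<eta>"
  obtain c :: "(nat \<Rightarrow> nat) \<Rightarrow> real" where c: "\<And>\<kappa>. 0 \<le> c \<kappa>" "c \<eta> = 1"
    and f_eq: "f = (\<lambda>x. \<Sum>\<kappa>\<in>deg_idx n ?m. of_real (c \<kappa>) * monom n \<kappa> x)"
    using is_jackE[OF f] by blast
  define d where "d \<kappa> = (if 0 < \<kappa> (n - 1) then c (lower_idx n \<kappa>) else 0)" for \<kappa>
  have d_raise: "d (raise_idx n \<kappa>) = c \<kappa>" if "\<kappa> \<in> multi_idx n" for \<kappa>
    using that n by (simp add: d_def raise_idx_def lower_raise_idx)
  show ?thesis
  proof (rule is_jackI[of d])
    show "0 \<le> d \<kappa>" for \<kappa> using c by (simp add: d_def)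
    show "d (raise_idx n \<eta>) = 1" using c by (simp add: d_raise[OF \<eta>])
    fix x
    have "raise_op n f x = (\<Sum>\<kappa>\<in>deg_idx n ?m. of_real (d (raise_idx n \<kappa>)) * monom n (raise_idx n \<kappa>) x)"
      unfolding f_eq raise_op_sum
      by (intro sum.cong) (simp_all add: raise_op_monom[OF n] d_raise deg_idx_multi)
    also have "\<dots> = (\<Sum>\<kappa>\<in>{\<kappa> \<in> deg_idx n (Suc ?m). 0 < \<kappa> (n - 1)}. of_real (d \<kappa>) * monom n \<kappa> x)"
      by (rule sum.reindex_bij_betw[OF bij_betw_raise_idx_deg[OF n]])
    also have "\<dots> = (\<Sum>\<kappa>\<in>deg_idx n (Suc ?m). of_real (d \<kappa>) * monom n \<kappa> x)"
      by (rule sum.mono_neutral_left) (auto simp: d_def)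
    finally show "raise_op n f x = (\<Sum>\<kappa>\<in>deg_idx n (absv n (raise_idx n \<eta>)). of_real (d \<kappa>) * monom n \<kappa> x)"
      by (simp add: absv_raise_idx[OF n])
  qed (rule raise_op_eigenfunction[OF n is_jack_partially_diff[OF f] is_jack_eigenfunction[OF f]])
qed

lemma swap_not_in_low_idx:
  assumes "\<kappa> \<in> multi_idx n" "i < j" "j < n" "\<kappa> i < \<kappa> j" shows "\<kappa> \<circ> swp i j \<notin> low_idx n \<kappa>"
proof -
  have \<kappa>s: "\<kappa> \<circ> swp i j \<in> multi_idx n" using assms by (intro multi_idx_comp swp_permutes) auto
  have "prec n \<kappa> (\<kappa> \<circ> swp i j)" using prec_swap[OF \<kappa>s, of i j] assms by simp
  then show ?thesis using prec_trans[OF _ _ assms(1) \<kappa>s] prec_irrefl by (auto simp: low_idx_def)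
qed

lemma monom_combination_sw_pt:
  assumes "i < n" "j < n"
  shows "(\<Sum>\<kappa>\<in>deg_idx n m. c \<kappa> * monom n \<kappa> (sw_pt i j x)) = (\<Sum>\<kappa>\<in>deg_idx n m. c (\<kappa> \<circ> swp i j) * monom n \<kappa> x)"
proof -
  have "(\<Sum>\<kappa>\<in>deg_idx n m. c \<kappa> * monom n \<kappa> (sw_pt i j x)) = (\<Sum>\<kappa>\<in>deg_idx n m. c \<kappa> * monom n (\<kappa> \<circ> swp i j) x)"
    by (simp add: monom_sw_pt[OF assms])
  also have "\<dots> = (\<Sum>\<kappa>\<in>deg_idx n m. c (\<kappa> \<circ> swp i j) * monom n \<kappa> x)"
    by (rule sum.reindex_bij_witness[where i = "\<lambda>\<kappa>. \<kappa> \<circ> swp i j" and j = "\<lambda>\<kappa>. \<kappa> \<circ> swp i j"])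
      (simp_all only: comp_swp_swp deg_idx_comp[OF _ swp_permutes[OF assms]])
  finally show ?thesis .
qed

lemma is_jack_swap:
  assumes k: "0 \<le> k" and \<kappa>: "\<kappa> \<in> multi_idx n" and j: "Suc j < n" "\<kappa> j < \<kappa> (Suc j)" and f: "is_jack n k \<kappa> f"
  shows "is_jack n k (\<kappa> \<circ> swp j (Suc j)) (\<lambda>x. f (sw_pt j (Suc j) x) + of_real (swap_coef n k \<kappa> j) * f x)"
proof -
  let ?s = "swp j (Suc j)" and ?a = "swap_coef n k \<kappa> j" and ?M = "deg_idx n (absv n \<kappa>)"
  have jn: "j < n" using j by simp
  note perm = swp_permutes[OF jn j(1)]
  obtain c :: "(nat \<Rightarrow> nat) \<Rightarrow> real" where c: "\<And>\<kappa>. 0 \<le> c \<kappa>" "c \<kappa> = 1"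
    and f_eq: "f = (\<lambda>x. \<Sum>\<kappa>\<in>?M. of_real (c \<kappa>) * monom n \<kappa> x)"
    using is_jackE[OF f] by blast
  define d where "d \<tau> = c (\<tau> \<circ> ?s) + ?a * c \<tau>" for \<tau>
  show ?thesis
  proof (rule is_jackI[of d])
    show "0 \<le> d \<tau>" for \<tau> using c swap_coef_nonneg[OF k j] by (simp add: d_def)
    have "(\<kappa> \<circ> ?s) j \<noteq> \<kappa> j" using j by simp
    then have "\<kappa> \<circ> ?s \<noteq> \<kappa>" by metis
    then have "complex_of_real (c (\<kappa> \<circ> ?s)) = 0"
      using eigenfunction_support[OF k \<kappa> f_eq is_jack_eigenfunction[OF f]]
        swap_not_in_low_idx[OF \<kappa> lessI j] deg_idx_comp[OF deg_idx_absv[OF \<kappa>] perm] by blast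
    then show "d (\<kappa> \<circ> ?s) = 1" using c by (simp add: d_def)
    show "f (sw_pt j (Suc j) x) + of_real ?a * f x
      = (\<Sum>\<tau>\<in>deg_idx n (absv n (\<kappa> \<circ> ?s)). of_real (d \<tau>) * monom n \<tau> x)" for x
      unfolding absv_comp[OF perm] f_eq monom_combination_sw_pt[OF jn j(1)] d_def
      by (simp only: of_real_add of_real_mult distrib_right sum.distrib sum_distrib_left mult.assoc)
    show "cher_D n k i (\<lambda>x. f (sw_pt j (Suc j) x) + of_real ?a * f x) x
      = of_real (eigval n k (\<kappa> \<circ> ?s) i) * (f (sw_pt j (Suc j) x) + of_real ?a * f x)" if "i < n" for i x
      using swap_step_eigenfunction[OF k j is_jack_partially_diff[OF f] is_jack_eigenfunction[OF f] that] .
  qed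
qed

lemma last_positive_entry_obtain:
  assumes "\<eta> \<in> multi_idx n" "absv n \<eta> \<noteq> 0"
  obtains i where "i < n" "0 < \<eta> i" "\<forall>l>i. \<eta> l = 0"
proof -
  define S where "S = {i. i < n \<and> 0 < \<eta> i}"
  have fin: "finite S" by (simp add: S_def)
  have "S \<noteq> {}" using assms(2) by (auto simp: S_def absv_def)
  then have Max: "Max S \<in> S" by (rule Max_in[OF fin])
  show ?thesis
  proof
    show "Max S < n" "0 < \<eta> (Max S)" using Max by (simp_all add: S_def)
    have "l \<in> S" if "\<eta> l \<noteq> 0" for l
      using that assms(1) by (auto simp: S_def multi_idx_def not_less[symmetric])
    then show "\<forall>l>Max S. \<eta> l = 0" using Max_ge[OF fin] by (meson leD)
  qed
qed

lemma multi_idx_raise_swap_induct [consumes 2, case_names zero raise swap]: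
  assumes n: "1 \<le> n" and \<eta>: "\<eta> \<in> multi_idx n"
    and zero: "P (\<lambda>_. 0)"
    and raise: "\<And>\<eta>. \<eta> \<in> multi_idx n \<Longrightarrow> P \<eta> \<Longrightarrow> P (raise_idx n \<eta>)"
    and swap: "\<And>\<kappa> j. \<kappa> \<in> multi_idx n \<Longrightarrow> Suc j < n \<Longrightarrow> \<kappa> j = 0 \<Longrightarrow> 0 < \<kappa> (Suc j) \<Longrightarrow>
      (\<forall>i>Suc j. \<kappa> i = 0) \<Longrightarrow> P \<kappa> \<Longrightarrow> P (\<kappa> \<circ> swp j (Suc j))"
  shows "P \<eta>"
  using \<eta>
proof (induction "absv n \<eta>" arbitrary: \<eta>)
  case 0
  then have "\<eta> \<in> deg_idx n 0" by (simp add: deg_idx_def)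
  then show ?case using zero by (simp add: deg_idx_zero)
next
  case (Suc m)
  obtain i where i: "i < n" "0 < \<eta> i" "\<forall>l>i. \<eta> l = 0"
    using last_positive_entry_obtain[OF Suc.prems] Suc.hyps(2) by auto
  then show ?case
    using Suc.prems Suc.hyps(2)
  proof (induction "n - Suc i" arbitrary: i \<eta>)
    case 0
    have "i = n - 1" using 0(1,2) by simp
    with 0(3) have last: "0 < \<eta> (n - 1)" by (simp only:)
    have \<eta>_eq: "raise_idx n (lower_idx n \<eta>) = \<eta>" by (rule raise_lower_idx[OF n 0(5) last])
    then have "m = absv n (lower_idx n \<eta>)" using absv_raise_idx[OF n, of "lower_idx n \<eta>"] 0(6) by simp
    then have "P (lower_idx n \<eta>)" by (intro Suc.hyps(1) lower_idx_multi[OF n])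
    from raise[OF lower_idx_multi[OF n] this] show ?case by (simp only: \<eta>_eq)
  next
    case (Suc d)
    let ?\<tau> = "\<eta> \<circ> swp i (Suc i)"
    have less: "Suc i < n" using Suc.hyps(2) by simp
    note perm = swp_permutes[OF Suc.prems(1) less]
    have \<tau>: "?\<tau> \<in> multi_idx n" "?\<tau> i = 0" "0 < ?\<tau> (Suc i)" "\<forall>l>Suc i. ?\<tau> l = 0"
      using Suc.prems multi_idx_comp[OF _ perm] by auto
    then have "P ?\<tau>" using Suc less by (intro Suc.hyps(1)[of "Suc i"]) (simp_all add: absv_comp[OF perm])
    from swap[OF \<tau>(1) less \<tau>(2-4) this] show ?case by (simp only: comp_swp_swp)
  qed
qed

lemma is_jack_exists:
  assumes "1 \<le> n" "0 \<le> k" "\<eta> \<in> multi_idx n" shows "\<exists>f. is_jack n k \<eta> f"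
  using assms(1,3)
proof (induction rule: multi_idx_raise_swap_induct)
  case zero then show ?case using is_jack_zero by blast
next
  case (raise \<eta>) then show ?case using is_jack_raise[OF assms(1)] by blast
next
  case (swap \<kappa> j) then show ?case using is_jack_swap[OF assms(2)] by (metis (no_types))
qed

lemma is_jack_minus_monom_low:
  assumes k: "0 \<le> k" and \<eta>: "\<eta> \<in> multi_idx n" and f: "is_jack n k \<eta> f"
  shows "(\<lambda>x. f x - monom n \<eta> x) \<in> fun_space.span (monom n ` low_idx n \<eta>)"
proof -
  let ?M = "deg_idx n (absv n \<eta>)"
  obtain c :: "(nat \<Rightarrow> nat) \<Rightarrow> real" where c: "c \<eta> = 1"
    and f_eq: "f = (\<lambda>x. \<Sum>\<kappa>\<in>?M. of_real (c \<kappa>) * monom n \<kappa> x)"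
    using is_jackE[OF f] by blast
  have "(\<lambda>x. of_real (c \<kappa>) * monom n \<kappa> x) \<in> fun_space.span (monom n ` low_idx n \<eta>)" if "\<kappa> \<in> ?M - {\<eta>}" for \<kappa>
    using eigenfunction_support[OF k \<eta> f_eq is_jack_eigenfunction[OF f], of \<kappa>] that
    by (cases "c \<kappa> = 0") (auto intro: fun_span_zero fun_space.span_scale[of "monom n \<kappa>"] fun_space.span_base)
  then have "(\<lambda>x. \<Sum>\<kappa>\<in>?M - {\<eta>}. of_real (c \<kappa>) * monom n \<kappa> x) \<in> fun_space.span (monom n ` low_idx n \<eta>)"
    by (intro fun_span_sum)
  then show ?thesis using deg_idx_absv[OF \<eta>] c unfolding f_eq by (simp add: sum.remove[of ?M \<eta>])
qed

lemma jackE_eq: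
  assumes k: "0 \<le> k" and \<eta>: "\<eta> \<in> multi_idx n" and f: "is_jack n k \<eta> f"
  shows "jackE n k \<eta> = f"
  unfolding jackE_def low_idx_def[symmetric]
proof (rule the_equality)
  obtain c where "(\<lambda>x. f x - monom n \<eta> x) = (\<lambda>x. \<Sum>\<kappa>\<in>low_idx n \<eta>. c \<kappa> * monom n \<kappa> x)"
    using fun_span_image_obtain[OF finite_low_idx[OF \<eta>] is_jack_minus_monom_low[OF k \<eta> f]] .
  then have "f = (\<lambda>x. monom n \<eta> x + (\<Sum>\<kappa>\<in>low_idx n \<eta>. c \<kappa> * monom n \<kappa> x))"
    by (simp add: fun_eq_iff algebra_simps)
  then show "(\<exists>c. f = (\<lambda>x. monom n \<eta> x + (\<Sum>\<kappa>\<in>low_idx n \<eta>. c \<kappa> * monom n \<kappa> x))) \<and>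
      (\<forall>j<n. \<forall>x. cher_D n k j f x = of_real (eigval n k \<eta> j) * f x)"
    using is_jack_eigenfunction[OF f] by blast
  fix g
  assume "(\<exists>c. g = (\<lambda>x. monom n \<eta> x + (\<Sum>\<kappa>\<in>low_idx n \<eta>. c \<kappa> * monom n \<kappa> x))) \<and>
      (\<forall>j<n. \<forall>x. cher_D n k j g x = of_real (eigval n k \<eta> j) * g x)"
  then obtain c where g: "g = (\<lambda>x. monom n \<eta> x + (\<Sum>\<kappa>\<in>low_idx n \<eta>. c \<kappa> * monom n \<kappa> x))"
    and eig: "\<And>j x. j < n \<Longrightarrow> cher_D n k j g x = of_real (eigval n k \<eta> j) * g x" by blast
  have "partially_diff g"
    unfolding g by (intro partially_diff_add partially_diff_sum partially_diff_mult) auto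
  then have "cher_D n k j (\<lambda>x. g x + (-1) * f x) x = of_real (eigval n k \<eta> j) * (g x + (-1) * f x)"
    if "j < n" for j x
    using cher_D_add[OF that _ is_jack_partially_diff[OF f], of g k "-1" x] eig[OF that]
      is_jack_eigenfunction[OF f that] by (simp add: algebra_simps)
  moreover have "(\<lambda>x. (\<Sum>\<kappa>\<in>low_idx n \<eta>. c \<kappa> * monom n \<kappa> x) - (f x - monom n \<eta> x))
      \<in> fun_space.span (monom n ` low_idx n \<eta>)"
    by (intro fun_span_diff fun_span_linear_combination order_refl is_jack_minus_monom_low[OF k \<eta> f])
  ultimately have "(\<lambda>x. g x + (-1) * f x) = (\<lambda>x. 0)"
    unfolding g by (intro eigenfunction_low_eq_zero[OF k \<eta>]) (simp_all add: algebra_simps)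
  then show "g = f" by (simp add: fun_eq_iff)
qed

locale jack_parameters =
  fixes n :: nat and k :: real
  assumes n: "1 \<le> n" and k: "0 \<le> k"
begin

abbreviation "E \<equiv> jackE n k"

lemma is_jack_jackE: "\<eta> \<in> multi_idx n \<Longrightarrow> is_jack n k \<eta> (E \<eta>)"
  using is_jack_exists[OF n k] jackE_eq[OF k] by metis

lemmas jackE_eigenfunction = is_jack_eigenfunction[OF is_jack_jackE]
  and jackE_partially_diff = is_jack_partially_diff[OF is_jack_jackE]

lemma jackE_in_span: "\<eta> \<in> deg_idx n m \<Longrightarrow> E \<eta> \<in> fun_space.span (monom n ` deg_idx n m)"
  using is_jack_in_span[OF is_jack_jackE[of \<eta>]] by (auto simp: deg_idx_def)

lemma jackE_zero: "E (\<lambda>_. 0) = (\<lambda>_. 1)"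
  by (intro jackE_eq k is_jack_zero zero_multi_idx)

lemma jackE_raise: "\<eta> \<in> multi_idx n \<Longrightarrow> E (raise_idx n \<eta>) = raise_op n (E \<eta>)"
  by (intro jackE_eq k is_jack_raise n is_jack_jackE raise_idx_multi)

lemma jackE_one_nonzero: "\<eta> \<in> multi_idx n \<Longrightarrow> E \<eta> one_vec \<noteq> 0"
  using is_jack_one_ge[OF is_jack_jackE] by fastforce

lemma jackE_indep: "indep_family E (deg_idx n m)"
proof (rule joint_eigenfunctions_indep[where n = n])
  show "cher_D n k j (\<lambda>x. \<Sum>\<kappa>\<in>S'. c \<kappa> * E \<kappa> x) x = (\<Sum>\<kappa>\<in>S'. c \<kappa> * (of_real (eigval n k \<kappa> j) * E \<kappa> x))"
    if "j < n" "S' \<subseteq> deg_idx n m" for j c S' x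
    using that jackE_partially_diff jackE_eigenfunction deg_idx_multi
    by (subst cher_D_sum) (auto intro!: sum.cong)
  show "\<exists>j<n. complex_of_real (eigval n k \<kappa> j) \<noteq> of_real (eigval n k \<kappa>' j)"
    if "\<kappa> \<in> deg_idx n m" "\<kappa>' \<in> deg_idx n m" "\<kappa> \<noteq> \<kappa>'" for \<kappa> \<kappa>'
    using that eigval_determines_idx[OF k deg_idx_multi deg_idx_multi permutes_id, of \<kappa> n m \<kappa>' m] by auto
  show "\<exists>x. E \<kappa> x \<noteq> 0" if "\<kappa> \<in> deg_idx n m" for \<kappa>
    using jackE_one_nonzero[OF deg_idx_multi[OF that]] by blast
qed simp

lemma monom_in_span_jackE: "\<eta> \<in> deg_idx n m \<Longrightarrow> monom n \<eta> \<in> fun_space.span (E ` deg_idx n m)"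
proof (induction "card (low_idx n \<eta>)" arbitrary: \<eta> rule: less_induct)
  case less
  have \<eta>: "\<eta> \<in> multi_idx n" by (rule deg_idx_multi[OF less.prems])
  have "monom n \<kappa> \<in> fun_space.span (E ` deg_idx n m)" if \<kappa>: "\<kappa> \<in> low_idx n \<eta>" for \<kappa>
    using low_idx_subset[OF less.prems] \<kappa> psubset_card_mono[OF finite_low_idx[OF \<eta>] low_idx_psubset[OF \<eta> \<kappa>]]
    by (intro less.hyps) auto
  then have "fun_space.span (monom n ` low_idx n \<eta>) \<subseteq> fun_space.span (E ` deg_idx n m)"
    by (intro fun_space.span_minimal fun_space.subspace_span) auto
  with is_jack_minus_monom_low[OF k \<eta> is_jack_jackE[OF \<eta>]]
  have "(\<lambda>x. E \<eta> x - monom n \<eta> x) \<in> fun_space.span (E ` deg_idx n m)" by blast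
  from fun_span_diff[OF fun_space.span_base[OF imageI[OF less.prems]] this] show ?case by simp
qed

lemma span_monom_subset_span_jackE:
  "fun_space.span (monom n ` deg_idx n m) \<subseteq> fun_space.span (E ` deg_idx n m)"
  using monom_in_span_jackE by (intro fun_space.span_minimal fun_space.subspace_span) auto

lemma eigenfunction_jackE_support:
  assumes f: "f = (\<lambda>x. \<Sum>\<rho>\<in>deg_idx n m. d \<rho> * E \<rho> x)" and j: "j < n"
    and eig: "\<And>x. cher_D n k j f x = of_real l * f x"
    and \<rho>: "\<rho> \<in> deg_idx n m" "d \<rho> \<noteq> 0"
  shows "eigval n k \<rho> j = l"
proof -
  have "(\<Sum>\<rho>\<in>deg_idx n m. (d \<rho> * of_real (eigval n k \<rho> j)) * E \<rho> x)
    = (\<Sum>\<rho>\<in>deg_idx n m. (of_real l * d \<rho>) * E \<rho> x)" for x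
  proof -
    have "(\<Sum>\<rho>\<in>deg_idx n m. (d \<rho> * of_real (eigval n k \<rho> j)) * E \<rho> x)
      = (\<Sum>\<rho>\<in>deg_idx n m. d \<rho> * cher_D n k j (E \<rho>) x)"
      using j by (intro sum.cong) (simp_all add: jackE_eigenfunction deg_idx_multi)
    also have "\<dots> = cher_D n k j f x"
      unfolding f using j by (intro cher_D_sum[symmetric]) (auto simp: jackE_partially_diff deg_idx_multi)
    finally show ?thesis unfolding eig unfolding f by (simp add: sum_distrib_left mult.assoc)
  qed
  from indep_family_coeff_eq[OF jackE_indep this \<rho>(1)] show ?thesis using \<rho>(2) by simp
qed

end

subsection \<open>Adjacent transpositions of Jack polynomials\<close>

lemma sort_rank_adjacent_tie:
  assumes "Suc j < n" "\<eta> j = \<eta> (Suc j)" shows "sort_rank n \<eta> (Suc j) = Suc (sort_rank n \<eta> j)"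
proof -
  have "{i. i < n \<and> sorts_before \<eta> i (Suc j)} = insert j {i. i < n \<and> sorts_before \<eta> i j}"
    using assms by (auto simp: sorts_before_def less_Suc_eq)
  then show ?thesis using assms sorts_before_irrefl by (simp add: sort_rank_def)
qed

lemma span_monom_sw_pt:
  assumes f: "f \<in> fun_space.span (monom n ` deg_idx n m)" and ij: "i < n" "j < n"
  shows "(\<lambda>x. f (sw_pt i j x)) \<in> fun_space.span (monom n ` deg_idx n m)"
proof -
  obtain c where c: "f = (\<lambda>x. \<Sum>\<kappa>\<in>deg_idx n m. c \<kappa> * monom n \<kappa> x)"
    using fun_span_image_obtain[OF finite_deg_idx f] .
  show ?thesis
    unfolding c monom_combination_sw_pt[OF ij] by (intro fun_span_linear_combination order_refl)
qed

context jack_parameters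
begin

lemma jackE_swap:
  assumes "\<kappa> \<in> multi_idx n" "Suc j < n" "\<kappa> j < \<kappa> (Suc j)"
  shows "E (\<kappa> \<circ> swp j (Suc j)) = (\<lambda>x. E \<kappa> (sw_pt j (Suc j) x) + of_real (swap_coef n k \<kappa> j) * E \<kappa> x)"
  using assms by (intro jackE_eq k is_jack_swap is_jack_jackE multi_idx_comp swp_permutes) auto

lemma jackE_sw_pt_ascent:
  assumes "\<kappa> \<in> multi_idx n" "Suc j < n" "\<kappa> j < \<kappa> (Suc j)"
  shows "E \<kappa> (sw_pt j (Suc j) x) = E (\<kappa> \<circ> swp j (Suc j)) x - of_real (swap_coef n k \<kappa> j) * E \<kappa> x"
  by (simp add: jackE_swap[OF assms])

lemma jackE_sw_pt_descent:
  assumes "\<kappa> \<in> multi_idx n" "Suc j < n" "\<kappa> j < \<kappa> (Suc j)"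
  shows "E (\<kappa> \<circ> swp j (Suc j)) (sw_pt j (Suc j) x)
    = of_real (swap_coef n k \<kappa> j) * E (\<kappa> \<circ> swp j (Suc j)) x + (1 - (of_real (swap_coef n k \<kappa> j))\<^sup>2) * E \<kappa> x"
proof -
  have "sw_pt j (Suc j) (sw_pt j (Suc j) x) = x" by (simp add: sw_pt_def)
  then show ?thesis
    unfolding jackE_swap[OF assms] by (simp add: algebra_simps power2_eq_square)
qed

lemma jackE_sw_pt_tie:
  assumes \<kappa>: "\<kappa> \<in> multi_idx n" and j: "Suc j < n" and tie: "\<kappa> j = \<kappa> (Suc j)"
  shows "E \<kappa> (sw_pt j (Suc j) x) = E \<kappa> x"
proof -
  let ?s = "swp j (Suc j)" and ?M = "deg_idx n (absv n \<kappa>)"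
  define g where "g x = E \<kappa> (sw_pt j (Suc j) x) + (-1) * E \<kappa> x" for x
  note \<kappa>M = deg_idx_absv[OF \<kappa>] and eig = jackE_eigenfunction[OF \<kappa>] and diff = jackE_partially_diff[OF \<kappa>]
  have "eigval n k \<kappa> j = eigval n k \<kappa> (Suc j) + k"
    using j tie by (simp add: eigval_sort_rank sort_rank_adjacent_tie algebra_simps)
  then have g_eig: "cher_D n k a g x = of_real (eigval n k \<kappa> (?s a)) * g x" if a: "a < n" for a x
    using cher_D_add[OF a partially_diff_sw_pt[OF diff] diff, of k j "Suc j" "-1" x] eig
      cher_D_sw_pt_first[OF j, of k "E \<kappa>" x] cher_D_sw_pt_second[OF j, of k "E \<kappa>" x]
      cher_D_sw_pt_other[OF j a, of k "E \<kappa>" x] a j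
    unfolding g_def[abs_def] by (cases "a = j"; cases "a = Suc j") (auto simp: algebra_simps)
  have "g \<in> fun_space.span (monom n ` ?M)"
    unfolding g_def[abs_def] using j
    by (intro fun_span_add span_monom_sw_pt fun_space.span_scale[of "E \<kappa>"] jackE_in_span \<kappa>M) auto
  then obtain d where d: "g = (\<lambda>x. \<Sum>\<rho>\<in>?M. d \<rho> * E \<rho> x)"
    using span_monom_subset_span_jackE fun_span_image_obtain[OF finite_deg_idx] by blast
  have "\<rho> = \<kappa>" if \<rho>: "\<rho> \<in> ?M" "d \<rho> \<noteq> 0" for \<rho>
  proof -
    have "\<rho> = \<kappa> \<circ> ?s"
      using eigenfunction_jackE_support[OF d _ g_eig \<rho>] j
      by (intro eigval_determines_idx[OF k deg_idx_multi[OF \<rho>(1)] \<kappa>] swp_permutes) auto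
    also have "\<dots> = \<kappa>" using tie by (auto simp: fun_eq_iff swp_def)
    finally show ?thesis .
  qed
  then have g_eq: "g x = d \<kappa> * E \<kappa> x" for x
    unfolding d using \<kappa>M by (subst sum.mono_neutral_right[of ?M "{\<kappa>}"]) auto
  have "g one_vec = 0" by (simp add: g_def sw_pt_def one_vec_def comp_def)
  then have "d \<kappa> = 0" using g_eq[of one_vec] jackE_one_nonzero[OF \<kappa>] by simp
  then show ?thesis using g_eq[of x] by (simp add: g_def)
qed

lemma jackE_sw_pt_in_span:
  assumes \<tau>: "\<tau> \<in> multi_idx n" and j: "Suc j < n"
  shows "(\<lambda>x. E \<tau> (sw_pt j (Suc j) x)) \<in> fun_space.span (E ` {\<tau>, \<tau> \<circ> swp j (Suc j)})"
proof -
  let ?s = "swp j (Suc j)"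
  have E: "(\<lambda>x. a * E \<rho> x) \<in> fun_space.span (E ` {\<tau>, \<tau> \<circ> ?s})" if "\<rho> \<in> {\<tau>, \<tau> \<circ> ?s}" for a \<rho>
    using that by (intro fun_space.span_scale[of "E \<rho>"] fun_space.span_base) auto
  consider (ascent) "\<tau> j < \<tau> (Suc j)" | (tie) "\<tau> j = \<tau> (Suc j)" | (descent) "\<tau> (Suc j) < \<tau> j" by linarith
  then show ?thesis
  proof cases
    case ascent
    from fun_span_diff[OF E[of "\<tau> \<circ> ?s" 1] E[of \<tau>]] show ?thesis
      unfolding jackE_sw_pt_ascent[OF \<tau> j ascent] by simp
  next
    case tie
    from E[of \<tau> 1] show ?thesis unfolding jackE_sw_pt_tie[OF \<tau> j tie] by simp
  next
    case descent
    have "\<tau> \<circ> ?s \<in> multi_idx n" using j by (intro multi_idx_comp[OF \<tau>] swp_permutes) auto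
    moreover have "(\<tau> \<circ> ?s) j < (\<tau> \<circ> ?s) (Suc j)" using descent by simp
    ultimately show ?thesis
      using fun_span_add[OF E[of \<tau>] E[of "\<tau> \<circ> ?s"]] jackE_sw_pt_descent[of "\<tau> \<circ> ?s" j] j by simp
  qed
qed

end

subsection \<open>The expansion of powers of the coordinate sum\<close>

lemma coord_mult_in_span:
  assumes f: "f \<in> fun_space.span (monom n ` deg_idx n m)" and l: "l < n"
  shows "(\<lambda>x. x l * f x) \<in> fun_space.span (monom n ` deg_idx n (Suc m))"
proof -
  obtain c where c: "f = (\<lambda>x. \<Sum>\<kappa>\<in>deg_idx n m. c \<kappa> * monom n \<kappa> x)"
    using fun_span_image_obtain[OF finite_deg_idx f] .
  have mem: "\<kappa>(l := Suc (\<kappa> l)) \<in> deg_idx n (Suc m)" if "\<kappa> \<in> deg_idx n m" for \<kappa>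
  proof -
    have "absv n (\<kappa>(l := Suc (\<kappa> l))) = Suc (absv n \<kappa>)"
      unfolding absv_def
      using l sum.remove[of "{..<n}" l "\<kappa>(l := Suc (\<kappa> l))"] sum.remove[of "{..<n}" l \<kappa>] by simp
    then show ?thesis using that l by (auto simp: deg_idx_def multi_idx_def)
  qed
  have "(\<lambda>x. \<Sum>\<kappa>\<in>deg_idx n m. c \<kappa> * monom n (\<kappa>(l := Suc (\<kappa> l))) x)
    \<in> fun_space.span (monom n ` deg_idx n (Suc m))"
    by (intro fun_span_sum fun_space.span_scale[of "monom n _"] fun_space.span_base imageI mem)
  then show ?thesis
    unfolding c sum_distrib_left coord_mult_monom[OF l, symmetric] by (simp add: mult.left_commute)
qed

lemma sum_power_in_span: "(\<lambda>z. (\<Sum>i<n. z i) ^ m) \<in> fun_space.span (monom n ` deg_idx n m)"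
proof (induction m)
  case 0
  have "monom n (\<lambda>_. 0) \<in> fun_space.span (monom n ` deg_idx n 0)"
    by (intro fun_space.span_base) (simp add: deg_idx_zero)
  then show ?case by (simp add: monom_def[abs_def])
next
  case (Suc m)
  have "(\<lambda>z. \<Sum>i<n. z i * (\<Sum>i<n. z i) ^ m) \<in> fun_space.span (monom n ` deg_idx n (Suc m))"
    by (intro fun_span_sum coord_mult_in_span Suc) auto
  then show ?case by (simp add: sum_distrib_right)
qed

context jack_parameters
begin

lemma sum_power_jackE: "(\<Sum>i<n. z i) ^ m = (\<Sum>\<kappa>\<in>deg_idx n m. coefs n k m \<kappa> * E \<kappa> z)"
proof -
  let ?M = "deg_idx n m"
  obtain c where c: "(\<lambda>z. (\<Sum>i<n. z i) ^ m) = (\<lambda>z. \<Sum>\<kappa>\<in>?M. c \<kappa> * E \<kappa> z)"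
    using fun_span_image_obtain[OF finite_deg_idx]
      subsetD[OF span_monom_subset_span_jackE sum_power_in_span] .
  define c' where "c' \<kappa> = (if \<kappa> \<in> ?M then c \<kappa> else 0)" for \<kappa>
  have c': "(\<Sum>i<n. z i) ^ m = (\<Sum>\<kappa>\<in>?M. c' \<kappa> * E \<kappa> z)" for z
    unfolding fun_cong[OF c, of z] by (intro sum.cong) (simp_all add: c'_def)
  have "coefs n k m = c'"
    unfolding coefs_def deg_idx_def[symmetric]
  proof (rule the_equality)
    show "(\<forall>\<kappa>. \<kappa> \<notin> ?M \<longrightarrow> c' \<kappa> = 0) \<and> (\<forall>z. (\<Sum>i<n. z i) ^ m = (\<Sum>\<kappa>\<in>?M. c' \<kappa> * E \<kappa> z))"
      using c' by (simp add: c'_def)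
    fix d assume d: "(\<forall>\<kappa>. \<kappa> \<notin> ?M \<longrightarrow> d \<kappa> = 0) \<and> (\<forall>z. (\<Sum>i<n. z i) ^ m = (\<Sum>\<kappa>\<in>?M. d \<kappa> * E \<kappa> z))"
    have "d \<kappa> = c' \<kappa>" if "\<kappa> \<in> ?M" for \<kappa>
    proof (rule indep_family_coeff_eq[OF jackE_indep _ that])
      show "(\<Sum>\<kappa>\<in>?M. d \<kappa> * E \<kappa> z) = (\<Sum>\<kappa>\<in>?M. c' \<kappa> * E \<kappa> z)" for z using c'[of z] d by metis
    qed
    moreover have "d \<kappa> = c' \<kappa>" if "\<kappa> \<notin> ?M" for \<kappa> using d that by (simp add: c'_def)
    ultimately show "d = c'" by blast
  qed
  then show ?thesis using c'[of z] by (simp only:)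
qed

lemma jackE_sw_pt_in_span_diff:
  assumes j: "Suc j < n" and \<tau>: "\<tau> \<in> deg_idx n m - {\<kappa>, \<kappa> \<circ> swp j (Suc j)}"
  shows "(\<lambda>x. E \<tau> (sw_pt j (Suc j) x)) \<in> fun_space.span (E ` (deg_idx n m - {\<kappa>, \<kappa> \<circ> swp j (Suc j)}))"
proof -
  let ?s = "swp j (Suc j)"
  have perm: "?s permutes {..<n}" using j by (intro swp_permutes) auto
  have "\<tau> \<circ> ?s \<noteq> \<kappa> \<circ> ?s" "\<tau> \<circ> ?s \<noteq> \<kappa>" using \<tau> by (metis DiffE comp_swp_swp insertCI)+
  then have "E ` {\<tau>, \<tau> \<circ> ?s} \<subseteq> E ` (deg_idx n m - {\<kappa>, \<kappa> \<circ> ?s})"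
    using \<tau> deg_idx_comp[of \<tau>, OF _ perm] by auto
  from fun_space.span_mono[OF this] show ?thesis
    using jackE_sw_pt_in_span[OF _ j, of \<tau>] \<tau> by (auto simp: deg_idx_multi)
qed

lemma coefs_swap:
  assumes \<kappa>: "\<kappa> \<in> multi_idx n" and j: "Suc j < n" "\<kappa> j < \<kappa> (Suc j)"
  shows "coefs n k (absv n \<kappa>) (\<kappa> \<circ> swp j (Suc j)) * (1 - of_real (swap_coef n k \<kappa> j))
    = coefs n k (absv n \<kappa>) \<kappa>"
proof -
  let ?s = "swp j (Suc j)" and ?C = "coefs n k (absv n \<kappa>)" and ?M = "deg_idx n (absv n \<kappa>)"
  let ?\<eta> = "\<kappa> \<circ> ?s" and ?a = "complex_of_real (swap_coef n k \<kappa> j)"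
  have perm: "?s permutes {..<n}" using j by (intro swp_permutes) auto
  note \<kappa>M = deg_idx_absv[OF \<kappa>] and \<eta>M = deg_idx_comp[OF deg_idx_absv[OF \<kappa>] perm]
  have "?\<eta> j \<noteq> \<kappa> j" using j by simp
  then have ne: "?\<eta> \<noteq> \<kappa>" by metis
  let ?V = "fun_space.span (E ` (?M - {?\<eta>}))" and ?rest = "?M - {\<kappa>, ?\<eta>}"
  have split: "(\<Sum>\<tau>\<in>?M. g \<tau>) = g \<kappa> + (g ?\<eta> + sum g ?rest)" for g :: "(nat \<Rightarrow> nat) \<Rightarrow> complex"
    using sum_remove_two[OF finite_deg_idx \<kappa>M \<eta>M ne[symmetric]] .
  have rest_le: "fun_space.span (E ` ?rest) \<subseteq> ?V" by (intro fun_space.span_mono image_mono) auto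
  have "(\<lambda>x. E \<tau> (sw_pt j (Suc j) x)) \<in> ?V" if "\<tau> \<in> ?rest" for \<tau>
    using jackE_sw_pt_in_span_diff[OF j(1) that] rest_le by blast
  then have "(\<lambda>x. \<Sum>\<tau>\<in>?rest. ?C \<tau> * E \<tau> (sw_pt j (Suc j) x)) \<in> ?V"
    by (intro fun_span_sum fun_space.span_scale[of "\<lambda>x. E _ (sw_pt j (Suc j) x)"])
  moreover have "(\<lambda>x. \<Sum>\<tau>\<in>?rest. ?C \<tau> * E \<tau> x) \<in> ?V" by (intro fun_span_linear_combination) auto
  moreover have "(\<lambda>x. ((1 - ?a\<^sup>2) * ?C ?\<eta> - (1 + ?a) * ?C \<kappa>) * E \<kappa> x) \<in> ?V"
    using \<kappa>M ne by (intro fun_space.span_scale[of "E \<kappa>"] fun_space.span_base) auto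
  ultimately have "(\<lambda>x. (\<Sum>\<tau>\<in>?rest. ?C \<tau> * E \<tau> (sw_pt j (Suc j) x)) - (\<Sum>\<tau>\<in>?rest. ?C \<tau> * E \<tau> x)
      + ((1 - ?a\<^sup>2) * ?C ?\<eta> - (1 + ?a) * ?C \<kappa>) * E \<kappa> x) \<in> ?V"
    by (intro fun_span_add fun_span_diff)
  moreover have "(\<Sum>\<tau>\<in>?rest. ?C \<tau> * E \<tau> (sw_pt j (Suc j) x)) - (\<Sum>\<tau>\<in>?rest. ?C \<tau> * E \<tau> x)
      + ((1 - ?a\<^sup>2) * ?C ?\<eta> - (1 + ?a) * ?C \<kappa>) * E \<kappa> x = (?C ?\<eta> * (1 - ?a) - ?C \<kappa>) * E ?\<eta> x" for x
  proof -
    have "(\<Sum>i<n. sw_pt j (Suc j) x i) = (\<Sum>i<n. x i)"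
      using sum.permute[OF perm, of x] by (simp add: sw_pt_def)
    then have "(\<Sum>\<tau>\<in>?M. ?C \<tau> * E \<tau> (sw_pt j (Suc j) x)) = (\<Sum>\<tau>\<in>?M. ?C \<tau> * E \<tau> x)"
      unfolding sum_power_jackE[symmetric] by simp
    then show ?thesis
      unfolding split jackE_sw_pt_ascent[OF \<kappa> j] jackE_sw_pt_descent[OF \<kappa> j] by (simp add: algebra_simps)
  qed
  ultimately have "?C ?\<eta> * (1 - ?a) - ?C \<kappa> = 0"
    by (intro indep_family_not_in_span[OF jackE_indep finite_deg_idx \<eta>M]) simp
  then show ?thesis by simp
qed

end

subsection \<open>The lowering operator\<close>

lemma partially_diff_diff_quot_monom:
  assumes "i < n" "j < n" "i \<noteq> j" shows "partially_diff (diff_quot i j (monom n \<eta>))"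
proof -
  have greater: "partially_diff (diff_quot i j (monom n \<eta>))" if "i < n" "j < n" "\<eta> j < \<eta> i" for i j
    using that by (subst ext[OF diff_quot_monom]) auto
  consider (greater) "\<eta> j < \<eta> i" | (equal) "\<eta> i = \<eta> j" | (less) "\<eta> i < \<eta> j" by linarith
  then show ?thesis
  proof cases
    case less
    have "diff_quot i j (monom n \<eta>) = (\<lambda>x. (-1) * diff_quot j i (monom n \<eta>) x)"
      by (rule ext, subst diff_quot_anti) simp
    then show ?thesis
      using greater[OF assms(2,1) less] by (simp only: partially_diff_mult partially_diff_const)
  next
    case equal then show ?thesis using assms by (subst ext[OF diff_quot_monom_equal]) auto
  qed (use greater assms in auto)
qed

lemma partially_diff_dunkl_span_monom:
  assumes j: "j < n" and "finite A" "f \<in> fun_space.span (monom n ` A)"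
  shows "partially_diff (dunkl n k (unit_vec j) f)"
proof -
  have monom: "partially_diff (dunkl n k (unit_vec j) (monom n \<eta>))" for \<eta>
  proof -
    have "dunkl n k (unit_vec j) (monom n \<eta>) = (\<lambda>x. of_nat (\<eta> j) * monom n (\<eta>(j := \<eta> j - 1)) x +
        of_real k * (\<Sum>b\<in>{..<n} - {j}. diff_quot j b (monom n \<eta>) x))"
      by (rule ext) (simp only: dunkl_unit[OF j] dir_deriv_monom[OF j])
    then show ?thesis
      using j
      by (simp only:) (intro partially_diff_add partially_diff_mult partially_diff_sum partially_diff_const
          partially_diff_monom partially_diff_diff_quot_monom; auto)
  qed
  obtain c where "f = (\<lambda>x. \<Sum>\<kappa>\<in>A. c \<kappa> * monom n \<kappa> x)" using fun_span_image_obtain assms(2,3) .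
  then have "dunkl n k (unit_vec j) f = (\<lambda>x. \<Sum>\<kappa>\<in>A. c \<kappa> * dunkl n k (unit_vec j) (monom n \<kappa>) x)"
    using dunkl_sum[OF j, of A "monom n"] by auto
  then show ?thesis using monom by (simp only: partially_diff_sum partially_diff_mult partially_diff_const)
qed

lemma partially_diff_coord_mult_eq_zero:
  assumes "partially_diff g" "\<And>x. x j * g x = 0" shows "g x = 0"
proof (cases "x j = 0")
  case True
  have "dir_deriv (unit_vec j) (\<lambda>x. x j * g x) x = g x"
    using True assms(1) by (simp add: dir_deriv_mult dir_deriv_coord unit_vec_apply)
  then show ?thesis by (simp add: assms(2))
qed (use assms(2)[of x] in simp)

context jack_parameters
begin

definition lower_op :: "((nat \<Rightarrow> complex) \<Rightarrow> complex) \<Rightarrow> (nat \<Rightarrow> complex) \<Rightarrow> complex" where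
  "lower_op f x = dunkl n k (unit_vec (n - 1)) f (x \<circ> cyc n)"

definition raise_factor :: "(nat \<Rightarrow> nat) \<Rightarrow> real" where
  "raise_factor \<eta> = eigval n k \<eta> 0 + 1 + k * (real n - 1)"

lemma raise_factor_ge: "1 \<le> raise_factor \<eta>"
  using eigval_lower_bound[OF k, of 0 n \<eta>] n by (simp add: raise_factor_def)

lemma raise_factor_le: "raise_factor \<eta> \<le> real (absv n \<eta>) + (1 + k * real n)"
proof -
  have "\<eta> 0 \<le> absv n \<eta>" unfolding absv_def using n by (intro member_le_sum) auto
  moreover have "0 \<le> k * real (sort_rank n \<eta> 0)" using k by simp
  ultimately have "eigval n k \<eta> 0 \<le> real (absv n \<eta>)"
    unfolding eigval_sort_rank[of 0 n, OF less_le_trans[OF zero_less_one n]] by linarith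
  moreover have "k * (real n - 1) \<le> k * real n" using k by (intro mult_left_mono) auto
  ultimately show ?thesis by (simp add: raise_factor_def)
qed

lemma lower_op_jackE_raise:
  assumes "\<eta> \<in> multi_idx n"
  shows "lower_op (E (raise_idx n \<eta>)) x = of_real (raise_factor \<eta>) * E \<eta> x"
proof -
  have "lower_op (E (raise_idx n \<eta>)) x = dunkl n k (unit_vec 0) (\<lambda>x. x 0 * E \<eta> x) (x \<circ> cyc n \<circ> cyc_inv n)"
    unfolding lower_op_def jackE_raise[OF assms] by (rule dunkl_last_raise_op[OF n])
  also have "\<dots> = dunkl n k (unit_vec 0) (\<lambda>x. x 0 * E \<eta> x) x" by (simp only: comp_cyc_cyc_inv)
  also have "\<dots> = of_real (raise_factor \<eta>) * E \<eta> x"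
    using n unfolding dunkl_first_coord_mult[OF n jackE_partially_diff[OF assms]]
    by (simp add: jackE_eigenfunction[OF assms] raise_factor_def algebra_simps)
  finally show ?thesis .
qed

lemma lower_op_jackE_last_zero:
  assumes \<kappa>: "\<kappa> \<in> multi_idx n" "\<kappa> (n - 1) = 0"
  shows "lower_op (E \<kappa>) x = 0"
proof -
  have last: "n - 1 < n" using n by simp
  have "{i. i < n \<and> sorts_before \<kappa> i (n - 1)} = {..<n - 1}"
  proof (rule set_eqI)
    show "i \<in> {i. i < n \<and> sorts_before \<kappa> i (n - 1)} \<longleftrightarrow> i \<in> {..<n - 1}" for i
      using \<kappa> n by (cases "i = n - 1") (auto simp: sorts_before_def)
  qed
  then have eigval: "eigval n k \<kappa> (n - 1) = - k * (real n - 1)"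
    using last \<kappa> by (simp add: eigval_sort_rank sort_rank_def of_nat_diff)
  have "{n - 1<..<n} = {}" by auto
  then have "x (n - 1) * dunkl n k (unit_vec (n - 1)) (E \<kappa>) x = 0" for x
    using jackE_eigenfunction[OF \<kappa>(1) last, of x] unfolding cher_D_def eigval by (simp add: algebra_simps)
  with partially_diff_dunkl_span_monom[OF last finite_deg_idx jackE_in_span[OF deg_idx_absv[OF \<kappa>(1)]]]
  show ?thesis unfolding lower_op_def by (rule partially_diff_coord_mult_eq_zero)
qed

lemma lower_op_sum:
  "(\<And>i. i \<in> S \<Longrightarrow> partially_diff (f i)) \<Longrightarrow> lower_op (\<lambda>x. \<Sum>i\<in>S. c i * f i x) x = (\<Sum>i\<in>S. c i * lower_op (f i) x)"
  unfolding lower_op_def by (rule dunkl_sum) (use n in auto)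

lemma lower_op_cmult: "partially_diff f \<Longrightarrow> lower_op (\<lambda>x. c * f x) x = c * lower_op f x"
  unfolding lower_op_def using n by (intro dunkl_cmult) auto

lemma lower_op_sum_power: "lower_op (\<lambda>z. (\<Sum>i<n. z i) ^ Suc m) x = of_nat (Suc m) * (\<Sum>i<n. x i) ^ m"
proof -
  let ?f = "\<lambda>z :: nat \<Rightarrow> complex. (\<Sum>i<n. z i) ^ Suc m" and ?y = "x \<circ> cyc n"
  have last: "n - 1 < n" using n by simp
  have sum_comp: "(\<Sum>i<n. (z \<circ> \<sigma>) i) = (\<Sum>i<n. z i)" if "\<sigma> permutes {..<n}" for z :: "nat \<Rightarrow> complex" and \<sigma>
    using sum.permute[OF that, of z] by simp
  have diff: "partially_diff ?f" by (intro partially_diff_power partially_diff_sum partially_diff_coord)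
  have quot_zero: "diff_quot (n - 1) b ?f y = 0" if "b \<in> {..<n} - {n - 1}" for b y
  proof (rule diff_quot_eqI[OF diff, where q = "\<lambda>_. 0"])
    show "?f y - ?f (sw_pt (n - 1) b y) = (y (n - 1) - y b) * 0" for y
      unfolding sw_pt_def using sum_comp[OF swp_permutes[OF last, of b]] that by simp
  qed (use that in auto)
  have "dir_deriv (unit_vec (n - 1)) ?f ?y = of_nat (Suc m) * (\<Sum>i<n. ?y i) ^ m"
  proof (rule dir_derivI)
    have "(\<Sum>i<n. unit_vec (n - 1) i) = 1" using last by (simp add: unit_vec_apply)
    then have "(\<Sum>i<n. coord_line (n - 1) ?y t i) = (\<Sum>i<n. ?y i) + t" for t
      by (simp only: sum.distrib sum_distrib_left[symmetric]) simp
    moreover have "((\<lambda>t. ((\<Sum>i<n. ?y i) + t) ^ Suc m) has_field_derivative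
      of_nat (Suc m) * (\<Sum>i<n. ?y i) ^ m) (at 0)"
      by (auto intro!: derivative_eq_intros simp del: power_Suc)
    ultimately show "((\<lambda>t. ?f (coord_line (n - 1) ?y t))
      has_field_derivative of_nat (Suc m) * (\<Sum>i<n. ?y i) ^ m) (at 0)" by (simp only:)
  qed
  then show ?thesis
    unfolding lower_op_def dunkl_unit[OF last] using quot_zero sum_comp[OF cyc_permutes, of x] by simp
qed

lemma coefs_raise:
  assumes \<eta>: "\<eta> \<in> deg_idx n m"
  shows "coefs n k (Suc m) (raise_idx n \<eta>) * of_real (raise_factor \<eta>) = of_nat (Suc m) * coefs n k m \<eta>"
proof (rule indep_family_coeff_eq[OF jackE_indep _ \<eta>])
  fix x
  let ?C = "coefs n k"
  have "(\<Sum>\<kappa>\<in>deg_idx n m. ?C (Suc m) (raise_idx n \<kappa>) * of_real (raise_factor \<kappa>) * E \<kappa> x)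
    = (\<Sum>\<kappa>\<in>deg_idx n m. ?C (Suc m) (raise_idx n \<kappa>) * lower_op (E (raise_idx n \<kappa>)) x)"
    by (intro sum.cong) (simp_all add: lower_op_jackE_raise deg_idx_multi)
  also have "\<dots> = (\<Sum>\<kappa>\<in>{\<kappa> \<in> deg_idx n (Suc m). 0 < \<kappa> (n - 1)}. ?C (Suc m) \<kappa> * lower_op (E \<kappa>) x)"
    by (rule sum.reindex_bij_betw[OF bij_betw_raise_idx_deg[OF n]])
  also have "\<dots> = (\<Sum>\<kappa>\<in>deg_idx n (Suc m). ?C (Suc m) \<kappa> * lower_op (E \<kappa>) x)"
    using lower_op_jackE_last_zero deg_idx_multi
    by (intro sum.mono_neutral_left) (simp_all del: One_nat_def, blast)
  also have "\<dots> = lower_op (\<lambda>z. (\<Sum>i<n. z i) ^ Suc m) x"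
    unfolding sum_power_jackE by (intro lower_op_sum[symmetric] jackE_partially_diff deg_idx_multi)
  also have "\<dots> = (\<Sum>\<kappa>\<in>deg_idx n m. of_nat (Suc m) * ?C m \<kappa> * E \<kappa> x)"
    unfolding lower_op_sum_power unfolding sum_power_jackE by (simp add: sum_distrib_left mult.assoc)
  finally show "(\<Sum>\<kappa>\<in>deg_idx n m. ?C (Suc m) (raise_idx n \<kappa>) * of_real (raise_factor \<kappa>) * E \<kappa> x)
    = (\<Sum>\<kappa>\<in>deg_idx n m. of_nat (Suc m) * ?C m \<kappa> * E \<kappa> x)" .
qed

subsection \<open>The normalized Jack polynomials\<close>

definition jack_coef :: "(nat \<Rightarrow> nat) \<Rightarrow> real" where
  "jack_coef \<eta> = Re (coefs n k (absv n \<eta>) \<eta>)"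

lemma coefs_positive:
  assumes "\<eta> \<in> multi_idx n" shows "\<exists>r>0. coefs n k (absv n \<eta>) \<eta> = complex_of_real r"
  using n assms
proof (induction rule: multi_idx_raise_swap_induct)
  case zero
  have "coefs n k 0 (\<lambda>_. 0) = 1" using sum_power_jackE[of "\<lambda>_. 0" 0] by (simp add: jackE_zero deg_idx_zero)
  then show ?case by (intro exI[of _ 1]) (simp add: absv_zero)
next
  case (raise \<eta>)
  then obtain r where r: "0 < r" "coefs n k (absv n \<eta>) \<eta> = complex_of_real r" by blast
  have pos: "0 < raise_factor \<eta>" using raise_factor_ge[of \<eta>] by simp
  then have "coefs n k (Suc (absv n \<eta>)) (raise_idx n \<eta>)
    = of_real (real (Suc (absv n \<eta>)) * r / raise_factor \<eta>)"
    using coefs_raise[OF deg_idx_absv[OF raise(1)]] unfolding r(2) by (simp add: field_simps)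
  then show ?case using r(1) pos unfolding absv_raise_idx[OF n]
    by (intro exI[of _ "real (Suc (absv n \<eta>)) * r / raise_factor \<eta>"]) simp
next
  case (swap \<kappa> j)
  then obtain r where r: "0 < r" "coefs n k (absv n \<kappa>) \<kappa> = complex_of_real r" by blast
  have ascent: "\<kappa> j < \<kappa> (Suc j)" using swap by simp
  have pos: "0 < 1 - swap_coef n k \<kappa> j" using swap_coef_less_one[OF k swap(2) ascent] by simp
  then have "1 - complex_of_real (swap_coef n k \<kappa> j) \<noteq> 0"
    by (metis less_irrefl of_real_1 of_real_diff of_real_eq_0_iff)
  then have "coefs n k (absv n \<kappa>) (\<kappa> \<circ> swp j (Suc j)) = of_real (r / (1 - swap_coef n k \<kappa> j))"
    using coefs_swap[OF swap(1,2) ascent] unfolding r(2) by (simp add: field_simps)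
  moreover have "0 < r / (1 - swap_coef n k \<kappa> j)" using r(1) pos by simp
  moreover have absv: "absv n (\<kappa> \<circ> swp j (Suc j)) = absv n \<kappa>"
    using swap(2) by (intro absv_comp swp_permutes) auto
  ultimately show ?case unfolding absv by blast
qed

lemma coefs_eq: "\<eta> \<in> multi_idx n \<Longrightarrow> coefs n k (absv n \<eta>) \<eta> = of_real (jack_coef \<eta>)"
  and jack_coef_pos: "\<eta> \<in> multi_idx n \<Longrightarrow> 0 < jack_coef \<eta>"
  using coefs_positive[of \<eta>] by (auto simp: jack_coef_def)

lemma jack_coef_raise:
  assumes \<eta>: "\<eta> \<in> multi_idx n"
  shows "jack_coef (raise_idx n \<eta>) * raise_factor \<eta> = real (Suc (absv n \<eta>)) * jack_coef \<eta>"
proof -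
  have "complex_of_real (jack_coef (raise_idx n \<eta>) * raise_factor \<eta>)
    = of_real (real (Suc (absv n \<eta>)) * jack_coef \<eta>)"
    using coefs_raise[OF deg_idx_absv[OF \<eta>]] coefs_eq[OF \<eta>] coefs_eq[OF raise_idx_multi, of \<eta>]
    unfolding absv_raise_idx[OF n] by simp
  then show ?thesis by (simp only: of_real_eq_iff)
qed

lemma jack_coef_swap:
  assumes \<kappa>: "\<kappa> \<in> multi_idx n" and j: "Suc j < n" "\<kappa> j < \<kappa> (Suc j)"
  shows "jack_coef (\<kappa> \<circ> swp j (Suc j)) * (1 - swap_coef n k \<kappa> j) = jack_coef \<kappa>"
proof -
  have perm: "swp j (Suc j) permutes {..<n}" using j by (intro swp_permutes) auto
  have "complex_of_real (jack_coef (\<kappa> \<circ> swp j (Suc j)) * (1 - swap_coef n k \<kappa> j)) = of_real (jack_coef \<kappa>)"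
    using coefs_swap[OF assms] coefs_eq[OF \<kappa>] coefs_eq[OF multi_idx_comp[OF \<kappa> perm]]
    unfolding absv_comp[OF perm] by simp
  then show ?thesis by (simp only: of_real_eq_iff)
qed

abbreviation "L \<equiv> jackL n k"

lemma jackL_eq: "\<eta> \<in> multi_idx n \<Longrightarrow> L \<eta> = (\<lambda>x. of_real (jack_coef \<eta>) * E \<eta> x)"
  by (rule ext) (simp add: jackL_def coefs_eq)

lemma jackL_partially_diff: "\<eta> \<in> multi_idx n \<Longrightarrow> partially_diff (L \<eta>)"
  by (simp add: jackL_eq partially_diff_mult jackE_partially_diff)

lemma lower_op_jackL_raise:
  assumes \<eta>: "\<eta> \<in> multi_idx n" shows "lower_op (L (raise_idx n \<eta>)) x = of_nat (Suc (absv n \<eta>)) * L \<eta> x"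
proof -
  have "lower_op (L (raise_idx n \<eta>)) x = of_real (jack_coef (raise_idx n \<eta>) * raise_factor \<eta>) * E \<eta> x"
    by (simp add: jackL_eq lower_op_cmult jackE_partially_diff lower_op_jackE_raise[OF \<eta>])
  then show ?thesis unfolding jack_coef_raise[OF \<eta>] by (simp add: jackL_eq[OF \<eta>])
qed

lemma lower_op_jackL_last_zero: "\<kappa> \<in> multi_idx n \<Longrightarrow> \<kappa> (n - 1) = 0 \<Longrightarrow> lower_op (L \<kappa>) x = 0"
  by (simp add: jackL_eq lower_op_cmult jackE_partially_diff lower_op_jackE_last_zero)

definition jackL_one :: "(nat \<Rightarrow> nat) \<Rightarrow> real" where
  "jackL_one \<eta> = jack_coef \<eta> * Re (E \<eta> one_vec)"

lemma jackL_one_vec: "\<eta> \<in> multi_idx n \<Longrightarrow> L \<eta> one_vec = of_real (jackL_one \<eta>)"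
  using is_jack_one_real[OF is_jack_jackE] by (simp add: jackL_eq jackL_one_def)

lemma jackL_one_pos: "\<eta> \<in> multi_idx n \<Longrightarrow> 0 < jackL_one \<eta>"
  using is_jack_one_ge[OF is_jack_jackE, of \<eta>] jack_coef_pos[of \<eta>] by (simp add: jackL_one_def)

lemma jackL_norm_le:
  assumes \<eta>: "\<eta> \<in> multi_idx n" and x: "\<And>i. i < n \<Longrightarrow> cmod (x i) \<le> R"
  shows "cmod (L \<eta> x) \<le> jackL_one \<eta> * R ^ absv n \<eta>"
proof -
  have "cmod (L \<eta> x) = jack_coef \<eta> * cmod (E \<eta> x)"
    using jack_coef_pos[OF \<eta>] by (simp add: jackL_eq[OF \<eta>] norm_mult)
  also have "\<dots> \<le> jack_coef \<eta> * (Re (E \<eta> one_vec) * R ^ absv n \<eta>)"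
    using is_jack_norm_le[OF is_jack_jackE[OF \<eta>] \<eta> x] jack_coef_pos[OF \<eta>] by (intro mult_left_mono) auto
  finally show ?thesis by (simp add: jackL_one_def mult.assoc)
qed

lemma jackL_one_raise:
  assumes "\<eta> \<in> multi_idx n"
  shows "jackL_one (raise_idx n \<eta>) * raise_factor \<eta> = real (Suc (absv n \<eta>)) * jackL_one \<eta>"
proof -
  have "E (raise_idx n \<eta>) one_vec = E \<eta> one_vec"
    unfolding jackE_raise[OF assms] by (simp add: raise_op_def one_vec_def comp_def)
  then have "jackL_one (raise_idx n \<eta>) * raise_factor \<eta>
    = (jack_coef (raise_idx n \<eta>) * raise_factor \<eta>) * Re (E \<eta> one_vec)"
    by (simp add: jackL_one_def)
  then show ?thesis by (simp only: jack_coef_raise[OF assms] jackL_one_def mult.assoc)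
qed

lemma jackL_one_swap:
  assumes "\<kappa> \<in> multi_idx n" "Suc j < n" "\<kappa> j < \<kappa> (Suc j)"
  shows "jackL_one (\<kappa> \<circ> swp j (Suc j)) * (1 - swap_coef n k \<kappa> j) = (1 + swap_coef n k \<kappa> j) * jackL_one \<kappa>"
proof -
  let ?\<eta> = "\<kappa> \<circ> swp j (Suc j)" and ?a = "swap_coef n k \<kappa> j"
  have "sw_pt j (Suc j) one_vec = one_vec" by (simp add: sw_pt_def one_vec_def comp_def)
  then have "E ?\<eta> one_vec = (1 + of_real ?a) * E \<kappa> one_vec"
    by (simp add: jackE_swap[OF assms] algebra_simps)
  then have one: "Re (E ?\<eta> one_vec) = (1 + ?a) * Re (E \<kappa> one_vec)" by simp
  have "jackL_one ?\<eta> * (1 - ?a) = (jack_coef ?\<eta> * (1 - ?a)) * Re (E ?\<eta> one_vec)" by (simp add: jackL_one_def)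
  also have "\<dots> = (1 + ?a) * jackL_one \<kappa>" unfolding jack_coef_swap[OF assms] one by (simp add: jackL_one_def)
  finally show ?thesis .
qed

end

subsection \<open>Adding and removing a full column\<close>

definition plus_one :: "nat \<Rightarrow> (nat \<Rightarrow> nat) \<Rightarrow> nat \<Rightarrow> nat" where
  "plus_one n \<kappa> i = (if i < n then Suc (\<kappa> i) else 0)"

lemma plus_one_multi [simp]: "plus_one n \<kappa> \<in> multi_idx n"
  by (auto simp: plus_one_def multi_idx_def)

lemma minus_one_multi: "\<eta> \<in> multi_idx n \<Longrightarrow> minus_one \<eta> \<in> multi_idx n"
  by (auto simp: minus_one_def multi_idx_def)

lemma minus_plus_one: "\<kappa> \<in> multi_idx n \<Longrightarrow> minus_one (plus_one n \<kappa>) = \<kappa>"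
  by (auto simp: plus_one_def minus_one_def multi_idx_def fun_eq_iff)

lemma plus_minus_one: "\<eta> \<in> multi_idx n \<Longrightarrow> \<forall>i<n. \<eta> i \<noteq> 0 \<Longrightarrow> plus_one n (minus_one \<eta>) = \<eta>"
  by (auto simp: plus_one_def minus_one_def multi_idx_def fun_eq_iff)

lemma bij_betw_plus_one: "bij_betw (plus_one n) (multi_idx n) {\<eta> \<in> multi_idx n. \<forall>i<n. \<eta> i \<noteq> 0}"
  by (rule bij_betw_byWitness[where f' = minus_one])
    (auto simp: minus_plus_one plus_minus_one minus_one_multi plus_one_def)

lemma absv_plus_one: "absv n (plus_one n \<kappa>) = absv n \<kappa> + n"
  by (simp add: absv_def plus_one_def sum_Suc)

lemma d_coef_plus_one:
  "\<kappa> \<in> multi_idx n \<Longrightarrow> d_coef n (plus_one n \<kappa>) = fact (absv n \<kappa> + n) / fact (absv n \<kappa>)"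
  by (simp add: d_coef_def minus_plus_one absv_plus_one) (simp add: plus_one_def)

lemma d_coef_eq_zero: "i < n \<Longrightarrow> \<eta> i = 0 \<Longrightarrow> d_coef n \<eta> = 0"
  by (auto simp: d_coef_def)

lemma plus_one_comp: "\<sigma> permutes {..<n} \<Longrightarrow> plus_one n (\<kappa> \<circ> \<sigma>) = plus_one n \<kappa> \<circ> \<sigma>"
  by (auto simp: plus_one_def fun_eq_iff permutes_lessThan_iff)

lemma is_partition_plus_one: "is_partition n lam \<Longrightarrow> is_partition n (plus_one n lam)"
  unfolding is_partition_def by (auto simp: plus_one_def multi_idx_def)

lemma is_partition_minus_one: "is_partition n lam \<Longrightarrow> is_partition n (minus_one lam)"
  unfolding is_partition_def by (auto simp: minus_one_multi) (simp add: minus_one_def diff_le_mono)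

lemma plus_part_plus_one:
  assumes \<kappa>: "\<kappa> \<in> multi_idx n" shows "plus_part n (plus_one n \<kappa>) = plus_one n (plus_part n \<kappa>)"
proof -
  have perm: "inv (sort_rank n \<kappa>) permutes {..<n}" by (intro permutes_inv sort_rank_permutes)
  have "plus_one n (plus_part n \<kappa>) = plus_one n \<kappa> \<circ> inv (sort_rank n \<kappa>)"
    by (simp only: plus_part_eq[OF \<kappa>] plus_one_comp[OF perm])
  then show ?thesis
    using plus_part_eqI[OF plus_one_multi perm] is_partition_plus_one[OF is_partition_plus_part[OF \<kappa>]] by simp
qed

lemma raise_idx_pow:
  assumes "\<kappa> \<in> multi_idx n" "i \<le> n"
  shows "(raise_idx n ^^ i) \<kappa> m = (if m + i < n then \<kappa> (m + i) else if m < n then Suc (\<kappa> (m + i - n)) else 0)"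
  using assms(2)
proof (induction i arbitrary: m)
  case 0 then show ?case using assms(1) by (auto simp: multi_idx_def)
next
  case (Suc i)
  then have IH: "(raise_idx n ^^ i) \<kappa> m
    = (if m + i < n then \<kappa> (m + i) else if m < n then Suc (\<kappa> (m + i - n)) else 0)" for m by simp
  consider "Suc m < n" | "Suc m = n" | "n \<le> m" by linarith
  then show ?case using Suc.prems by cases (auto simp: raise_idx_def[of n "(raise_idx n ^^ i) \<kappa>"] IH)
qed

lemma raise_idx_pow_n: "\<kappa> \<in> multi_idx n \<Longrightarrow> (raise_idx n ^^ n) \<kappa> = plus_one n \<kappa>"
  by (auto simp: fun_eq_iff raise_idx_pow plus_one_def)

lemma raise_idx_pow_multi: "\<kappa> \<in> multi_idx n \<Longrightarrow> (raise_idx n ^^ i) \<kappa> \<in> multi_idx n"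
  by (cases i) auto

lemma absv_raise_idx_pow: "1 \<le> n \<Longrightarrow> absv n ((raise_idx n ^^ i) \<kappa>) = absv n \<kappa> + i"
  by (induction i) (simp_all add: absv_raise_idx)

lemma eigval_raise_idx_pow:
  "i + j < n \<Longrightarrow> eigval n k ((raise_idx n ^^ i) \<kappa>) j = eigval n k \<kappa> (i + j)"
  by (induction i arbitrary: j) (simp_all add: eigval_raise_idx(1))

lemma raise_op_pow:
  assumes "i \<le> n"
  shows "(raise_op n ^^ i) f x = (\<Prod>t<i. x (n - 1 - t)) * f (x \<circ> (cyc_inv n ^^ i))"
  using assms
proof (induction i arbitrary: x)
  case (Suc i)
  have shift: "(\<Prod>t<i. (x \<circ> cyc_inv n) (n - 1 - t)) = (\<Prod>t<i. x (n - 1 - Suc t))"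
    using Suc.prems by (intro prod.cong refl) (auto simp: cyc_inv_def)
  have "(raise_op n ^^ Suc i) f x = x (n - 1) * (raise_op n ^^ i) f (x \<circ> cyc_inv n)"
    by (simp add: raise_op_def)
  also have "\<dots> = x (n - 1) * ((\<Prod>t<i. x (n - 1 - Suc t)) * f (x \<circ> cyc_inv n \<circ> (cyc_inv n ^^ i)))"
    using Suc.IH[of "x \<circ> cyc_inv n"] Suc.prems by (simp only: shift Suc_leD)
  also have "x \<circ> cyc_inv n \<circ> (cyc_inv n ^^ i) = x \<circ> (cyc_inv n ^^ Suc i)"
    by (simp only: funpow.simps comp_assoc)
  finally show ?case by (simp only: prod.lessThan_Suc_shift mult.assoc diff_zero)
qed simp

lemma cyc_pow: "(cyc n ^^ i) m = (if m < n then (m + i) mod n else m)"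
proof (induction i)
  case (Suc i)
  show ?case
  proof (cases "m < n")
    case True
    then have "(m + i) mod n < n" by simp
    then have "cyc n ((m + i) mod n) = Suc (m + i) mod n" by (auto simp: cyc_def mod_Suc)
    then show ?thesis using Suc True by simp
  qed (use Suc in \<open>simp add: cyc_def\<close>)
qed simp

lemma cyc_pow_n: "cyc n ^^ n = id"
  by (auto simp: fun_eq_iff cyc_pow)

lemma cyc_pow_permutes: "cyc n ^^ i permutes {..<n}"
  by (induction i) (simp_all only: funpow.simps permutes_id permutes_compose cyc_permutes)

lemma cyc_inv_pow_n: "cyc_inv n ^^ n = id"
proof -
  have "(cyc_inv n ^^ i) ((cyc n ^^ i) m) = m" for i m
    by (induction i arbitrary: m) (simp_all add: funpow_swap1)
  then show ?thesis by (metis cyc_pow_n eq_id_iff)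
qed

lemma raise_op_pow_n: "(raise_op n ^^ n) f x = (\<Prod>i<n. x i) * f x"
  using prod.nat_diff_reindex[of x n] by (simp add: raise_op_pow cyc_inv_pow_n)

context jack_parameters
begin

lemma jackE_plus_one:
  assumes \<kappa>: "\<kappa> \<in> multi_idx n" shows "E (plus_one n \<kappa>) x = (\<Prod>i<n. x i) * E \<kappa> x"
proof -
  have "E ((raise_idx n ^^ i) \<kappa>) = (raise_op n ^^ i) (E \<kappa>)" for i
    by (induction i) (simp_all add: jackE_raise raise_idx_pow_multi[OF \<kappa>])
  then show ?thesis by (metis raise_idx_pow_n[OF \<kappa>] raise_op_pow_n)
qed

definition delta_factor :: "(nat \<Rightarrow> nat) \<Rightarrow> real" where
  "delta_factor \<kappa> = (\<Prod>j<n. eigval n k \<kappa> j + 1 + k * (real n - 1))"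

lemma delta_factor_pos: "0 < delta_factor \<kappa>"
  unfolding delta_factor_def
proof (intro prod_pos)
  show "0 < eigval n k \<kappa> j + 1 + k * (real n - 1)" if "j \<in> {..<n}" for j
    using eigval_lower_bound[OF k, of j n \<kappa>] that by simp
qed

lemma delta_factor_comp:
  assumes "\<kappa> \<in> multi_idx n" "\<sigma> permutes {..<n}" shows "delta_factor (\<kappa> \<circ> \<sigma>) = delta_factor \<kappa>"
proof -
  have "delta_factor \<kappa> = (\<Prod>i<n. real (plus_part n \<kappa> i) - k * real i + 1 + k * (real n - 1))"
    if "\<kappa> \<in> multi_idx n" for \<kappa>
    unfolding delta_factor_def prod_plus_part[OF that, of "\<lambda>i a. real a - k * real i + 1 + k * (real n - 1)"]
    by (simp add: eigval_sort_rank)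
  then show ?thesis using assms by (simp add: multi_idx_comp plus_part_comp)
qed

lemma jack_coef_plus_one:
  assumes \<kappa>: "\<kappa> \<in> multi_idx n"
  shows "jack_coef (plus_one n \<kappa>) * delta_factor \<kappa> = fact (absv n \<kappa> + n) / fact (absv n \<kappa>) * jack_coef \<kappa>"
proof -
  have "jack_coef ((raise_idx n ^^ i) \<kappa>) * (\<Prod>t<i. raise_factor ((raise_idx n ^^ t) \<kappa>))
    = fact (absv n \<kappa> + i) / fact (absv n \<kappa>) * jack_coef \<kappa>" for i
  proof (induction i)
    case (Suc i)
    have "jack_coef ((raise_idx n ^^ Suc i) \<kappa>) * (\<Prod>t<Suc i. raise_factor ((raise_idx n ^^ t) \<kappa>))
      = (jack_coef (raise_idx n ((raise_idx n ^^ i) \<kappa>)) * raise_factor ((raise_idx n ^^ i) \<kappa>)) *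
        (\<Prod>t<i. raise_factor ((raise_idx n ^^ t) \<kappa>))" by simp
    also have "\<dots> = real (Suc (absv n \<kappa> + i)) *
        (jack_coef ((raise_idx n ^^ i) \<kappa>) * (\<Prod>t<i. raise_factor ((raise_idx n ^^ t) \<kappa>)))"
      unfolding jack_coef_raise[OF raise_idx_pow_multi[OF \<kappa>]] absv_raise_idx_pow[OF n]
      by (simp only: mult.assoc)
    finally show ?case unfolding Suc by (simp add: algebra_simps)
  qed simp
  moreover have "(\<Prod>t<n. raise_factor ((raise_idx n ^^ t) \<kappa>)) = delta_factor \<kappa>"
    unfolding delta_factor_def using eigval_raise_idx_pow[where j = 0 and \<kappa> = \<kappa>]
    by (intro prod.cong) (simp_all add: raise_factor_def)
  ultimately show ?thesis by (metis raise_idx_pow_n[OF \<kappa>])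
qed

text \<open>The cyclic shift permutes the Dunkl operators cyclically, so the product of all of them, in the
  given order, is a power of the lowering operator.\<close>

lemma lower_op_pow_eq_foldr:
  assumes "i \<le> n"
  shows "(lower_op ^^ i) f = foldr (\<lambda>j g. dunkl n k (unit_vec j) g) [0..<i] (\<lambda>x. f (x \<circ> (cyc n ^^ i)))"
  using assms
proof (induction i arbitrary: f)
  case (Suc i)
  have last: "n - 1 < n" using n by simp
  have "(cyc n ^^ Suc i) (n - 1) = i" unfolding cyc_pow using Suc.prems n by simp
  then have "lower_op f (x \<circ> (cyc n ^^ i)) = dunkl n k (unit_vec i) (\<lambda>x. f (x \<circ> (cyc n ^^ Suc i))) x" for x
    using dunkl_comp[OF cyc_pow_permutes[where i = "Suc i"] last, of k f x]
    unfolding lower_op_def comp_assoc funpow_Suc_right by simp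
  then have "(\<lambda>x. lower_op f (x \<circ> (cyc n ^^ i))) = dunkl n k (unit_vec i) (\<lambda>x. f (x \<circ> (cyc n ^^ Suc i)))"
    by (rule ext)
  moreover have "(lower_op ^^ Suc i) f = (lower_op ^^ i) (lower_op f)"
    by (simp only: funpow_Suc_right o_apply)
  ultimately show ?case using Suc.IH[of "lower_op f"] Suc.prems by (simp add: comp_def)
qed simp

lemma dunkl_Delta_eq: "dunkl_Delta n k f = (lower_op ^^ n) f"
  unfolding dunkl_Delta_def lower_op_pow_eq_foldr[OF order_refl] by (simp add: cyc_pow_n)

end

subsection \<open>Series in Jack polynomials\<close>

lemma has_sum_complex_derivative:
  fixes g g' :: "'i \<Rightarrow> complex \<Rightarrow> complex"
  assumes "0 < d" and bound: "\<And>i t. i \<in> M \<Longrightarrow> t \<in> cball z d \<Longrightarrow> cmod (g i t) \<le> B i" "B summable_on M"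
    and deriv: "\<And>i w. i \<in> M \<Longrightarrow> (g i has_field_derivative g' i w) (at w)"
  obtains D where "((\<lambda>t. \<Sum>\<^sub>\<infinity>i\<in>M. g i t) has_field_derivative D) (at z)" "((\<lambda>i. g' i z) has_sum D) M"
proof -
  let ?F = "finite_subsets_at_top M"
  have limit: "uniform_limit (cball z d) (\<lambda>X t. \<Sum>i\<in>X. g i t) (\<lambda>t. \<Sum>\<^sub>\<infinity>i\<in>M. g i t) ?F"
    using bound by (intro Weierstrass_m_test_general) auto
  have sum_deriv: "((\<lambda>t. \<Sum>i\<in>X. g i t) has_field_derivative (\<Sum>i\<in>X. g' i w)) (at w)" if "X \<subseteq> M" for X w
    using that deriv by (intro DERIV_sum) auto
  have "\<forall>\<^sub>F X in ?F. continuous_on (cball z d) (\<lambda>t. \<Sum>i\<in>X. g i t) \<and>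
      (\<forall>w\<in>ball z d. ((\<lambda>t. \<Sum>i\<in>X. g i t) has_field_derivative (\<Sum>i\<in>X. g' i w)) (at w))"
  proof (rule eventually_finite_subsets_at_top_weakI, intro conjI ballI)
    fix X assume X: "X \<subseteq> M"
    show "continuous_on (cball z d) (\<lambda>t. \<Sum>i\<in>X. g i t)"
      by (rule DERIV_continuous_on[OF has_field_derivative_at_within[OF sum_deriv[OF X]]])
  qed (rule sum_deriv)
  from has_complex_derivative_uniform_limit[OF this limit finite_subsets_at_top_neq_bot \<open>0 < d\<close>]
  obtain g_lim where "\<And>w. w \<in> ball z d \<Longrightarrow> ((\<lambda>t. \<Sum>\<^sub>\<infinity>i\<in>M. g i t) has_field_derivative g_lim w) (at w) \<and>
      ((\<lambda>X. \<Sum>i\<in>X. g' i w) \<longlongrightarrow> g_lim w) ?F" by metis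
  moreover have "z \<in> ball z d" using \<open>0 < d\<close> by simp
  ultimately show ?thesis by (intro that[of "g_lim z"]) (auto simp: has_sum_def)
qed

lemma has_sum_diff:
  fixes f g :: "'a \<Rightarrow> 'b::topological_ab_group_add"
  assumes "(f has_sum a) A" "(g has_sum b) A"
  shows "((\<lambda>x. f x - g x) has_sum (a - b)) A"
  using has_sum_add[OF assms(1), of "\<lambda>x. - g x" "- b"] assms(2) by (simp add: has_sum_uminus)

lemma has_sum_finite_sum:
  fixes g :: "'b \<Rightarrow> 'a \<Rightarrow> 'c::topological_comm_monoid_add"
  assumes "\<And>b. b \<in> B \<Longrightarrow> (g b has_sum S b) X"
  shows "((\<lambda>\<eta>. \<Sum>b\<in>B. g b \<eta>) has_sum (\<Sum>b\<in>B. S b)) X"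
  using assms by (induction B rule: infinite_finite_induct) (auto intro: has_sum_add)

lemma linear_times_power_bounded:
  fixes r r' c :: real
  assumes "0 \<le> r" "r < r'"
  obtains K where "0 \<le> K" "\<And>m. (real m + c) * r ^ m \<le> K * r' ^ Suc m"
proof -
  define q where "q = r / r'"
  have q: "0 \<le> q" "q < 1" using assms by (auto simp: q_def)
  have "(\<lambda>m. real m * q ^ m) \<longlonglongrightarrow> 0" using q powser_times_n_limit_0[of q] by simp
  moreover have "(\<lambda>m. c * q ^ m) \<longlonglongrightarrow> c * 0" using q by (intro tendsto_intros LIMSEQ_realpow_zero) auto
  ultimately have "(\<lambda>m. real m * q ^ m + c * q ^ m) \<longlonglongrightarrow> 0 + c * 0" by (rule tendsto_add)
  then have "Bseq (\<lambda>m. real m * q ^ m + c * q ^ m)" using convergentI convergent_imp_Bseq by blast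
  then obtain K where K: "0 < K" "\<And>m. norm (real m * q ^ m + c * q ^ m) \<le> K" by (auto simp: Bseq_def)
  have "(real m + c) * r ^ m \<le> (K / r') * r' ^ Suc m" for m
  proof -
    have "(real m + c) * r ^ m = (real m * q ^ m + c * q ^ m) * r' ^ m"
      using assms by (simp add: q_def power_divide field_simps)
    also have "\<dots> \<le> K * r' ^ m" using K(2)[of m] assms by (intro mult_right_mono) auto
    finally show ?thesis using assms by simp
  qed
  then show ?thesis using K assms by (intro that[of "K / r'"]) auto
qed

context jack_parameters
begin

lemma supnorm_ge: "i < n \<Longrightarrow> cmod (z i) \<le> supnorm n z"
  unfolding supnorm_def by (intro Max_ge) auto

lemma supnorm_nonneg: "0 \<le> supnorm n z"
  using order_trans[OF norm_ge_zero supnorm_ge[of 0 z]] n by simp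

lemma supnorm_less_iff: "supnorm n z < R \<longleftrightarrow> (\<forall>i<n. cmod (z i) < R)"
  unfolding supnorm_def using n by (subst Max_less_iff) (auto simp: lessThan_empty_iff)

lemma supnorm_comp_less: "\<sigma> permutes {..<n} \<Longrightarrow> supnorm n x < R \<Longrightarrow> supnorm n (x \<circ> \<sigma>) < R"
  by (simp add: supnorm_less_iff permutes_lessThan_iff)

definition jack_series :: "((nat \<Rightarrow> nat) \<Rightarrow> complex) \<Rightarrow> (nat \<Rightarrow> complex) \<Rightarrow> complex" where
  "jack_series A x = (\<Sum>\<^sub>\<infinity>\<eta>\<in>multi_idx n. A \<eta> * L \<eta> x)"

definition jack_summable :: "((nat \<Rightarrow> nat) \<Rightarrow> complex) \<Rightarrow> real \<Rightarrow> bool" where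
  "jack_summable A r \<longleftrightarrow> (\<lambda>\<eta>. cmod (A \<eta>) * jackL_one \<eta> * r ^ absv n \<eta>) summable_on multi_idx n"

definition has_jack_series :: "((nat \<Rightarrow> complex) \<Rightarrow> complex) \<Rightarrow> ((nat \<Rightarrow> nat) \<Rightarrow> complex) \<Rightarrow> real \<Rightarrow> bool" where
  "has_jack_series f A R \<longleftrightarrow> (\<forall>r. 0 \<le> r \<longrightarrow> r < R \<longrightarrow> jack_summable A r) \<and>
    (\<forall>x. supnorm n x < R \<longrightarrow> f x = jack_series A x)"

lemma jack_series_term_le:
  assumes "\<eta> \<in> multi_idx n" "supnorm n x \<le> r"
  shows "cmod (A \<eta> * L \<eta> x) \<le> cmod (A \<eta>) * jackL_one \<eta> * r ^ absv n \<eta>"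
proof -
  have "cmod (L \<eta> x) \<le> jackL_one \<eta> * r ^ absv n \<eta>"
    using assms supnorm_ge by (intro jackL_norm_le) (auto intro: order_trans)
  then show ?thesis by (simp add: norm_mult mult.assoc mult_left_mono)
qed

lemma jack_series_has_sum:
  assumes "jack_summable A r" "supnorm n x \<le> r"
  shows "((\<lambda>\<eta>. A \<eta> * L \<eta> x) has_sum jack_series A x) (multi_idx n)"
proof -
  have "(\<lambda>\<eta>. norm (A \<eta> * L \<eta> x)) summable_on multi_idx n"
    using assms(1) unfolding jack_summable_def
    by (rule summable_on_comparison_test) (use jack_series_term_le[OF _ assms(2)] in auto)
  then show ?thesis unfolding jack_series_def by (rule has_sum_infsum[OF abs_summable_summable])
qed

lemma has_jack_series_has_sum:
  assumes "has_jack_series f A R" "supnorm n x < R"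
  shows "((\<lambda>\<eta>. A \<eta> * L \<eta> x) has_sum f x) (multi_idx n)"
  using assms supnorm_nonneg[of x] jack_series_has_sum[of A "supnorm n x" x]
  by (simp add: has_jack_series_def)

lemma supnorm_coord_line_le: "supnorm n (coord_line a y t) \<le> supnorm n y + cmod t"
proof -
  have "cmod (coord_line a y t i) \<le> supnorm n y + cmod t" if "i < n" for i
    using norm_triangle_ineq[of "y i" "t * unit_vec a i"] supnorm_ge[OF that, of y]
    by (auto simp: unit_vec_apply intro: add_increasing2 split: if_splits)
  then show ?thesis
    unfolding supnorm_def[of n "coord_line a y t"] using n
    by (intro Max.boundedI) (auto simp: lessThan_empty_iff)
qed

lemma has_jack_series_dir_deriv:
  assumes f: "has_jack_series f A R" and y: "supnorm n y < R"
  shows "((\<lambda>\<eta>. A \<eta> * dir_deriv (unit_vec a) (L \<eta>) y) has_sum dir_deriv (unit_vec a) f y) (multi_idx n)"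
proof -
  let ?M = "multi_idx n"
  obtain r where r: "supnorm n y < r" "r < R" using dense[OF y] by blast
  define d where "d = r - supnorm n y"
  have "0 < d" using r by (simp add: d_def)
  have line: "supnorm n (coord_line a y t) \<le> r" if "t \<in> cball 0 d" for t
    using supnorm_coord_line_le[of y t a] that by (simp add: d_def)
  have "0 \<le> r" using supnorm_nonneg[of y] r by simp
  then have summable: "(\<lambda>\<eta>. cmod (A \<eta>) * jackL_one \<eta> * r ^ absv n \<eta>) summable_on ?M"
    using f r by (simp add: has_jack_series_def jack_summable_def)
  have bound: "cmod (A \<eta> * L \<eta> (coord_line a y t)) \<le> cmod (A \<eta>) * jackL_one \<eta> * r ^ absv n \<eta>"
    if "\<eta> \<in> ?M" "t \<in> cball 0 d" for \<eta> t
    using that(1) line[OF that(2)] by (rule jack_series_term_le)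
  have deriv: "((\<lambda>t. A \<eta> * L \<eta> (coord_line a y t)) has_field_derivative
      A \<eta> * dir_deriv (unit_vec a) (L \<eta>) (coord_line a y w)) (at w)" if "\<eta> \<in> ?M" for \<eta> w
    by (intro DERIV_cmult partially_diff_DERIV jackL_partially_diff that)
  from has_sum_complex_derivative[OF \<open>0 < d\<close> bound summable deriv]
  obtain D where D: "((\<lambda>t. \<Sum>\<^sub>\<infinity>\<eta>\<in>?M. A \<eta> * L \<eta> (coord_line a y t)) has_field_derivative D) (at 0)"
    and sum: "((\<lambda>\<eta>. A \<eta> * dir_deriv (unit_vec a) (L \<eta>) (coord_line a y 0)) has_sum D) ?M" by blast
  have "((\<lambda>t. f (coord_line a y t)) has_field_derivative D) (at 0)"
  proof (rule has_field_derivative_transform_within_open[OF D])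
    show "open (ball (0::complex) d)" "0 \<in> ball (0::complex) d" using \<open>0 < d\<close> by auto
    show "(\<Sum>\<^sub>\<infinity>\<eta>\<in>?M. A \<eta> * L \<eta> (coord_line a y t)) = f (coord_line a y t)" if "t \<in> ball 0 d" for t
      using f line[of t] that r(2) by (simp add: has_jack_series_def jack_series_def)
  qed
  then have "dir_deriv (unit_vec a) f y = D" by (rule dir_derivI)
  then show ?thesis using sum by simp
qed

lemma has_jack_series_diff_quot:
  assumes f: "has_jack_series f A R" and y: "supnorm n y < R" and ab: "a < n" "b < n"
  shows "((\<lambda>\<eta>. A \<eta> * diff_quot a b (L \<eta>) y) has_sum diff_quot a b f y) (multi_idx n)"
proof (cases "y a = y b")
  case True
  have "((\<lambda>\<eta>. A \<eta> * dir_deriv (unit_vec a) (L \<eta>) y - A \<eta> * dir_deriv (unit_vec b) (L \<eta>) y) has_sum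
    (dir_deriv (unit_vec a) f y - dir_deriv (unit_vec b) f y)) (multi_idx n)"
    by (intro has_sum_diff has_jack_series_dir_deriv[OF f y])
  then show ?thesis using True by (simp add: diff_quot_def algebra_simps)
next
  case False
  have swapped: "supnorm n (sw_pt a b y) < R"
    unfolding sw_pt_def by (intro supnorm_comp_less swp_permutes ab y)
  have "((\<lambda>\<eta>. (A \<eta> * L \<eta> y - A \<eta> * L \<eta> (sw_pt a b y)) / (y a - y b)) has_sum
    ((f y - f (sw_pt a b y)) / (y a - y b))) (multi_idx n)"
    by (intro has_sum_divide_const has_sum_diff has_jack_series_has_sum[OF f] y swapped)
  then show ?thesis using False by (simp add: diff_quot_def algebra_simps)
qed

lemma has_jack_series_lower_op_has_sum:
  assumes f: "has_jack_series f A R" and x: "supnorm n x < R"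
  shows "((\<lambda>\<eta>. A \<eta> * lower_op (L \<eta>) x) has_sum lower_op f x) (multi_idx n)"
proof -
  let ?y = "x \<circ> cyc n" and ?a = "n - 1"
  have last: "?a < n" using n by simp
  have y: "supnorm n ?y < R" by (rule supnorm_comp_less[OF cyc_permutes x])
  have "((\<lambda>\<eta>. A \<eta> * dir_deriv (unit_vec ?a) (L \<eta>) ?y +
      of_real k * (\<Sum>b\<in>{..<n} - {?a}. A \<eta> * diff_quot ?a b (L \<eta>) ?y)) has_sum
    (dir_deriv (unit_vec ?a) f ?y + of_real k * (\<Sum>b\<in>{..<n} - {?a}. diff_quot ?a b f ?y))) (multi_idx n)"
    using last by (intro has_sum_add has_sum_cmult_right has_sum_finite_sum
        has_jack_series_dir_deriv[OF f y] has_jack_series_diff_quot[OF f y]) auto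
  then show ?thesis
    unfolding lower_op_def dunkl_unit[OF last]
    by (simp only: sum_distrib_left distrib_left mult.left_commute[of "of_real k"])
qed

definition lower_coef :: "((nat \<Rightarrow> nat) \<Rightarrow> complex) \<Rightarrow> (nat \<Rightarrow> nat) \<Rightarrow> complex" where
  "lower_coef A \<kappa> = A (raise_idx n \<kappa>) * of_nat (Suc (absv n \<kappa>))"

lemma jack_summable_lower_coef:
  assumes A: "jack_summable A r'" and r: "0 \<le> r" "r < r'"
  shows "jack_summable (lower_coef A) r"
proof -
  obtain K where K: "0 \<le> K" "\<And>m. (real m + (1 + k * real n)) * r ^ m \<le> K * r' ^ Suc m"
    using linear_times_power_bounded[OF r, of "1 + k * real n"] by blast
  let ?t = "\<lambda>\<eta>. K * (cmod (A \<eta>) * jackL_one \<eta> * r' ^ absv n \<eta>)"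
  have "?t summable_on multi_idx n"
    using A unfolding jack_summable_def by (rule summable_on_cmult_right)
  then have "?t summable_on {\<kappa> \<in> multi_idx n. 0 < \<kappa> (n - 1)}"
    by (rule summable_on_subset_banach) auto
  then have "(\<lambda>\<kappa>. ?t (raise_idx n \<kappa>)) summable_on multi_idx n"
    using summable_on_reindex_bij_betw[OF bij_betw_raise_idx[OF n], of ?t] by simp
  then show ?thesis unfolding jack_summable_def
  proof (rule summable_on_comparison_test)
    fix \<kappa> assume \<kappa>: "\<kappa> \<in> multi_idx n"
    let ?p = "raise_idx n \<kappa>" and ?m = "absv n \<kappa>"
    have "cmod (lower_coef A \<kappa>) * jackL_one \<kappa> * r ^ ?m = cmod (A ?p) * (real (Suc ?m) * jackL_one \<kappa>) * r ^ ?m"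
      by (simp add: lower_coef_def norm_mult del: of_nat_Suc)
    also have "\<dots> = cmod (A ?p) * jackL_one ?p * (raise_factor \<kappa> * r ^ ?m)"
      unfolding jackL_one_raise[OF \<kappa>, symmetric] by simp
    also have "\<dots> \<le> cmod (A ?p) * jackL_one ?p * (K * r' ^ Suc ?m)"
    proof (intro mult_left_mono)
      have "raise_factor \<kappa> * r ^ ?m \<le> (real ?m + (1 + k * real n)) * r ^ ?m"
        using raise_factor_le r by (intro mult_right_mono) auto
      then show "raise_factor \<kappa> * r ^ ?m \<le> K * r' ^ Suc ?m" using K(2)[of ?m] by linarith
    qed (use jackL_one_pos[OF raise_idx_multi, of \<kappa>] in simp)
    finally show "cmod (lower_coef A \<kappa>) * jackL_one \<kappa> * r ^ ?m \<le> ?t ?p"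
      by (simp add: absv_raise_idx[OF n] algebra_simps)
    show "0 \<le> cmod (lower_coef A \<kappa>) * jackL_one \<kappa> * r ^ ?m" using jackL_one_pos[OF \<kappa>] r by simp
  qed
qed

lemma has_jack_series_lower_op:
  assumes f: "has_jack_series f A R" shows "has_jack_series (lower_op f) (lower_coef A) R"
  unfolding has_jack_series_def
proof (intro conjI allI impI)
  fix r assume r: "0 \<le> r" "r < R"
  obtain r' where "r < r'" "r' < R" using dense[OF r(2)] by blast
  then show "jack_summable (lower_coef A) r"
    using f r by (intro jack_summable_lower_coef[of A r']) (auto simp: has_jack_series_def)
next
  fix x assume x: "supnorm n x < R"
  let ?t = "\<lambda>\<eta>. A \<eta> * lower_op (L \<eta>) x"
  have "(?t has_sum lower_op f x) {\<kappa> \<in> multi_idx n. 0 < \<kappa> (n - 1)}"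
    using has_jack_series_lower_op_has_sum[OF f x]
    by (rule has_sum_cong_neutral[THEN iffD1, rotated -1]) (auto simp: lower_op_jackL_last_zero)
  then have "((\<lambda>\<kappa>. ?t (raise_idx n \<kappa>)) has_sum lower_op f x) (multi_idx n)"
    by (subst has_sum_reindex_bij_betw[OF bij_betw_raise_idx[OF n]])
  then have "((\<lambda>\<kappa>. lower_coef A \<kappa> * L \<kappa> x) has_sum lower_op f x) (multi_idx n)"
    by (simp add: lower_op_jackL_raise lower_coef_def mult.assoc cong: has_sum_cong)
  then show "lower_op f x = jack_series (lower_coef A) x"
    unfolding jack_series_def by (rule infsumI[symmetric])
qed

lemma lower_coef_pow:
  "(lower_coef ^^ i) A \<kappa> = A ((raise_idx n ^^ i) \<kappa>) * (fact (absv n \<kappa> + i) / fact (absv n \<kappa>))"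
proof (induction i arbitrary: \<kappa>)
  case (Suc i)
  have "(lower_coef ^^ Suc i) A \<kappa> = A ((raise_idx n ^^ i) (raise_idx n \<kappa>)) *
    (fact (Suc (absv n \<kappa>) + i) / fact (Suc (absv n \<kappa>))) * of_nat (Suc (absv n \<kappa>))"
    by (simp add: lower_coef_def Suc absv_raise_idx[OF n])
  moreover have "fact (Suc (absv n \<kappa>) + i) / fact (Suc (absv n \<kappa>)) * of_nat (Suc (absv n \<kappa>))
    = (fact (absv n \<kappa> + Suc i) / fact (absv n \<kappa>) :: complex)"
    by (simp add: divide_simps del: of_nat_Suc)
  ultimately show ?case by (simp only: funpow_Suc_right o_apply mult.assoc)
qed simp

theorem dunkl_Delta_jack_series:
  assumes f: "has_jack_series f A R" and x: "supnorm n x < R"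
  shows "dunkl_Delta n k f x = jack_series (\<lambda>\<kappa>. d_coef n (plus_one n \<kappa>) * A (plus_one n \<kappa>)) x"
proof -
  have "has_jack_series ((lower_op ^^ i) f) ((lower_coef ^^ i) A) R" for i
    by (induction i) (simp_all add: f has_jack_series_lower_op)
  then have "dunkl_Delta n k f x = jack_series ((lower_coef ^^ n) A) x"
    using x unfolding dunkl_Delta_eq by (simp add: has_jack_series_def)
  also have "\<dots> = jack_series (\<lambda>\<kappa>. d_coef n (plus_one n \<kappa>) * A (plus_one n \<kappa>)) x"
    unfolding jack_series_def lower_coef_pow
    by (intro infsum_cong) (simp add: raise_idx_pow_n d_coef_plus_one)
  finally show ?thesis .
qed

subsection \<open>Action on finite combinations of Jack polynomials\<close>

lemma has_jack_series_finite:
  assumes "finite S" "S \<subseteq> multi_idx n"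
  shows "has_jack_series (\<lambda>x. \<Sum>\<eta>\<in>S. c \<eta> * L \<eta> x) (\<lambda>\<eta>. if \<eta> \<in> S then c \<eta> else 0) R"
  unfolding has_jack_series_def jack_summable_def
proof (intro conjI allI impI)
  show "(\<lambda>\<eta>. cmod (if \<eta> \<in> S then c \<eta> else 0) * jackL_one \<eta> * r ^ absv n \<eta>) summable_on multi_idx n" for r
    using summable_on_finite[OF assms(1)] assms(2)
    by (subst summable_on_cong_neutral[where T = S]) auto
  have "jack_series (\<lambda>\<eta>. if \<eta> \<in> S then c \<eta> else 0) x = (\<Sum>\<^sub>\<infinity>\<eta>\<in>S. c \<eta> * L \<eta> x)" for x
    unfolding jack_series_def using assms(2) by (intro infsum_cong_neutral) auto
  then show "(\<Sum>\<eta>\<in>S. c \<eta> * L \<eta> x) = jack_series (\<lambda>\<eta>. if \<eta> \<in> S then c \<eta> else 0) x" for x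
    using assms(1) by simp
qed

lemma dunkl_Delta_jackL_sum:
  assumes S: "finite S" "S \<subseteq> multi_idx n"
  shows "dunkl_Delta n k (\<lambda>x. \<Sum>\<eta>\<in>S. c \<eta> * L \<eta> x) = (\<lambda>x. \<Sum>\<eta>\<in>S. c \<eta> * (d_coef n \<eta> * L (minus_one \<eta>) x))"
proof
  fix x
  let ?A = "\<lambda>\<eta>. if \<eta> \<in> S then c \<eta> else 0"
  let ?t = "\<lambda>\<eta>. d_coef n \<eta> * ?A \<eta> * L (minus_one \<eta>) x" and ?pos = "{\<eta> \<in> multi_idx n. \<forall>i<n. \<eta> i \<noteq> 0}"
  have "dunkl_Delta n k (\<lambda>x. \<Sum>\<eta>\<in>S. c \<eta> * L \<eta> x) x
    = jack_series (\<lambda>\<kappa>. d_coef n (plus_one n \<kappa>) * ?A (plus_one n \<kappa>)) x"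
    by (rule dunkl_Delta_jack_series[OF has_jack_series_finite[OF S, where R = "supnorm n x + 1"]]) simp
  also have "\<dots> = (\<Sum>\<^sub>\<infinity>\<kappa>\<in>multi_idx n. ?t (plus_one n \<kappa>))"
    unfolding jack_series_def by (intro infsum_cong) (simp add: minus_plus_one)
  also have "\<dots> = (\<Sum>\<^sub>\<infinity>\<eta>\<in>?pos. ?t \<eta>)" by (rule infsum_reindex_bij_betw[OF bij_betw_plus_one])
  also have "\<dots> = (\<Sum>\<^sub>\<infinity>\<eta>\<in>S. ?t \<eta>)" using S d_coef_eq_zero by (intro infsum_cong_neutral) auto
  finally show "dunkl_Delta n k (\<lambda>x. \<Sum>\<eta>\<in>S. c \<eta> * L \<eta> x) x = (\<Sum>\<eta>\<in>S. c \<eta> * (d_coef n \<eta> * L (minus_one \<eta>) x))"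
    using S by (simp add: algebra_simps)
qed

lemma dunkl_Delta_jackL:
  assumes "\<eta> \<in> multi_idx n" shows "dunkl_Delta n k (L \<eta>) = (\<lambda>x. d_coef n \<eta> * L (minus_one \<eta>) x)"
  using dunkl_Delta_jackL_sum[of "{\<eta>}" "\<lambda>_. 1"] assms by simp

lemma dunkl_Delta_jackE_ratio:
  assumes \<eta>: "\<eta> \<in> multi_idx n"
  shows "dunkl_Delta n k (E \<eta>)
    = (\<lambda>x. d_coef n \<eta> * of_real (jack_coef (minus_one \<eta>) / jack_coef \<eta>) * E (minus_one \<eta>) x)"
proof -
  have "E \<eta> = (\<lambda>x. \<Sum>\<eta>\<in>{\<eta>}. of_real (1 / jack_coef \<eta>) * L \<eta> x)"
    using jack_coef_pos[OF \<eta>] by (simp add: jackL_eq[OF \<eta>])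
  then have "dunkl_Delta n k (E \<eta>)
    = (\<lambda>x. \<Sum>\<eta>\<in>{\<eta>}. of_real (1 / jack_coef \<eta>) * (d_coef n \<eta> * L (minus_one \<eta>) x))"
    using dunkl_Delta_jackL_sum[of "{\<eta>}" "\<lambda>\<eta>. of_real (1 / jack_coef \<eta>)"] \<eta> by simp
  then show ?thesis by (simp add: jackL_eq[OF minus_one_multi[OF \<eta>]] mult.assoc)
qed

definition delta_eigval :: "(nat \<Rightarrow> nat) \<Rightarrow> real" where
  "delta_eigval \<eta> = (if \<forall>i<n. 1 \<le> \<eta> i then delta_factor (minus_one \<eta>) else 0)"

lemma dunkl_Delta_jackE:
  assumes \<eta>: "\<eta> \<in> multi_idx n"
  shows "dunkl_Delta n k (E \<eta>) = (\<lambda>x. of_real (delta_eigval \<eta>) * E (minus_one \<eta>) x)"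
proof (cases "\<forall>i<n. 1 \<le> \<eta> i")
  case True
  then have "\<forall>i<n. \<eta> i \<noteq> 0" by fastforce
  define \<kappa> where "\<kappa> = minus_one \<eta>"
  have \<kappa>: "\<kappa> \<in> multi_idx n" "\<eta> = plus_one n \<kappa>"
    using \<eta> \<open>\<forall>i<n. \<eta> i \<noteq> 0\<close> by (simp_all add: \<kappa>_def minus_one_multi plus_minus_one)
  have "fact (absv n \<kappa> + n) / fact (absv n \<kappa>) * (jack_coef \<kappa> / jack_coef \<eta>) = delta_factor \<kappa>"
    using jack_coef_plus_one[OF \<kappa>(1)] jack_coef_pos[OF \<eta>] unfolding \<kappa>(2) by (simp add: field_simps)
  then have "d_coef n \<eta> * of_real (jack_coef \<kappa> / jack_coef \<eta>) = of_real (delta_factor \<kappa>)"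
    unfolding \<kappa>(2) d_coef_plus_one[OF \<kappa>(1)] by (metis of_real_divide of_real_fact of_real_mult)
  then show ?thesis using True by (simp add: dunkl_Delta_jackE_ratio[OF \<eta>] delta_eigval_def \<kappa>_def)
next
  case False
  then have "d_coef n \<eta> = 0" using d_coef_eq_zero by (auto simp: not_le)
  then show ?thesis using False by (auto simp: dunkl_Delta_jackE_ratio[OF \<eta>] delta_eigval_def)
qed

lemma delta_eigval_comp:
  assumes \<eta>: "\<eta> \<in> multi_idx n" and \<sigma>: "\<sigma> permutes {..<n}" shows "delta_eigval (\<eta> \<circ> \<sigma>) = delta_eigval \<eta>"
proof -
  have "(\<forall>i<n. 1 \<le> (\<eta> \<circ> \<sigma>) i) \<longleftrightarrow> (\<forall>i<n. 1 \<le> \<eta> i)"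
    using permutes_lessThan_iff[OF \<sigma>] permutes_lessThan_iff[OF permutes_inv[OF \<sigma>]]
    by (metis comp_apply permutes_inverses(1)[OF \<sigma>])
  moreover have "minus_one (\<eta> \<circ> \<sigma>) = minus_one \<eta> \<circ> \<sigma>" by (auto simp: minus_one_def)
  ultimately show ?thesis
    by (simp only: delta_eigval_def delta_factor_comp[OF minus_one_multi[OF \<eta>] \<sigma>])
qed

definition orbit :: "(nat \<Rightarrow> nat) \<Rightarrow> (nat \<Rightarrow> nat) set" where
  "orbit lam = {\<eta> \<in> multi_idx n. plus_part n \<eta> = lam}"

lemma orbit_multi: "\<eta> \<in> orbit lam \<Longrightarrow> \<eta> \<in> multi_idx n"
  by (simp add: orbit_def)

lemma orbit_absv: "\<eta> \<in> orbit lam \<Longrightarrow> absv n \<eta> = absv n lam"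
  using absv_plus_part[of \<eta> n] by (simp add: orbit_def)

lemma finite_orbit: "finite (orbit lam)"
  by (rule finite_subset[OF _ finite_deg_idx[of n "absv n lam"]])
    (auto simp: deg_idx_def orbit_multi orbit_absv)

lemma partition_in_orbit: "is_partition n lam \<Longrightarrow> lam \<in> orbit lam"
  by (simp add: orbit_def plus_part_partition is_partition_def)

lemma orbit_obtain_perm:
  assumes "is_partition n lam" "\<eta> \<in> orbit lam"
  obtains \<sigma> where "\<sigma> permutes {..<n}" "\<eta> = lam \<circ> \<sigma>"
proof -
  have "\<eta> \<in> multi_idx n" "lam \<in> multi_idx n" "plus_part n \<eta> = plus_part n lam"
    using assms plus_part_partition[OF assms(1)] by (auto simp: orbit_def is_partition_def)
  then show ?thesis using plus_part_eq_obtain that by blast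
qed

lemma jackC_eq: "jackC n k lam = (\<lambda>z. \<Sum>\<eta>\<in>orbit lam. L \<eta> z)"
  by (rule ext) (simp add: jackC_def orbit_def)

lemma bij_betw_plus_one_orbit:
  assumes lam: "is_partition n lam" shows "bij_betw (plus_one n) (orbit lam) (orbit (plus_one n lam))"
proof (rule bij_betw_byWitness[where f' = minus_one])
  show "\<forall>\<kappa>\<in>orbit lam. minus_one (plus_one n \<kappa>) = \<kappa>" by (simp add: orbit_multi minus_plus_one)
  show "plus_one n ` orbit lam \<subseteq> orbit (plus_one n lam)" by (auto simp: orbit_def plus_part_plus_one)
  have shift: "\<eta> = plus_one n (minus_one \<eta>) \<and> minus_one \<eta> \<in> orbit lam"
    if \<eta>: "\<eta> \<in> orbit (plus_one n lam)" for \<eta>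
  proof -
    obtain \<sigma> where \<sigma>: "\<sigma> permutes {..<n}" "\<eta> = plus_one n lam \<circ> \<sigma>"
      using orbit_obtain_perm[OF is_partition_plus_one[OF lam] \<eta>] .
    then have eq: "\<eta> = plus_one n (lam \<circ> \<sigma>)" by (simp add: plus_one_comp)
    have multi: "lam \<in> multi_idx n" using lam by (simp add: is_partition_def)
    have "lam \<circ> \<sigma> \<in> orbit lam"
      using multi \<sigma>(1) lam by (simp add: orbit_def multi_idx_comp plus_part_comp plus_part_partition)
    then show ?thesis unfolding eq by (simp add: minus_plus_one orbit_multi)
  qed
  show "\<forall>\<eta>\<in>orbit (plus_one n lam). plus_one n (minus_one \<eta>) = \<eta>" using shift by metis
  show "minus_one ` orbit (plus_one n lam) \<subseteq> orbit lam" using shift by blast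
qed

lemma d_coef_orbit_eq_zero:
  assumes "is_partition n lam" "\<eta> \<in> orbit lam" "i < n" "lam i = 0" shows "d_coef n \<eta> = 0"
proof -
  obtain \<sigma> where \<sigma>: "\<sigma> permutes {..<n}" "\<eta> = lam \<circ> \<sigma>" using orbit_obtain_perm[OF assms(1,2)] .
  then have "inv \<sigma> i < n" "\<eta> (inv \<sigma> i) = 0"
    using assms permutes_inverses(1)[OF \<sigma>(1)] by (simp_all add: permutes_lessThan_iff permutes_inv)
  then show ?thesis by (rule d_coef_eq_zero)
qed

lemma dunkl_Delta_jackC:
  assumes lam: "is_partition n lam"
  shows "dunkl_Delta n k (jackC n k lam) = (\<lambda>x. d_coef n lam * jackC n k (minus_one lam) x)"
proof -
  have delta: "dunkl_Delta n k (jackC n k lam) = (\<lambda>x. \<Sum>\<eta>\<in>orbit lam. d_coef n \<eta> * L (minus_one \<eta>) x)"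
    using dunkl_Delta_jackL_sum[OF finite_orbit, of lam "\<lambda>_. 1"] by (simp add: jackC_eq orbit_def)
  have multi: "lam \<in> multi_idx n" using lam by (simp add: is_partition_def)
  show ?thesis
  proof (cases "\<forall>i<n. lam i \<noteq> 0")
    case True
    define \<mu> where "\<mu> = minus_one lam"
    have \<mu>: "is_partition n \<mu>" "lam = plus_one n \<mu>"
      using lam multi True by (simp_all add: \<mu>_def is_partition_minus_one plus_minus_one)
    show ?thesis
      unfolding delta
    proof
      fix x
      have "(\<Sum>\<eta>\<in>orbit lam. d_coef n \<eta> * L (minus_one \<eta>) x) = (\<Sum>\<kappa>\<in>orbit \<mu>. d_coef n (plus_one n \<kappa>) * L \<kappa> x)"
        unfolding \<mu>(2) sum.reindex_bij_betw[OF bij_betw_plus_one_orbit[OF \<mu>(1)], symmetric]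
        by (intro sum.cong) (simp_all add: minus_plus_one orbit_multi)
      also have "\<dots> = d_coef n lam * jackC n k \<mu> x"
        using \<mu>
        by (simp add: jackC_eq sum_distrib_left d_coef_plus_one orbit_multi orbit_absv is_partition_def)
      finally show "(\<Sum>\<eta>\<in>orbit lam. d_coef n \<eta> * L (minus_one \<eta>) x)
        = d_coef n lam * jackC n k (minus_one lam) x"
        by (simp only: \<mu>_def)
    qed
  next
    case False
    then obtain i where i: "i < n" "lam i = 0" by blast
    then have "d_coef n \<eta> = 0" if "\<eta> \<in> orbit lam" for \<eta> using d_coef_orbit_eq_zero[OF lam that] by blast
    then show ?thesis unfolding delta using d_coef_eq_zero[of i n lam] i by simp
  qed
qed

end

subsection \<open>Growth of the values at the all-one vector\<close>

lemma prod_raise_idx: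
  fixes h :: "nat \<Rightarrow> nat \<Rightarrow> 'a::comm_monoid_mult"
  assumes "1 \<le> n" and step: "h (sort_rank n \<eta> 0) (Suc (\<eta> 0)) = c * h (sort_rank n \<eta> 0) (\<eta> 0)"
  shows "(\<Prod>i<n. h (sort_rank n (raise_idx n \<eta>) i) (raise_idx n \<eta> i)) = c * (\<Prod>i<n. h (sort_rank n \<eta> i) (\<eta> i))"
proof -
  let ?h = "\<lambda>\<eta> i. h (sort_rank n \<eta> i) (\<eta> i)"
  obtain p where p: "n = Suc p" using assms(1) by (cases n) auto
  have "(\<Prod>i<n. ?h (raise_idx n \<eta>) i) = (\<Prod>i<p. ?h (raise_idx n \<eta>) i) * ?h (raise_idx n \<eta>) p"
    unfolding p by (rule prod.lessThan_Suc)
  also have "(\<Prod>i<p. ?h (raise_idx n \<eta>) i) = (\<Prod>i<p. ?h \<eta> (Suc i))"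
    using p by (intro prod.cong) (auto simp: sort_rank_raise_idx cyc_def raise_idx_def)
  also have "?h (raise_idx n \<eta>) p = c * ?h \<eta> 0"
    using p step by (simp add: sort_rank_raise_idx cyc_def raise_idx_def)
  also have "(\<Prod>i<p. ?h \<eta> (Suc i)) * (c * ?h \<eta> 0) = c * (\<Prod>i<n. ?h \<eta> i)"
    unfolding p prod.lessThan_Suc_shift by (simp add: ac_simps)
  finally show ?thesis .
qed

context jack_parameters
begin

text \<open>The generalized Pochhammer symbol at \<^term>\<open>1 + k * (real n - 1)\<close>: this parameter makes the
  normalized values \<^term>\<open>jackL_one \<eta> / fact (absv n \<eta>) * poch_prod \<eta>\<close> invariant under raising.\<close>

definition poch_prod :: "(nat \<Rightarrow> nat) \<Rightarrow> real" where
  "poch_prod \<eta> = (\<Prod>j<n. pochhammer (1 + k * (real n - 1) - k * real (sort_rank n \<eta> j)) (\<eta> j))"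

definition scaled_one :: "(nat \<Rightarrow> nat) \<Rightarrow> real" where
  "scaled_one \<eta> = jackL_one \<eta> / fact (absv n \<eta>) * poch_prod \<eta>"

lemma poch_base_ge: "j < n \<Longrightarrow> 1 \<le> 1 + k * (real n - 1) - k * real (sort_rank n \<eta> j)"
  using eigval_lower_bound[OF k, of j n \<eta>] by (simp add: eigval_sort_rank)

lemma poch_prod_pos: "0 < poch_prod \<eta>"
  unfolding poch_prod_def
proof (intro prod_pos pochhammer_pos)
  show "0 < 1 + k * (real n - 1) - k * real (sort_rank n \<eta> j)" if "j \<in> {..<n}" for j
    using poch_base_ge[of j \<eta>] that by simp
qed

lemma scaled_one_pos: "\<eta> \<in> multi_idx n \<Longrightarrow> 0 < scaled_one \<eta>"
  unfolding scaled_one_def using jackL_one_pos poch_prod_pos by simp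

lemma scaled_one_raise:
  assumes "\<eta> \<in> multi_idx n" shows "scaled_one (raise_idx n \<eta>) = scaled_one \<eta>"
proof -
  have "pochhammer (1 + k * (real n - 1) - k * real (sort_rank n \<eta> 0)) (Suc (\<eta> 0))
    = raise_factor \<eta> * pochhammer (1 + k * (real n - 1) - k * real (sort_rank n \<eta> 0)) (\<eta> 0)"
    using n by (simp add: pochhammer_Suc raise_factor_def eigval_sort_rank algebra_simps)
  then have "poch_prod (raise_idx n \<eta>) = raise_factor \<eta> * poch_prod \<eta>"
    unfolding poch_prod_def
    using prod_raise_idx[OF n, of "\<lambda>r. pochhammer (1 + k * (real n - 1) - k * real r)"] by simp
  then show ?thesis
    using jackL_one_raise[OF assms]
    by (simp add: scaled_one_def absv_raise_idx[OF n] divide_simps algebra_simps del: of_nat_Suc)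
qed

lemma poch_prod_swap:
  assumes j: "Suc j < n" "\<kappa> j \<noteq> \<kappa> (Suc j)" shows "poch_prod (\<kappa> \<circ> swp j (Suc j)) = poch_prod \<kappa>"
proof -
  have perm: "swp j (Suc j) permutes {..<n}" using j by (intro swp_permutes) auto
  have "sort_rank n (\<kappa> \<circ> swp j (Suc j)) = sort_rank n \<kappa> \<circ> swp j (Suc j)"
    using j by (intro sort_rank_swap) auto
  then show ?thesis
    unfolding poch_prod_def
    using prod.permute[OF perm, of "\<lambda>j. pochhammer (1 + k * (real n - 1) - k * real (sort_rank n \<kappa> j)) (\<kappa> j)"]
    by simp
qed

lemma swap_ratio_le:
  assumes j: "Suc j < n" "\<kappa> j = 0" "0 < \<kappa> (Suc j)"
  shows "(1 + swap_coef n k \<kappa> j) / (1 - swap_coef n k \<kappa> j) \<le> 1 + 2 * k / real (\<kappa> (Suc j))"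
proof -
  define d where "d = eigval n k \<kappa> (Suc j) - eigval n k \<kappa> j"
  have d: "real (\<kappa> (Suc j)) + k \<le> d" using eigval_gap[OF k, of "Suc j" n j \<kappa>] j by (simp add: d_def)
  then have pos: "0 < d - k" "0 < d" using j k by auto
  then have "(1 + k / d) / (1 - k / d) = 1 + 2 * k / (d - k)" by (simp add: field_simps)
  also have "\<dots> \<le> 1 + 2 * k / real (\<kappa> (Suc j))"
    using d pos j k by (intro add_left_mono divide_left_mono) auto
  finally show ?thesis by (simp add: swap_coef_def d_def)
qed

lemma scaled_one_swap_le:
  assumes \<kappa>: "\<kappa> \<in> multi_idx n" and j: "Suc j < n" "\<kappa> j = 0" "0 < \<kappa> (Suc j)"
  shows "scaled_one (\<kappa> \<circ> swp j (Suc j)) \<le> (1 + 2 * k / real (\<kappa> (Suc j))) * scaled_one \<kappa>"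
proof -
  let ?\<eta> = "\<kappa> \<circ> swp j (Suc j)" and ?a = "swap_coef n k \<kappa> j"
  have ascent: "\<kappa> j < \<kappa> (Suc j)" using j by simp
  have perm: "swp j (Suc j) permutes {..<n}" using j by (intro swp_permutes) auto
  have "jackL_one ?\<eta> = (1 + ?a) / (1 - ?a) * jackL_one \<kappa>"
    using jackL_one_swap[OF \<kappa> j(1) ascent] swap_coef_less_one[OF k j(1) ascent] by (simp add: field_simps)
  then have "scaled_one ?\<eta> = (1 + ?a) / (1 - ?a) * scaled_one \<kappa>"
    using poch_prod_swap[OF j(1)] ascent by (simp add: scaled_one_def absv_comp[OF perm] del: comp_apply)
  then show ?thesis
    using mult_right_mono[OF swap_ratio_le[OF j], of "scaled_one \<kappa>"] scaled_one_pos[OF \<kappa>] by simp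
qed

definition growth :: "nat \<Rightarrow> real" where
  "growth a = (\<Prod>b<a. (1 + 2 * k / real (Suc b)) ^ (n - 1))"

definition growth_prod :: "(nat \<Rightarrow> nat) \<Rightarrow> real" where
  "growth_prod \<eta> = (\<Prod>i<n. growth (\<eta> i))"

lemma growth_pos: "0 < growth a"
  unfolding growth_def using k by (intro prod_pos zero_less_power) (auto intro: add_pos_nonneg)

lemma growth_prod_comp: "\<sigma> permutes {..<n} \<Longrightarrow> growth_prod (\<eta> \<circ> \<sigma>) = growth_prod \<eta>"
  unfolding growth_prod_def using prod.permute[of \<sigma> "{..<n}" "\<lambda>i. growth (\<eta> i)"] by (simp add: comp_def)

lemma growth_prod_raise:
  "growth_prod (raise_idx n \<eta>) = (1 + 2 * k / real (Suc (\<eta> 0))) ^ (n - 1) * growth_prod \<eta>"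
  unfolding growth_prod_def
  by (rule prod_raise_idx[OF n, of "\<lambda>_. growth"]) (simp add: growth_def)

text \<open>An entry \<open>a\<close> is moved left at most \<^term>\<open>n - 1\<close> times between two applications of \<^term>\<open>raise_idx n\<close>,
  each time at the cost of a factor \<^term>\<open>1 + 2 * k / a\<close>. For zero entries this factor is \<^term>\<open>1::real\<close>,
  as division by zero yields zero.\<close>

definition growth_bounded :: "(nat \<Rightarrow> nat) \<Rightarrow> bool" where
  "growth_bounded \<eta> \<longleftrightarrow> (\<forall>j<n. (\<forall>i>j. \<eta> i = 0) \<longrightarrow>
    scaled_one \<eta> * (1 + 2 * k / real (\<eta> j)) ^ j \<le> scaled_one (\<lambda>_. 0) * growth_prod \<eta>)"

lemma growth_boundedD:
  assumes \<eta>: "\<eta> \<in> multi_idx n" and bounded: "growth_bounded \<eta>"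
  shows "scaled_one \<eta> \<le> scaled_one (\<lambda>_. 0) * growth_prod \<eta>"
proof -
  have "scaled_one \<eta> * 1 \<le> scaled_one \<eta> * (1 + 2 * k / real (\<eta> (n - 1))) ^ (n - 1)"
    using scaled_one_pos[OF \<eta>] k by (intro mult_left_mono one_le_power) auto
  also have "\<dots> \<le> scaled_one (\<lambda>_. 0) * growth_prod \<eta>"
    using \<eta> bounded n by (auto simp: growth_bounded_def multi_idx_def)
  finally show ?thesis by simp
qed

lemma growth_bounded_raise:
  assumes \<eta>: "\<eta> \<in> multi_idx n" and bounded: "growth_bounded \<eta>"
  shows "growth_bounded (raise_idx n \<eta>)"
  unfolding growth_bounded_def
proof (intro allI impI)
  let ?q = "(1 + 2 * k / real (Suc (\<eta> 0))) ^ (n - 1)"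
  fix j assume j: "j < n" "\<forall>i>j. raise_idx n \<eta> i = 0"
  have "\<not> j < n - 1" using j(2) raise_idx_last[OF n, of \<eta>] by fastforce
  then have last: "j = n - 1" using j(1) by simp
  have "?q * scaled_one \<eta> \<le> ?q * (scaled_one (\<lambda>_. 0) * growth_prod \<eta>)"
    using growth_boundedD[OF assms] k by (intro mult_left_mono) auto
  then have "scaled_one (raise_idx n \<eta>) * ?q \<le> scaled_one (\<lambda>_. 0) * growth_prod (raise_idx n \<eta>)"
    unfolding scaled_one_raise[OF \<eta>] growth_prod_raise by (simp add: ac_simps)
  then show "scaled_one (raise_idx n \<eta>) * (1 + 2 * k / real (raise_idx n \<eta> j)) ^ j
    \<le> scaled_one (\<lambda>_. 0) * growth_prod (raise_idx n \<eta>)" unfolding last by (simp only: raise_idx_last[OF n])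
qed

lemma growth_bounded_swap:
  assumes \<kappa>: "\<kappa> \<in> multi_idx n" and j: "Suc j < n" "\<kappa> j = 0" "0 < \<kappa> (Suc j)"
    and trailing: "\<forall>i>Suc j. \<kappa> i = 0" and bounded: "growth_bounded \<kappa>"
  shows "growth_bounded (\<kappa> \<circ> swp j (Suc j))"
  unfolding growth_bounded_def
proof (intro allI impI)
  let ?\<eta> = "\<kappa> \<circ> swp j (Suc j)" and ?K = "scaled_one (\<lambda>_. 0)"
  let ?q = "1 + 2 * k / real (\<kappa> (Suc j))"
  have perm: "swp j (Suc j) permutes {..<n}" using j by (intro swp_permutes) auto
  have q: "1 \<le> ?q" using k by simp
  have "scaled_one ?\<eta> * ?q ^ j \<le> (?q * scaled_one \<kappa>) * ?q ^ j"
    using scaled_one_swap_le[OF \<kappa> j] q by (intro mult_right_mono) auto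
  also have "\<dots> = scaled_one \<kappa> * ?q ^ Suc j" by simp
  also have "\<dots> \<le> ?K * growth_prod \<kappa>" using bounded j(1) trailing unfolding growth_bounded_def by blast
  finally have bound: "scaled_one ?\<eta> * ?q ^ j \<le> ?K * growth_prod ?\<eta>" by (simp only: growth_prod_comp[OF perm])
  have "scaled_one ?\<eta> * 1 \<le> scaled_one ?\<eta> * ?q ^ j"
    using scaled_one_pos[OF multi_idx_comp[OF \<kappa> perm]] q by (intro mult_left_mono one_le_power) auto
  then have weak_bound: "scaled_one ?\<eta> \<le> ?K * growth_prod ?\<eta>" using bound by simp
  fix i assume i: "i < n" "\<forall>l>i. ?\<eta> l = 0"
  then have "j \<le> i" using j(3) by (metis comp_apply linorder_not_less not_less_zero swp_simps(1))
  then consider (moved) "i = j" | (vacated) "i = Suc j" | (beyond) "Suc j < i" by linarith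
  then show "scaled_one ?\<eta> * (1 + 2 * k / real (?\<eta> i)) ^ i \<le> ?K * growth_prod ?\<eta>"
  proof cases
    case moved then show ?thesis using bound by simp
  next
    case vacated then show ?thesis using weak_bound j(2) by simp
  next
    case beyond then show ?thesis using weak_bound trailing by simp
  qed
qed

lemma scaled_one_le:
  assumes "\<eta> \<in> multi_idx n" shows "scaled_one \<eta> \<le> scaled_one (\<lambda>_. 0) * growth_prod \<eta>"
proof -
  have "growth_bounded \<eta>"
    using n assms
  proof (induction rule: multi_idx_raise_swap_induct)
    case zero show ?case by (simp add: growth_bounded_def growth_prod_def growth_def)
  qed (fact growth_bounded_raise growth_bounded_swap)+
  then show ?thesis by (rule growth_boundedD[OF assms])
qed

lemma jackL_one_le:
  assumes \<eta>: "\<eta> \<in> multi_idx n"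
  shows "jackL_one \<eta> / fact (absv n \<eta>) \<le> scaled_one (\<lambda>_. 0) * (growth_prod \<eta> / poch_prod \<eta>)"
  using scaled_one_le[OF \<eta>] poch_prod_pos[of \<eta>] by (simp add: scaled_one_def field_simps)

end

subsection \<open>Absolute convergence\<close>

lemma summable_on_prod_multi_idx:
  fixes h :: "nat \<Rightarrow> real"
  assumes nonneg: "\<And>a. 0 \<le> h a" and "summable h"
  shows "(\<lambda>\<eta>. \<Prod>i<n. h (\<eta> i)) summable_on multi_idx n"
proof -
  let ?P = "PiE {..<n} (\<lambda>_. UNIV) :: (nat \<Rightarrow> nat) set"
  have "summable (\<lambda>a. norm (h a))" using assms by simp
  then have "(\<lambda>\<eta>. norm (\<Prod>i<n. h (\<eta> i))) summable_on ?P"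
    by (intro abs_summable_equivalent[THEN iffD2] abs_summable_on_prod_PiE)
      (simp_all add: abs_summable_on_nat_iff')
  moreover have "bij_betw (\<lambda>\<eta>. restrict \<eta> {..<n}) (multi_idx n) ?P"
    by (rule bij_betw_byWitness[where f' = "\<lambda>\<eta> i. if i < n then \<eta> i else 0"])
      (auto simp: multi_idx_def PiE_def extensional_def fun_eq_iff not_less)
  ultimately have "(\<lambda>\<eta>. norm (\<Prod>i<n. h (restrict \<eta> {..<n} i))) summable_on multi_idx n"
    using summable_on_reindex_bij_betw by fastforce
  then show ?thesis by (simp add: prod_nonneg nonneg)
qed

lemma summable_ratio_limit:
  fixes f R :: "nat \<Rightarrow> real"
  assumes step: "\<And>a. f (Suc a) = R a * f a" and limit: "R \<longlonglongrightarrow> l" and "\<bar>l\<bar> < 1"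
  shows "summable f"
proof -
  obtain c where c: "\<bar>l\<bar> < c" "c < 1" using dense[OF assms(3)] by blast
  have "\<forall>\<^sub>F a in sequentially. \<bar>R a\<bar> < c"
    using tendsto_rabs[OF limit] c(1) by (rule order_tendstoD)
  then obtain N where N: "\<And>a. N \<le> a \<Longrightarrow> \<bar>R a\<bar> < c" by (auto simp: eventually_sequentially)
  show ?thesis
  proof (rule summable_ratio_test[OF c(2)])
    show "norm (f (Suc a)) \<le> c * norm (f a)" if "N \<le> a" for a
      unfolding step using N[OF that] by (auto simp: abs_mult intro: mult_right_mono)
  qed
qed

lemma norm_shift_ratio_tendsto: "(\<lambda>a. cmod (z + of_nat a) / real (Suc a)) \<longlonglongrightarrow> 1"
proof -
  have "(\<lambda>a. (z - 1) / of_nat (Suc a)) \<longlonglongrightarrow> 0"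
    using LIMSEQ_Suc[OF lim_const_over_n[of "z - 1"]] by simp
  then have "(\<lambda>a. cmod ((z - 1) / of_nat (Suc a) + 1)) \<longlonglongrightarrow> cmod (0 + 1)"
    by (intro tendsto_intros)
  moreover have "cmod ((z - 1) / of_nat (Suc a) + 1) = cmod (z + of_nat a) / real (Suc a)" for a
  proof -
    have "of_nat (Suc a) \<noteq> (0::complex)" by (simp only: of_nat_eq_0_iff)
    then have "(z - 1) / of_nat (Suc a) + 1 = (z + of_nat a) / of_nat (Suc a)"
      by (simp add: field_simps)
    then show ?thesis by (simp only: norm_divide norm_of_nat)
  qed
  ultimately show ?thesis by simp
qed

lemma power_ratio_tendsto:
  assumes "p \<le> s"
  shows "(\<lambda>a. real (Suc a) ^ p / real (Suc a) ^ s) \<longlonglongrightarrow> (if p < s then 0 else 1)"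
proof -
  have "(\<lambda>a. inverse (real (Suc a)) ^ (s - p)) \<longlonglongrightarrow> 0 ^ (s - p)"
    by (intro tendsto_power LIMSEQ_inverse_real_of_nat)
  moreover have "real (Suc a) ^ p / real (Suc a) ^ s = inverse (real (Suc a)) ^ (s - p)" for a
    using assms by (simp add: power_diff power_inverse field_simps del: of_nat_Suc)
  moreover have "(if p < s then 0 else 1) = (0::real) ^ (s - p)" using assms by (simp add: power_0_left)
  ultimately show ?thesis by (simp only:)
qed

lemma norm_shift_prod_ratio_tendsto:
  fixes u v :: "nat \<Rightarrow> complex"
  assumes "p \<le> s"
  shows "(\<lambda>a. (\<Prod>i<p. cmod (u i + of_nat a)) / (\<Prod>i<s. cmod (v i + of_nat a))) \<longlonglongrightarrow> (if p < s then 0 else 1)"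
proof -
  let ?c = "\<lambda>a. real (Suc a)"
  have "(\<lambda>a. (\<Prod>i<p. cmod (u i + of_nat a) / ?c a) / (\<Prod>i<s. cmod (v i + of_nat a) / ?c a) *
      (?c a ^ p / ?c a ^ s))
    \<longlonglongrightarrow> (\<Prod>i<p. 1) / (\<Prod>i<s. 1) * (if p < s then 0 else 1)"
    using assms
    by (intro tendsto_mult tendsto_divide tendsto_prod norm_shift_ratio_tendsto power_ratio_tendsto) auto
  moreover have "(\<Prod>i<l. f i / ?c a) = (\<Prod>i<l. f i) / ?c a ^ l" for f :: "nat \<Rightarrow> real" and l a
    by (simp add: prod_dividef del: of_nat_Suc)
  ultimately show ?thesis by (simp add: divide_simps del: of_nat_Suc)
qed

context jack_parameters
begin

definition majorant :: "nat \<Rightarrow> nat \<Rightarrow> (nat \<Rightarrow> complex) \<Rightarrow> (nat \<Rightarrow> complex) \<Rightarrow> real \<Rightarrow> nat \<Rightarrow> real" where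
  "majorant p s u v \<rho> a = \<rho> ^ a * growth a *
    ((\<Prod>i<p. cmod (pochhammer (u i) a)) / (\<Prod>i<s. cmod (pochhammer (v i) a)))"

lemma majorant_nonneg: "0 \<le> \<rho> \<Longrightarrow> 0 \<le> majorant p s u v \<rho> a"
  unfolding majorant_def using growth_pos[of a]
  by (intro mult_nonneg_nonneg divide_nonneg_nonneg prod_nonneg) auto

lemma majorant_summable:
  assumes ps: "p \<le> s" and \<rho>: "0 \<le> \<rho>" "p < s \<or> \<rho> < 1"
  shows "summable (majorant p s u v \<rho>)"
proof (rule summable_ratio_limit)
  let ?R = "\<lambda>a. \<rho> * (1 + 2 * k / real (Suc a)) ^ (n - 1) *
    ((\<Prod>i<p. cmod (u i + of_nat a)) / (\<Prod>i<s. cmod (v i + of_nat a)))"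
  have poch: "(\<Prod>i<l. cmod (pochhammer (z i) (Suc a)))
    = (\<Prod>i<l. cmod (z i + of_nat a)) * (\<Prod>i<l. cmod (pochhammer (z i) a))"
    for z l a by (simp add: pochhammer_Suc norm_mult prod.distrib mult.commute)
  show "majorant p s u v \<rho> (Suc a) = ?R a * majorant p s u v \<rho> a" for a
    unfolding majorant_def growth_def poch by simp
  have "(\<lambda>a. 2 * k / real (Suc a)) \<longlonglongrightarrow> 0"
    using LIMSEQ_Suc[OF lim_const_over_n[of "2 * k"]] by simp
  then show "?R \<longlonglongrightarrow> \<rho> * (1 + 0) ^ (n - 1) * (if p < s then 0 else 1)"
    by (intro tendsto_intros norm_shift_prod_ratio_tendsto ps)
  show "\<bar>\<rho> * (1 + 0) ^ (n - 1) * (if p < s then 0 else 1)\<bar> < 1" using \<rho> by auto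
qed

lemma gpoch_plus_part:
  assumes "\<eta> \<in> multi_idx n"
  shows "gpoch n k p \<mu> (plus_part n \<eta>)
    = (\<Prod>j<n. \<Prod>i<p. pochhammer (\<mu> i - of_real k * of_nat (sort_rank n \<eta> j)) (\<eta> j))"
  unfolding gpoch_def prod_plus_part[OF assms, of "\<lambda>j. pochhammer (_ - of_real k * of_nat j)"]
  by (rule prod.swap)

lemma gpoch_append_plus_part:
  assumes \<eta>: "\<eta> \<in> multi_idx n"
  shows "cmod (gpoch n k (Suc q) (\<nu>(q := of_real (1 + k * (real n - 1)))) (plus_part n \<eta>))
    = cmod (gpoch n k q \<nu> (plus_part n \<eta>)) * poch_prod \<eta>"
proof -
  let ?c = "1 + k * (real n - 1)"
  have "(\<Prod>j<n. pochhammer (of_real ?c - of_real k * of_nat (sort_rank n \<eta> j)) (\<eta> j))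
    = complex_of_real (poch_prod \<eta>)"
    unfolding poch_prod_def of_real_prod by (simp flip: pochhammer_of_real)
  then show ?thesis
    unfolding gpoch_plus_part[OF \<eta>] using poch_prod_pos[of \<eta>]
    by (simp add: prod.distrib norm_mult del: of_real_add of_real_mult)
qed

lemma hypergeometric_majorant_summable:
  assumes pq: "p \<le> q + 1" and \<rho>: "0 \<le> \<rho>" "p \<le> q \<or> \<rho> < 1"
  shows "(\<lambda>\<eta>. cmod (gpoch n k p \<mu> (plus_part n \<eta>) / gpoch n k q \<nu> (plus_part n \<eta>)) *
    (jackL_one \<eta> / fact (absv n \<eta>)) * \<rho> ^ absv n \<eta>) summable_on multi_idx n"
proof (rule summable_on_comparison_test)
  define \<nu>' where "\<nu>' = \<nu>(q := of_real (1 + k * (real n - 1)))"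
  let ?m = "\<lambda>r. majorant p (Suc q) (\<lambda>i. \<mu> i - of_real k * of_nat r) (\<lambda>i. \<nu>' i - of_real k * of_nat r) \<rho>"
  define H where "H a = (\<Sum>r<n. ?m r a)" for a
  let ?K = "scaled_one (\<lambda>_. 0)"
  have K: "0 < ?K" by (intro scaled_one_pos zero_multi_idx)
  have "0 \<le> H a" for a unfolding H_def using \<rho> by (intro sum_nonneg majorant_nonneg) auto
  moreover have "summable H"
    unfolding H_def[abs_def] using pq \<rho> by (intro summable_sum majorant_summable) auto
  ultimately show "(\<lambda>\<eta>. ?K * (\<Prod>i<n. H (\<eta> i))) summable_on multi_idx n"
    by (intro summable_on_cmult_right summable_on_prod_multi_idx)
  fix \<eta> assume \<eta>: "\<eta> \<in> multi_idx n"
  let ?G = "cmod (gpoch n k p \<mu> (plus_part n \<eta>) / gpoch n k q \<nu> (plus_part n \<eta>))"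
  show "0 \<le> ?G * (jackL_one \<eta> / fact (absv n \<eta>)) * \<rho> ^ absv n \<eta>"
    using jackL_one_pos[OF \<eta>] \<rho> by simp
  have "?G * (jackL_one \<eta> / fact (absv n \<eta>)) * \<rho> ^ absv n \<eta>
    \<le> ?G * (?K * (growth_prod \<eta> / poch_prod \<eta>)) * \<rho> ^ absv n \<eta>"
    using jackL_one_le[OF \<eta>] \<rho> by (intro mult_right_mono mult_left_mono) auto
  also have "\<dots> = ?K * (\<rho> ^ absv n \<eta> * growth_prod \<eta> *
      (cmod (gpoch n k p \<mu> (plus_part n \<eta>)) / cmod (gpoch n k (Suc q) \<nu>' (plus_part n \<eta>))))"
    unfolding \<nu>'_def gpoch_append_plus_part[OF \<eta>] by (simp add: norm_divide)
  also have "\<dots> = ?K * (\<Prod>j<n. ?m (sort_rank n \<eta> j) (\<eta> j))"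
    unfolding gpoch_plus_part[OF \<eta>] growth_prod_def majorant_def absv_def power_sum
    by (simp only: prod_norm[symmetric] prod_dividef prod.distrib)
  also have "\<dots> \<le> ?K * (\<Prod>j<n. H (\<eta> j))"
    using K \<rho> sort_rank_less unfolding H_def
    by (intro mult_left_mono prod_mono conjI majorant_nonneg member_le_sum) auto
  finally show "?G * (jackL_one \<eta> / fact (absv n \<eta>)) * \<rho> ^ absv n \<eta> \<le> ?K * (\<Prod>i<n. H (\<eta> i))" .
qed

end

subsection \<open>Hypergeometric series\<close>

context jack_parameters
begin

definition column_ratio :: "(nat \<Rightarrow> nat) \<Rightarrow> real" where
  "column_ratio \<kappa> = fact (absv n \<kappa> + n) / fact (absv n \<kappa>) / delta_factor \<kappa>"

lemma column_ratio_pos: "0 < column_ratio \<kappa>"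
  using delta_factor_pos[of \<kappa>] by (simp add: column_ratio_def)

lemma jackL_plus_one:
  assumes \<kappa>: "\<kappa> \<in> multi_idx n"
  shows "L (plus_one n \<kappa>) w = of_real (column_ratio \<kappa>) * ((\<Prod>i<n. w i) * L \<kappa> w)"
proof -
  have "jack_coef (plus_one n \<kappa>) = column_ratio \<kappa> * jack_coef \<kappa>"
    using jack_coef_plus_one[OF \<kappa>] delta_factor_pos[of \<kappa>] by (simp add: column_ratio_def field_simps)
  then show ?thesis by (simp add: jackL_eq \<kappa> jackE_plus_one)
qed

lemma jackC_plus_one:
  assumes lam: "is_partition n lam"
  shows "jackC n k (plus_one n lam) w = of_real (column_ratio lam) * ((\<Prod>i<n. w i) * jackC n k lam w)"
proof -
  have multi: "lam \<in> multi_idx n" using lam by (simp add: is_partition_def)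
  have ratio: "column_ratio \<kappa> = column_ratio lam" if \<kappa>: "\<kappa> \<in> orbit lam" for \<kappa>
  proof -
    obtain \<sigma> where "\<sigma> permutes {..<n}" "\<kappa> = lam \<circ> \<sigma>" using orbit_obtain_perm[OF lam \<kappa>] .
    then show ?thesis by (simp only: column_ratio_def delta_factor_comp[OF multi] absv_comp)
  qed
  have "jackC n k (plus_one n lam) w = (\<Sum>\<kappa>\<in>orbit lam. L (plus_one n \<kappa>) w)"
    unfolding jackC_eq by (rule sum.reindex_bij_betw[OF bij_betw_plus_one_orbit[OF lam], symmetric])
  also have "\<dots> = (\<Sum>\<kappa>\<in>orbit lam. of_real (column_ratio lam) * ((\<Prod>i<n. w i) * L \<kappa> w))"
    by (intro sum.cong) (simp_all add: jackL_plus_one orbit_multi ratio)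
  finally show ?thesis by (simp add: jackC_eq sum_distrib_left)
qed

lemma jackC_one_vec: "jackC n k lam one_vec = of_real (\<Sum>\<eta>\<in>orbit lam. jackL_one \<eta>)"
  by (simp add: jackC_eq jackL_one_vec orbit_multi)

lemma jackC_one_pos:
  assumes "is_partition n lam" shows "0 < (\<Sum>\<eta>\<in>orbit lam. jackL_one \<eta>)"
  using partition_in_orbit[OF assms] jackL_one_pos[OF orbit_multi] by (intro sum_pos finite_orbit) auto

lemma jackC_norm_le:
  assumes w: "\<And>i. i < n \<Longrightarrow> cmod (w i) \<le> R"
  shows "cmod (jackC n k lam w) \<le> (\<Sum>\<eta>\<in>orbit lam. jackL_one \<eta>) * R ^ absv n lam"
  unfolding jackC_eq sum_distrib_right
proof (rule sum_norm_le)
  fix \<eta> assume \<eta>: "\<eta> \<in> orbit lam"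
  from jackL_norm_le[OF orbit_multi[OF \<eta>] w] show "cmod (L \<eta> w) \<le> jackL_one \<eta> * R ^ absv n lam"
    by (simp add: orbit_absv[OF \<eta>])
qed

text \<open>The two properties of the quotients \<^term>\<open>L \<eta> w / L \<eta> one_vec\<close> and
  \<^term>\<open>jackC n k lam w / jackC n k lam one_vec\<close> on which the hypergeometric identities rest.\<close>

definition normalized_at :: "(nat \<Rightarrow> complex) \<Rightarrow> ((nat \<Rightarrow> nat) \<Rightarrow> complex) \<Rightarrow> bool" where
  "normalized_at w Q \<longleftrightarrow> (\<forall>\<eta>\<in>multi_idx n. cmod (Q \<eta>) \<le> supnorm n w ^ absv n \<eta> \<and>
    Q (plus_one n \<eta>) = (\<Prod>i<n. w i) * Q \<eta>)"

lemma normalized_at_jackL: "normalized_at w (\<lambda>\<eta>. L \<eta> w / L \<eta> one_vec)"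
  unfolding normalized_at_def
proof (intro ballI conjI)
  fix \<eta> assume \<eta>: "\<eta> \<in> multi_idx n"
  show "cmod (L \<eta> w / L \<eta> one_vec) \<le> supnorm n w ^ absv n \<eta>"
    using jackL_norm_le[where x = w, OF \<eta> supnorm_ge] jackL_one_pos[OF \<eta>]
    by (simp add: jackL_one_vec[OF \<eta>] norm_divide field_simps)
  show "L (plus_one n \<eta>) w / L (plus_one n \<eta>) one_vec = (\<Prod>i<n. w i) * (L \<eta> w / L \<eta> one_vec)"
    using column_ratio_pos[of \<eta>] by (simp add: jackL_plus_one[OF \<eta>] one_vec_def)
qed

lemma normalized_at_jackC:
  "normalized_at w (\<lambda>\<eta>. jackC n k (plus_part n \<eta>) w / jackC n k (plus_part n \<eta>) one_vec)"
  unfolding normalized_at_def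
proof (intro ballI conjI)
  fix \<eta> assume \<eta>: "\<eta> \<in> multi_idx n"
  let ?l = "plus_part n \<eta>"
  note part = is_partition_plus_part[OF \<eta>]
  show "cmod (jackC n k ?l w / jackC n k ?l one_vec) \<le> supnorm n w ^ absv n \<eta>"
    using jackC_norm_le[where w = w and lam = ?l, OF supnorm_ge] jackC_one_pos[OF part]
    unfolding jackC_one_vec norm_divide norm_of_real by (simp add: absv_plus_part[OF \<eta>] field_simps)
  show "jackC n k (plus_part n (plus_one n \<eta>)) w / jackC n k (plus_part n (plus_one n \<eta>)) one_vec
      = (\<Prod>i<n. w i) * (jackC n k ?l w / jackC n k ?l one_vec)"
    using column_ratio_pos[of ?l] by (simp add: plus_part_plus_one[OF \<eta>] jackC_plus_one[OF part] one_vec_def)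
qed

definition hyp_coef :: "nat \<Rightarrow> nat \<Rightarrow> (nat \<Rightarrow> complex) \<Rightarrow> (nat \<Rightarrow> complex) \<Rightarrow> ((nat \<Rightarrow> nat) \<Rightarrow> complex)
    \<Rightarrow> (nat \<Rightarrow> nat) \<Rightarrow> complex" where
  "hyp_coef p q \<mu> \<nu> Q \<eta> =
    gpoch n k p \<mu> (plus_part n \<eta>) / gpoch n k q \<nu> (plus_part n \<eta>) / fact (absv n \<eta>) * Q \<eta>"

lemma gpoch_plus_one: "gpoch n k p \<mu> (plus_one n lam) = gpoch n k p \<mu> (\<lambda>_. 1) * gpoch n k p (\<lambda>i. \<mu> i + 1) lam"
proof -
  have "pochhammer (\<mu> i - of_real k * of_nat j) (plus_one n lam j)
    = pochhammer (\<mu> i - of_real k * of_nat j) 1 * pochhammer (\<mu> i + 1 - of_real k * of_nat j) (lam j)"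
    if "j < n" for i j
    using that by (simp add: plus_one_def pochhammer_rec algebra_simps)
  then show ?thesis unfolding gpoch_def by (simp add: prod.distrib)
qed

lemma hyp_coef_plus_one:
  assumes Q: "normalized_at w Q" and \<kappa>: "\<kappa> \<in> multi_idx n"
  shows "d_coef n (plus_one n \<kappa>) * hyp_coef p q \<mu> \<nu> Q (plus_one n \<kappa>) =
    gpoch n k p \<mu> (\<lambda>_. 1) / gpoch n k q \<nu> (\<lambda>_. 1) * (\<Prod>i<n. w i) *
      hyp_coef p q (\<lambda>i. \<mu> i + 1) (\<lambda>i. \<nu> i + 1) Q \<kappa>"
proof -
  have "Q (plus_one n \<kappa>) = (\<Prod>i<n. w i) * Q \<kappa>" using Q \<kappa> by (simp add: normalized_at_def)
  then show ?thesis
    by (simp add: hyp_coef_def d_coef_plus_one \<kappa> plus_part_plus_one gpoch_plus_one absv_plus_one ac_simps)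
qed

lemma jack_summable_hyp_coef:
  assumes Q: "normalized_at w Q" and pq: "p \<le> q + 1" and r: "0 \<le> r" "p \<le> q \<or> r * supnorm n w < 1"
  shows "jack_summable (hyp_coef p q \<mu> \<nu> Q) r"
  unfolding jack_summable_def
proof (rule summable_on_comparison_test)
  let ?G = "\<lambda>\<eta>. cmod (gpoch n k p \<mu> (plus_part n \<eta>) / gpoch n k q \<nu> (plus_part n \<eta>))"
  show "(\<lambda>\<eta>. ?G \<eta> * (jackL_one \<eta> / fact (absv n \<eta>)) * (r * supnorm n w) ^ absv n \<eta>) summable_on multi_idx n"
    using r supnorm_nonneg by (intro hypergeometric_majorant_summable pq) auto
  fix \<eta> assume \<eta>: "\<eta> \<in> multi_idx n"
  have "cmod (hyp_coef p q \<mu> \<nu> Q \<eta>) = ?G \<eta> / fact (absv n \<eta>) * cmod (Q \<eta>)"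
    by (simp add: hyp_coef_def norm_mult norm_divide)
  also have "\<dots> \<le> ?G \<eta> / fact (absv n \<eta>) * supnorm n w ^ absv n \<eta>"
    using Q \<eta> by (intro mult_left_mono) (simp_all add: normalized_at_def)
  finally have "cmod (hyp_coef p q \<mu> \<nu> Q \<eta>) * jackL_one \<eta> * r ^ absv n \<eta>
    \<le> (?G \<eta> / fact (absv n \<eta>) * supnorm n w ^ absv n \<eta>) * jackL_one \<eta> * r ^ absv n \<eta>"
    using jackL_one_pos[OF \<eta>] r by (intro mult_right_mono) auto
  also have "\<dots> = ?G \<eta> * (jackL_one \<eta> / fact (absv n \<eta>)) * (r * supnorm n w) ^ absv n \<eta>"
    by (simp add: power_mult_distrib)
  finally show "cmod (hyp_coef p q \<mu> \<nu> Q \<eta>) * jackL_one \<eta> * r ^ absv n \<eta>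
    \<le> ?G \<eta> * (jackL_one \<eta> / fact (absv n \<eta>)) * (r * supnorm n w) ^ absv n \<eta>" .
  show "0 \<le> cmod (hyp_coef p q \<mu> \<nu> Q \<eta>) * jackL_one \<eta> * r ^ absv n \<eta>"
    using jackL_one_pos[OF \<eta>] r by simp
qed

lemma conv_dom_iff: "z \<in> conv_dom n p q w \<longleftrightarrow> p \<le> q \<or> supnorm n z * supnorm n w < 1"
  by (simp add: conv_dom_def)

lemma dunkl_Delta_hyp_series:
  assumes Q: "normalized_at w Q" and pq: "p \<le> q + 1" and z: "z \<in> conv_dom n p q w"
    and f: "\<And>x. x \<in> conv_dom n p q w \<Longrightarrow> f x = jack_series (hyp_coef p q \<mu> \<nu> Q) x"
  shows "dunkl_Delta n k f z = gpoch n k p \<mu> (\<lambda>_. 1) / gpoch n k q \<nu> (\<lambda>_. 1) * (\<Prod>i<n. w i) *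
    jack_series (hyp_coef p q (\<lambda>i. \<mu> i + 1) (\<lambda>i. \<nu> i + 1) Q) z"
proof -
  define R where "R = (if p \<le> q \<or> supnorm n w = 0 then supnorm n z + 1 else 1 / supnorm n w)"
  have less_R: "r < 1 / supnorm n w \<longleftrightarrow> r * supnorm n w < 1" if "supnorm n w \<noteq> 0" for r
    using that supnorm_nonneg[of w] by (intro pos_less_divide_eq) simp
  have R: "supnorm n z < R" using z less_R[of "supnorm n z"] by (auto simp: R_def conv_dom_iff)
  have inside: "p \<le> q \<or> r * supnorm n w < 1" if "r < R" for r
    using that less_R[of r] by (cases "supnorm n w = 0") (simp_all add: R_def split: if_splits)
  have "has_jack_series f (hyp_coef p q \<mu> \<nu> Q) R"
    unfolding has_jack_series_def
  proof (intro conjI allI impI)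
    show "jack_summable (hyp_coef p q \<mu> \<nu> Q) r" if "0 \<le> r" "r < R" for r
      using that by (intro jack_summable_hyp_coef[OF Q pq] inside)
    show "f x = jack_series (hyp_coef p q \<mu> \<nu> Q) x" if "supnorm n x < R" for x
      using inside[OF that] by (intro f) (simp add: conv_dom_iff)
  qed
  then have "dunkl_Delta n k f z
    = jack_series (\<lambda>\<kappa>. d_coef n (plus_one n \<kappa>) * hyp_coef p q \<mu> \<nu> Q (plus_one n \<kappa>)) z"
    by (rule dunkl_Delta_jack_series[OF _ R])
  also have "\<dots> = (\<Sum>\<^sub>\<infinity>\<kappa>\<in>multi_idx n. gpoch n k p \<mu> (\<lambda>_. 1) / gpoch n k q \<nu> (\<lambda>_. 1) * (\<Prod>i<n. w i) *
      (hyp_coef p q (\<lambda>i. \<mu> i + 1) (\<lambda>i. \<nu> i + 1) Q \<kappa> * L \<kappa> z))"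
    unfolding jack_series_def by (intro infsum_cong) (simp add: hyp_coef_plus_one[OF Q] mult.assoc)
  also have "\<dots> = gpoch n k p \<mu> (\<lambda>_. 1) / gpoch n k q \<nu> (\<lambda>_. 1) * (\<Prod>i<n. w i) *
      jack_series (hyp_coef p q (\<lambda>i. \<mu> i + 1) (\<lambda>i. \<nu> i + 1) Q) z"
    unfolding jack_series_def by (rule infsum_cmult_right')
  finally show ?thesis .
qed

lemma hypK_eq_jack_series: "hypK n k p q \<mu> \<nu> w = jack_series (hyp_coef p q \<mu> \<nu> (\<lambda>\<eta>. L \<eta> w / L \<eta> one_vec))"
  by (rule ext) (simp add: hypK_def jack_series_def hyp_coef_def mult.assoc)

lemma hypF_eq_jack_series:
  assumes pq: "p \<le> q + 1" and z: "z \<in> conv_dom n p q w"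
  shows "hypF n k p q \<mu> \<nu> w z
    = jack_series (hyp_coef p q \<mu> \<nu> (\<lambda>\<eta>. jackC n k (plus_part n \<eta>) w / jackC n k (plus_part n \<eta>) one_vec)) z"
    (is "_ = jack_series ?A z")
proof -
  let ?P = "{lam. is_partition n lam}"
  let ?term = "\<lambda>lam. gpoch n k p \<mu> lam / gpoch n k q \<nu> lam *
      (jackC n k lam w * jackC n k lam z / (fact (absv n lam) * jackC n k lam one_vec))"
  have "jack_summable ?A (supnorm n z)"
    using z by (intro jack_summable_hyp_coef[OF normalized_at_jackC pq] supnorm_nonneg)
      (simp add: conv_dom_iff)
  then have "((\<lambda>\<eta>. ?A \<eta> * L \<eta> z) has_sum jack_series ?A z) (multi_idx n)"
    by (rule jack_series_has_sum) simp
  moreover have "bij_betw snd (Sigma ?P orbit) (multi_idx n)"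
    by (rule bij_betw_byWitness[where f' = "\<lambda>\<eta>. (plus_part n \<eta>, \<eta>)"])
      (auto simp: orbit_def is_partition_plus_part)
  ultimately have over_orbits: "((\<lambda>(lam, \<eta>). ?A \<eta> * L \<eta> z) has_sum jack_series ?A z) (Sigma ?P orbit)"
    using has_sum_reindex_bij_betw[of snd "Sigma ?P orbit" "multi_idx n" "\<lambda>\<eta>. ?A \<eta> * L \<eta> z"]
    by (simp add: case_prod_unfold)
  have on_orbit: "((\<lambda>\<eta>. ?A \<eta> * L \<eta> z) has_sum ?term lam) (orbit lam)" for lam
  proof -
    have "(\<Sum>\<eta>\<in>orbit lam. ?A \<eta> * L \<eta> z)
      = (\<Sum>\<eta>\<in>orbit lam. gpoch n k p \<mu> lam / gpoch n k q \<nu> lam / fact (absv n lam) *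
          (jackC n k lam w / jackC n k lam one_vec) * L \<eta> z)"
      by (intro sum.cong) (auto simp: hyp_coef_def orbit_def absv_plus_part)
    also have "\<dots> = ?term lam" unfolding sum_distrib_left[symmetric] by (simp add: jackC_eq mult.assoc)
    finally show ?thesis using has_sum_finite[OF finite_orbit, of "\<lambda>\<eta>. ?A \<eta> * L \<eta> z" lam] by simp
  qed
  have "(?term has_sum jack_series ?A z) ?P"
    by (rule has_sum_SigmaD[OF over_orbits]) (simp only: case_prod_conv on_orbit)
  then show ?thesis unfolding hypF_def by (rule infsumI)
qed

lemma dunkl_Delta_hypK:
  assumes "p \<le> q + 1" "z \<in> conv_dom n p q w"
  shows "dunkl_Delta n k (hypK n k p q \<mu> \<nu> w) z = gpoch n k p \<mu> (\<lambda>_. 1) / gpoch n k q \<nu> (\<lambda>_. 1) *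
    (\<Prod>i<n. w i) * hypK n k p q (\<lambda>i. \<mu> i + 1) (\<lambda>i. \<nu> i + 1) w z"
  unfolding hypK_eq_jack_series
  by (rule dunkl_Delta_hyp_series[OF normalized_at_jackL assms refl])

lemma dunkl_Delta_hypF:
  assumes "p \<le> q + 1" "z \<in> conv_dom n p q w"
  shows "dunkl_Delta n k (hypF n k p q \<mu> \<nu> w) z = gpoch n k p \<mu> (\<lambda>_. 1) / gpoch n k q \<nu> (\<lambda>_. 1) *
    (\<Prod>i<n. w i) * hypF n k p q (\<lambda>i. \<mu> i + 1) (\<lambda>i. \<nu> i + 1) w z"
  unfolding hypF_eq_jack_series[OF assms]
  by (rule dunkl_Delta_hyp_series[OF normalized_at_jackC assms hypF_eq_jack_series[OF assms(1)]])

end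

theorem theorem6p10:
  fixes n :: nat and k :: real
  assumes "1 \<le> n" and "0 \<le> k"
  shows
   "(\<exists>a :: (nat \<Rightarrow> nat) \<Rightarrow> real.
       (\<forall>\<eta>\<in>multi_idx n.
          (if (\<forall>i<n. 1 \<le> \<eta> i)
           then dunkl_Delta n k (jackE n k \<eta>) = (\<lambda>x. of_real (a \<eta>) * jackE n k (minus_one \<eta>) x)
           else dunkl_Delta n k (jackE n k \<eta>) = (\<lambda>x. 0) \<and> a \<eta> = 0)) \<and>
       (\<forall>\<eta>\<in>multi_idx n. \<forall>\<sigma>. \<sigma> permutes {..<n} \<longrightarrow> a (\<eta> \<circ> \<sigma>) = a \<eta>))
    \<and> (\<forall>\<eta>\<in>multi_idx n.
          dunkl_Delta n k (jackL n k \<eta>) = (\<lambda>x. d_coef n \<eta> * jackL n k (minus_one \<eta>) x))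
    \<and> (\<forall>lam. is_partition n lam \<longrightarrow>
          dunkl_Delta n k (jackC n k lam) = (\<lambda>x. d_coef n lam * jackC n k (minus_one lam) x))
    \<and> (\<forall>p q (\<mu> :: nat \<Rightarrow> complex) (\<nu> :: nat \<Rightarrow> complex) (w :: nat \<Rightarrow> complex).
          p \<le> q + 1 \<longrightarrow>
          (\<forall>i<q. \<forall>j<n. \<forall>m::nat. \<nu> i \<noteq> of_real k * of_nat j - of_nat m) \<longrightarrow>
          (\<forall>z\<in>conv_dom n p q w.
             dunkl_Delta n k (hypK n k p q \<mu> \<nu> w) z =
               gpoch n k p \<mu> (\<lambda>_. 1) / gpoch n k q \<nu> (\<lambda>_. 1) * (\<Prod>i<n. w i) *
               hypK n k p q (\<lambda>i. \<mu> i + 1) (\<lambda>i. \<nu> i + 1) w z) \<and>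
          (\<forall>z\<in>conv_dom n p q w.
             dunkl_Delta n k (hypF n k p q \<mu> \<nu> w) z =
               gpoch n k p \<mu> (\<lambda>_. 1) / gpoch n k q \<nu> (\<lambda>_. 1) * (\<Prod>i<n. w i) *
               hypF n k p q (\<lambda>i. \<mu> i + 1) (\<lambda>i. \<nu> i + 1) w z))"
    (is "?eigen \<and> ?L \<and> ?C \<and> ?hyp")
proof -
  interpret jack_parameters n k by unfold_locales (fact assms)+
  have ?eigen
  proof (intro exI[of _ delta_eigval] conjI ballI allI impI)
    fix \<eta> assume \<eta>: "\<eta> \<in> multi_idx n"
    show "if \<forall>i<n. 1 \<le> \<eta> i
        then dunkl_Delta n k (jackE n k \<eta>) = (\<lambda>x. of_real (delta_eigval \<eta>) * jackE n k (minus_one \<eta>) x)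
        else dunkl_Delta n k (jackE n k \<eta>) = (\<lambda>x. 0) \<and> delta_eigval \<eta> = 0"
      using dunkl_Delta_jackE[OF \<eta>] by (auto simp: delta_eigval_def)
    show "delta_eigval (\<eta> \<circ> \<sigma>) = delta_eigval \<eta>" if "\<sigma> permutes {..<n}" for \<sigma>
      by (rule delta_eigval_comp[OF \<eta> that])
  qed
  moreover have ?L by (intro ballI dunkl_Delta_jackL)
  moreover have ?C by (intro allI impI dunkl_Delta_jackC)
  moreover have ?hyp by (intro allI impI conjI ballI dunkl_Delta_hypK dunkl_Delta_hypF)
  ultimately show ?thesis by (intro conjI)
qed

end
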